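(* Let $G$ be a biconnected outerplane graph whose weak dual is a tree $T$ with $n$ vertices, and let $c=(c_1,\dots,c_n)$, where $c_i$ is the length of the cycle bounding the interior face $F_i$ of $G$, the face corresponding to vertex $i$ of $T$. For $k\in\{1,\dots,n\}$ let \[\Delta_k=\gcd\left(\left\{ d_X(\mathcal{M})|_{X=c} : \mathcal{M}\in 2M^*_k(T^l)\right\}\right).\] Then $K(G)\cong\mathbb{Z}_{\Delta_1}\oplus\mathbb{Z}_{\Delta_2/\Delta_1}\oplus\cdots\oplus\mathbb{Z}_{\Delta_n/\Delta_{n-1}}$ and $\tau(G)=\Delta_n$.
   Context: An outerplane graph is a graph embedded in the plane with all vertices on the outer face. Its weak dual is its dual graph (one vertex per face, adjacent across shared edges) with the vertex of the outer face removed. $K(G)$ is the sandpile group of $G$, i.e. the torsion subgroup of $\mathbb{Z}^{V(G)}/\operatorname{Im} L(G)$, where $L(G)$ is the Laplacian matrix; $\tau(G)$ is the number of spanning trees of $G$; $\mathbb{Z}_1$ is the trivial group. For the tree $T$ with vertices $1,\dots,n$: $A_X(T)=\operatorname{diag}(x_1,\dots,x_n)-A(T)$, with $A(T)$ the adjacency matrix and $X=(x_1,\dots,x_n)$ indeterminates. $T^l$ is $T$ with a loop added at every vertex. A 2-matching of $T^l$ is a set $\mathcal{M}$ of edges (loops allowed) such that every vertex is incident to at most two edges of $\mathcal{M}$, a loop counting as two incidences at its vertex. $\ell(\mathcal{M})$ is the set of loops in $\mathcal{M}$. A 2-matching $\mathcal{M}$ is minimal if there is no 2-matching $\mathcal{M}'$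 with $|\mathcal{M}'|=|\mathcal{M}|$ and $\ell(\mathcal{M}')\subsetneq\ell(\mathcal{M})$. $2M^*_k(T^l)$ is the set of minimal 2-matchings of $T^l$ with $k$ edges. $d_X(\mathcal{M})$ is the determinant of the principal submatrix of $A_X(T)$ whose rows and columns are the vertices carrying the loops of $\mathcal{M}$ (equal to $1$ if there are no loops). *)

theory Defs
  imports
    "HOL-Analysis.Analysis"
    "HOL-Algebra.Elementary_Groups"
    "HOL-Algebra.Product_Groups"
    "HOL-Algebra.Coset"
begin

section \<open>Multigraphs\<close>

text \<open>Every edge has a set of one or two ends; an edge with a single end is a loop. Parallel
  edges are allowed.\<close>

record ('v, 'e) mgraph =
  verts :: "'v set"
  edges :: "'e set"
  ends :: "'e \<Rightarrow> 'v set"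

definition delete_vert :: "('v, 'e) mgraph \<Rightarrow> 'v \<Rightarrow> ('v, 'e) mgraph" where
  "delete_vert G v = \<lparr>verts = verts G - {v}, edges = {e \<in> edges G. v \<notin> ends G e}, ends = ends G\<rparr>"

definition connected_graph :: "('v, 'e) mgraph \<Rightarrow> bool" where
  "connected_graph G \<longleftrightarrow> verts G \<noteq> {} \<and>
     (\<forall>u \<in> verts G. \<forall>v \<in> verts G. (u, v) \<in> {(x, y). \<exists>e \<in> edges G. ends G e = {x, y}}\<^sup>*)"

definition biconnected :: "('v, 'e) mgraph \<Rightarrow> bool" where
  "biconnected G \<longleftrightarrow> card (verts G) \<ge> 2 \<and> connected_graph G \<and>
     (\<forall>v \<in> verts G. connected_graph (delete_vert G v))"

text \<open>A cycle is given by its vertices and edges in cyclic order. A loop is a cycle of length 1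
  and two parallel edges form a cycle of length 2.\<close>

definition is_cycle :: "('v, 'e) mgraph \<Rightarrow> 'v list \<Rightarrow> 'e list \<Rightarrow> bool" where
  "is_cycle G vs es \<longleftrightarrow>
     es \<noteq> [] \<and> length vs = length es \<and> distinct vs \<and> distinct es \<and>
     set vs \<subseteq> verts G \<and> set es \<subseteq> edges G \<and>
     (\<forall>i < length es. ends G (es ! i) = {vs ! i, vs ! (Suc i mod length es)})"

definition is_tree :: "('v, 'e) mgraph \<Rightarrow> bool" where
  "is_tree G \<longleftrightarrow> connected_graph G \<and> (\<nexists>vs es. is_cycle G vs es)"

definition num_spanning_trees :: "('v, 'e) mgraph \<Rightarrow> nat" where
  "num_spanning_trees G = card {S. S \<subseteq> edges G \<and> is_tree (G\<lparr>edges := S\<rparr>)}"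

definition incidences :: "('v, 'e) mgraph \<Rightarrow> 'e \<Rightarrow> 'v \<Rightarrow> nat" where
  "incidences G e v = (if v \<notin> ends G e then 0 else if card (ends G e) = 1 then 2 else 1)"

definition adjacency :: "('v, 'e) mgraph \<Rightarrow> 'v \<Rightarrow> 'v \<Rightarrow> nat" where
  "adjacency G u v = (\<Sum>e | e \<in> edges G \<and> ends G e = {u, v}. incidences G e u)"

definition laplacian :: "('v, 'e) mgraph \<Rightarrow> 'v \<Rightarrow> 'v \<Rightarrow> int" where
  "laplacian G u v =
     (if u = v then int (\<Sum>e \<in> edges G. incidences G e u) else 0) - int (adjacency G u v)"


section \<open>The sandpile group\<close>

definition int_lattice :: "'v set \<Rightarrow> ('v \<Rightarrow> int) monoid" where
  "int_lattice V = product_group V (\<lambda>_. integer_group)"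

definition laplacian_image :: "('v, 'e) mgraph \<Rightarrow> ('v \<Rightarrow> int) set" where
  "laplacian_image G =
     (\<lambda>f. \<lambda>u \<in> verts G. \<Sum>v \<in> verts G. laplacian G u v * f v) ` carrier (int_lattice (verts G))"

definition torsion_subgroup :: "('a, 'b) monoid_scheme \<Rightarrow> ('a, 'b) monoid_scheme" where
  "torsion_subgroup H =
     H\<lparr>carrier := {x \<in> carrier H. \<exists>m::nat. m > 0 \<and> x [^]\<^bsub>H\<^esub> m = \<one>\<^bsub>H\<^esub>}\<rparr>"

definition sandpile_group :: "('v, 'e) mgraph \<Rightarrow> ('v \<Rightarrow> int) set monoid" where
  "sandpile_group G = torsion_subgroup (int_lattice (verts G) Mod laplacian_image G)"


section \<open>Plane graphs\<close>

text \<open>The plane is the complex plane. A vertex is a point and an edge is (the image of) an arc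
  which meets the vertex set exactly in the two endpoints of the arc; distinct edges can meet in
  vertices only. Parallel edges are possible, loops are not.\<close>

definition plane_graph :: "(complex, complex set) mgraph \<Rightarrow> bool" where
  "plane_graph G \<longleftrightarrow> finite (verts G) \<and> finite (edges G) \<and>
     (\<forall>e \<in> edges G. \<exists>g. arc g \<and> path_image g = e \<and>
        ends G e = {pathstart g, pathfinish g} \<and> e \<inter> verts G = ends G e) \<and>
     (\<forall>e \<in> edges G. \<forall>e' \<in> edges G. e \<noteq> e' \<longrightarrow> e \<inter> e' \<subseteq> verts G)"

definition support :: "(complex, complex set) mgraph \<Rightarrow> complex set" where
  "support G = verts G \<union> \<Union>(edges G)"

definition faces :: "(complex, complex set) mgraph \<Rightarrow> complex set set" where
  "faces G = components (- support G)"

text \<open>The union of the unbounded faces; as the support of a plane graph is compact, there is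
  exactly one unbounded face.\<close>

definition outer_face :: "(complex, complex set) mgraph \<Rightarrow> complex set" where
  "outer_face G = outside (support G)"

definition outerplane :: "(complex, complex set) mgraph \<Rightarrow> bool" where
  "outerplane G \<longleftrightarrow> plane_graph G \<and> verts G \<subseteq> frontier (outer_face G)"

text \<open>Every edge of the plane graph is also an edge of the dual, where it joins the faces having it
  on their boundary (a loop, if there is only one such face).\<close>

definition plane_dual ::
    "(complex, complex set) mgraph \<Rightarrow> (complex set, complex set) mgraph" where
  "plane_dual G =
     \<lparr>verts = faces G, edges = edges G, ends = (\<lambda>e. {F \<in> faces G. e \<subseteq> frontier F})\<rparr>"

definition weak_dual ::
    "(complex, complex set) mgraph \<Rightarrow> (complex set, complex set) mgraph" where
  "weak_dual G = delete_vert (plane_dual G) (outer_face G)"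

definition bounding_cycle_length :: "(complex, complex set) mgraph \<Rightarrow> complex set \<Rightarrow> nat" where
  "bounding_cycle_length G F =
     (THE l. \<exists>vs es. is_cycle G vs es \<and> \<Union>(set es) = frontier F \<and> length es = l)"


section \<open>2-matchings and the polynomials \<open>d\<^sub>X\<close>\<close>

definition with_loops :: "('v, 'e) mgraph \<Rightarrow> ('v, 'e + 'v) mgraph" where
  "with_loops T = \<lparr>verts = verts T, edges = edges T <+> verts T,
     ends = case_sum (ends T) (\<lambda>v. {v})\<rparr>"

definition two_matching :: "('v, 'e) mgraph \<Rightarrow> 'e set \<Rightarrow> bool" where
  "two_matching G M \<longleftrightarrow> M \<subseteq> edges G \<and> (\<forall>v \<in> verts G. (\<Sum>e \<in> M. incidences G e v) \<le> 2)"

definition loops :: "('v, 'e) mgraph \<Rightarrow> 'e set \<Rightarrow> 'e set" where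
  "loops G M = {e \<in> M. card (ends G e) = 1}"

definition minimal_two_matching :: "('v, 'e) mgraph \<Rightarrow> 'e set \<Rightarrow> bool" where
  "minimal_two_matching G M \<longleftrightarrow> two_matching G M \<and>
     (\<nexists>M'. two_matching G M' \<and> card M' = card M \<and> loops G M' \<subset> loops G M)"

definition minimal_two_matchings :: "('v, 'e) mgraph \<Rightarrow> nat \<Rightarrow> 'e set set" where
  "minimal_two_matchings G k = {M. minimal_two_matching G M \<and> card M = k}"

text \<open>Leibniz formula for the determinant of the square matrix \<open>A\<close> with rows and columns indexed by
  the finite set \<open>S\<close>; it is 1 if \<open>S\<close> is empty.\<close>

definition det_on :: "'v set \<Rightarrow> ('v \<Rightarrow> 'v \<Rightarrow> 'r::comm_ring_1) \<Rightarrow> 'r" where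
  "det_on S A = (\<Sum>p | p permutes S. of_int (sign p) * (\<Prod>i \<in> S. A i (p i)))"

text \<open>The values \<open>X v\<close> lie in an arbitrary commutative ring, so \<open>X\<close> may be a family of
  indeterminates as well as the point at which the polynomial is evaluated.\<close>

definition A_matrix :: "('v \<Rightarrow> 'r::comm_ring_1) \<Rightarrow> ('v, 'e) mgraph \<Rightarrow> 'v \<Rightarrow> 'v \<Rightarrow> 'r" where
  "A_matrix X T u v = (if u = v then X u else 0) - of_nat (adjacency T u v)"

definition d_poly ::
    "('v \<Rightarrow> 'r::comm_ring_1) \<Rightarrow> ('v, 'e) mgraph \<Rightarrow> ('e + 'v) set \<Rightarrow> 'r" where
  "d_poly X T M =
     det_on (\<Union>(ends (with_loops T) ` loops (with_loops T) M)) (A_matrix X T)"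

end

theory Submission
  imports Defs
begin

text \<open>Choose a cycle of \<^term>\<open>G\<close> with the largest inside. By Janiszewski's theorem every ear of it lies inside,
  and as no vertex of an outerplane graph lies inside a cycle, this cycle is Hamiltonian and all other
  edges are chords. Adding the chords one at a time splits one face in two; the face boundaries, oriented
  coherently, form a basis of the lattice of integer flows, whose Gram matrix is \<open>A\<^sub>X(T)\<close> at \<open>X = c\<close>. Hence
  \<open>K(G)\<close> is the cokernel of this matrix, and by Cauchy-Binet its determinant counts the spanning trees.

  The invariant factors of the cokernel are quotients of the gcds of the \<open>k\<close>-minors. In a forest a
  nonzero minor \<open>det A[I,J]\<close> determines the directed paths that its terms use from \<open>I - J\<close> to
  \<open>J - I\<close>, because a forest carries no nonzero flow without divergence. So the \<open>k\<close>-minors are, up to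
  sign and zeros, the values \<open>d\<^sub>X(M)\<close> of all 2-matchings \<open>M\<close> with \<open>k\<close> edges. An exchange argument for forests
  shows that the non-minimal \<open>M\<close> contribute nothing new.\<close>

section \<open>Determinants over finite index sets\<close>

text \<open>The cokernel is compared by duality. A vector with sum 0 is the boundary of an integer
  edge function, and two such vectors are congruent modulo the Laplacian exactly when the pairings
  of their edge functions with the face cycles are congruent modulo the Gram matrix. A rational
  basis of the flows would not do for this: the cycles must pair onto all integer vectors, and only
  gradients may pair to zero with all of them. Both properties survive the addition of a chord
  because the chord is a free coordinate, used by the two new cycles only. The Gram matrix has the
  right entries because a boundary pairs with itself to its length, while coherent boundaries
  traverse a shared edge in opposite directions and so contribute -1. The \<open>d_poly\<close> are
  principal minors, whereas invariant factors involve all minors; the gap closes because the entries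
  along the forced paths are all -1, so a nonzero minor is a principal one up to sign. Gcds enter
  only through their sets of divisors, as equivalences for all \<open>g\<close>, which makes signs
  and orders of rows and columns harmless.\<close>

lemma det_on_int: "det_on S (A :: 'a \<Rightarrow> 'a \<Rightarrow> int) = (\<Sum>p | p permutes S. sign p * (\<Prod>i \<in> S. A i (p i)))"
  by (simp add: det_on_def)

lemma det_on_cong:
  assumes "\<And>i j. i \<in> S \<Longrightarrow> j \<in> S \<Longrightarrow> A i j = B i j"
  shows "det_on S A = det_on S B"
  unfolding det_on_def
  by (intro sum.cong refl arg_cong2[where f = "(*)"] prod.cong)
     (auto simp: assms permutes_in_image)

lemma det_on_transpose:
  fixes A :: "'a \<Rightarrow> 'a \<Rightarrow> int"
  assumes "finite S"
  shows "det_on S (\<lambda>i j. A j i) = det_on S A"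
proof -
  have "det_on S A = (\<Sum>p | p permutes S. sign (inv_into UNIV p) * (\<Prod>i \<in> S. A i (inv_into UNIV p i)))"
    unfolding det_on_int
    by (rule sum.reindex_bij_witness[of _ "inv_into UNIV" "inv_into UNIV"])
       (auto simp: permutes_inv permutes_inv_inv)
  also have "\<dots> = (\<Sum>p | p permutes S. sign p * (\<Prod>i \<in> S. A (p i) i))"
  proof (intro sum.cong refl arg_cong2[where f = "(*)"])
    fix p assume "p \<in> {p. p permutes S}"
    then have p: "p permutes S" by simp
    show "sign (inv_into UNIV p) = sign p"
      using p assms permutation_permutes sign_inverse by blast
    have "(\<Prod>i \<in> S. A i (inv_into UNIV p i)) = (\<Prod>i \<in> S. A (p i) (inv_into UNIV p (p i)))"
      by (rule prod.permute[OF p, unfolded o_def])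
    then show "(\<Prod>i \<in> S. A i (inv_into UNIV p i)) = (\<Prod>i \<in> S. A (p i) i)"
      using p by (simp add: permutes_inverses)
  qed
  finally show ?thesis by (simp add: det_on_int)
qed

lemma det_on_permute_cols:
  fixes A :: "'a \<Rightarrow> 'a \<Rightarrow> int"
  assumes "finite S" and q: "q permutes S"
  shows "det_on S (\<lambda>i j. A i (q j)) = sign q * det_on S A"
proof -
  have "det_on S A = (\<Sum>p | p permutes S. sign (q \<circ> p) * (\<Prod>i \<in> S. A i ((q \<circ> p) i)))"
    unfolding det_on_int by (rule setum_permutations_compose_left[OF q])
  also have "\<dots> = (\<Sum>p | p permutes S. sign q * (sign p * (\<Prod>i \<in> S. A i (q (p i)))))"
  proof (intro sum.cong refl)
    fix p assume "p \<in> {p. p permutes S}"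
    then have "sign (q \<circ> p) = sign q * sign p"
      using assms permutes_imp_permutation by (intro sign_compose) blast+
    then show "sign (q \<circ> p) * (\<Prod>i \<in> S. A i ((q \<circ> p) i)) = sign q * (sign p * (\<Prod>i \<in> S. A i (q (p i))))"
      by simp
  qed
  finally have "det_on S A = sign q * det_on S (\<lambda>i j. A i (q j))"
    by (simp add: det_on_int sum_distrib_left)
  then show ?thesis by (simp flip: mult.assoc)
qed

lemma det_on_permute_rows:
  fixes A :: "'a \<Rightarrow> 'a \<Rightarrow> int"
  assumes "finite S" and "q permutes S"
  shows "det_on S (\<lambda>i j. A (q i) j) = sign q * det_on S A"
  using det_on_permute_cols[OF assms, of "\<lambda>i j. A j i"] det_on_transpose[OF assms(1)]
    det_on_transpose[OF assms(1), of "\<lambda>i j. A (q i) j"] by simp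

lemma det_on_eq_rows:
  fixes A :: "'a \<Rightarrow> 'a \<Rightarrow> int"
  assumes "finite S" and ab: "a \<in> S" "b \<in> S" "a \<noteq> b" and "\<And>j. j \<in> S \<Longrightarrow> A a j = A b j"
  shows "det_on S A = 0"
proof -
  have "Transposition.transpose a b permutes S" using ab by (simp add: permutes_swap_id)
  from det_on_permute_rows[OF assms(1) this, of A]
  have "det_on S (\<lambda>i j. A (Transposition.transpose a b i) j) = - det_on S A"
    using ab by (simp add: sign_swap_id)
  moreover have "det_on S (\<lambda>i j. A (Transposition.transpose a b i) j) = det_on S A"
    by (rule det_on_cong) (auto simp: Transposition.transpose_def assms)
  ultimately show ?thesis by simp
qed

lemma det_on_reindex:
  fixes A :: "'b \<Rightarrow> 'b \<Rightarrow> int"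
  assumes "finite K" and f: "inj_on f K"
  shows "det_on (f ` K) A = det_on K (\<lambda>i j. A (f i) (f j))"
proof -
  have bij: "bij_betw f K (f ` K)" using f by (simp add: bij_betw_def)
  have bij_perm: "bij_betw (map_permutation K f) {p. p permutes K} {p. p permutes f ` K}"
    using bij_betw_permutations[OF bij] bij
    by (simp add: map_permutation_def[abs_def] restrict_id_def o_def bij_betw_def)
  have "det_on (f ` K) A =
      (\<Sum>p | p permutes K. sign (map_permutation K f p) * (\<Prod>i \<in> f ` K. A i (map_permutation K f p i)))"
    unfolding det_on_int
    by (rule sum.reindex_bij_betw[OF bij_perm, symmetric])
  also have "\<dots> = (\<Sum>p | p permutes K. sign p * (\<Prod>i \<in> K. A (f i) (f (p i))))"
  proof (intro sum.cong refl arg_cong2[where f = "(*)"])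
    fix p assume "p \<in> {p. p permutes K}"
    then have p: "p permutes K" by simp
    show "sign (map_permutation K f p) = sign p"
      using sign_map_permutation f p assms by blast
    show "(\<Prod>i \<in> f ` K. A i (map_permutation K f p i)) = (\<Prod>i \<in> K. A (f i) (f (p i)))"
      using f by (subst prod.reindex) (auto simp: map_permutation_def restrict_id_def)
  qed
  finally show ?thesis by (simp add: det_on_int)
qed

text \<open>Every row of the product is a combination of rows of \<open>B\<close>, so multilinearity
  sums over all choices \<open>h\<close> of one row of \<open>B\<close> for each \<open>i\<close>.
  The summation index \<open>l\<close> may have a type of its own, which serves the edges in the
  Cauchy-Binet formula.\<close>

lemma det_on_row_expand:
  fixes B :: "'b \<Rightarrow> 'a \<Rightarrow> int"
  assumes "finite S" "finite L"
  shows "det_on S (\<lambda>i j. \<Sum>l\<in>L. E i l * B l j) =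
    (\<Sum>h \<in> S \<rightarrow>\<^sub>E L. (\<Prod>i\<in>S. E i (h i)) * det_on S (\<lambda>i j. B (h i) j))"
proof -
  have "det_on S (\<lambda>i j. \<Sum>l\<in>L. E i l * B l j) =
      (\<Sum>p | p permutes S. \<Sum>h \<in> S \<rightarrow>\<^sub>E L. sign p * ((\<Prod>i\<in>S. E i (h i)) * (\<Prod>i\<in>S. B (h i) (p i))))"
    unfolding det_on_int using assms
    by (simp add: prod_sum_PiE sum_distrib_left prod.distrib)
  also have "\<dots> = (\<Sum>h \<in> S \<rightarrow>\<^sub>E L. \<Sum>p | p permutes S. sign p * ((\<Prod>i\<in>S. E i (h i)) * (\<Prod>i\<in>S. B (h i) (p i))))"
    by (rule sum.swap)
  finally show ?thesis
    unfolding det_on_int by (simp add: sum_distrib_left algebra_simps)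
qed

text \<open>One fixed bijection \<open>b\<close> turns every bijection from \<open>S\<close> to
  \<open>T\<close> into a permutation of \<open>S\<close>; \<open>restrict\<close> and
  \<open>restrict_id\<close> translate between the two conventions outside \<open>S\<close>.\<close>

lemma bij_betw_permutes_PiE:
  assumes "finite S" and b: "bij_betw b S T"
  shows "bij_betw (\<lambda>p. restrict (b \<circ> p) S) {p. p permutes S} {h \<in> S \<rightarrow>\<^sub>E T. inj_on h S \<and> h ` S = T}"
proof (rule bij_betw_byWitness[where f' = "\<lambda>h. restrict_id (inv_into S b \<circ> h) S"])
  have inv: "bij_betw (inv_into S b) T S" using b by (rule bij_betw_inv_into)
  show "\<forall>p\<in>{p. p permutes S}. restrict_id (inv_into S b \<circ> restrict (b \<circ> p) S) S = p"
    using b by (auto simp: fun_eq_iff restrict_id_def permutes_in_image bij_betw_def permutes_not_in)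
  show "\<forall>h\<in>{h \<in> S \<rightarrow>\<^sub>E T. inj_on h S \<and> h ` S = T}. restrict (b \<circ> restrict_id (inv_into S b \<circ> h) S) S = h"
    using b by (fastforce simp: fun_eq_iff restrict_id_def restrict_def f_inv_into_f bij_betw_def)
  show "(\<lambda>p. restrict (b \<circ> p) S) ` {p. p permutes S} \<subseteq> {h \<in> S \<rightarrow>\<^sub>E T. inj_on h S \<and> h ` S = T}"
  proof (clarify, intro conjI)
    fix p assume p: "p permutes S"
    have "bij_betw (b \<circ> p) S T"
      using bij_betw_trans[OF permutes_imp_bij[OF p] b] .
    then show "restrict (b \<circ> p) S \<in> S \<rightarrow>\<^sub>E T" "inj_on (restrict (b \<circ> p) S) S" "restrict (b \<circ> p) S ` S = T"
      by (auto simp: bij_betw_def)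
  qed
  show "(\<lambda>h. restrict_id (inv_into S b \<circ> h) S) ` {h \<in> S \<rightarrow>\<^sub>E T. inj_on h S \<and> h ` S = T} \<subseteq> {p. p permutes S}"
  proof (clarify)
    fix h assume "inj_on h S" "T = h ` S"
    then have "bij_betw (inv_into S b \<circ> h) S S"
      using inv by (intro bij_betw_trans[where B = T]) (auto simp: bij_betw_def)
    then have "bij_betw (restrict_id (inv_into S b \<circ> h) S) S S"
      by (rule bij_betw_cong[THEN iffD1, rotated]) (auto simp: restrict_id_def)
    then show "restrict_id (inv_into S b \<circ> h) S permutes S"
      by (rule bij_imp_permutes) (auto simp: restrict_id_def)
  qed
qed

text \<open>A non-injective choice of rows repeats a row and contributes 0; the injective ones are
  grouped by their image \<open>T\<close>. The enumerations \<open>b T\<close> are arbitrary, since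
  each occurs in both factors and its sign cancels.\<close>

theorem Cauchy_Binet_det_on:
  fixes M :: "'a \<Rightarrow> 'e \<Rightarrow> int" and M' :: "'e \<Rightarrow> 'a \<Rightarrow> int"
  assumes fin: "finite S" "finite E"
    and b: "\<And>T. T \<subseteq> E \<Longrightarrow> card T = card S \<Longrightarrow> bij_betw (b T) S T"
  shows "det_on S (\<lambda>i j. \<Sum>e\<in>E. M i e * M' e j) =
    (\<Sum>T | T \<subseteq> E \<and> card T = card S. det_on S (\<lambda>i j. M i (b T j)) * det_on S (\<lambda>i j. M' (b T i) j))"
proof -
  let ?t = "\<lambda>h. (\<Prod>i\<in>S. M i (h i)) * det_on S (\<lambda>i j. M' (h i) j)"
  let ?TT = "{T. T \<subseteq> E \<and> card T = card S}"
  let ?H = "\<lambda>T. {h \<in> S \<rightarrow>\<^sub>E T. inj_on h S \<and> h ` S = T}"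
  have "det_on S (\<lambda>i j. \<Sum>e\<in>E. M i e * M' e j) = (\<Sum>h \<in> S \<rightarrow>\<^sub>E E. ?t h)"
    by (rule det_on_row_expand[OF fin])
  also have "\<dots> = (\<Sum>h \<in> (\<Union>T\<in>?TT. ?H T). ?t h)"
  proof (rule sum.mono_neutral_right)
    show "finite (S \<rightarrow>\<^sub>E E)" using fin by (simp add: finite_PiE)
    show "(\<Union>T\<in>?TT. ?H T) \<subseteq> S \<rightarrow>\<^sub>E E" by (auto simp: PiE_def Pi_def)
    show "\<forall>h\<in>(S \<rightarrow>\<^sub>E E) - (\<Union>T\<in>?TT. ?H T). ?t h = 0"
    proof
      fix h assume h: "h \<in> (S \<rightarrow>\<^sub>E E) - (\<Union>T\<in>?TT. ?H T)"
      have "\<not> inj_on h S"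
      proof
        assume inj: "inj_on h S"
        have "h ` S \<in> ?TT" "h \<in> ?H (h ` S)"
          using h inj by (auto simp: PiE_iff card_image)
        then show False using h by blast
      qed
      then obtain a c where "a \<in> S" "c \<in> S" "a \<noteq> c" "h a = h c" by (auto simp: inj_on_def)
      then have "det_on S (\<lambda>i j. M' (h i) j) = 0"
        by (intro det_on_eq_rows[of S a c]) (auto simp: fin)
      then show "?t h = 0" by simp
    qed
  qed
  also have "\<dots> = (\<Sum>T\<in>?TT. \<Sum>h\<in>?H T. ?t h)"
  proof (rule sum.UNION_disjoint)
    show "finite ?TT" using fin by simp
    show "\<forall>T\<in>?TT. finite (?H T)"
    proof
      fix T assume "T \<in> ?TT"
      then have "finite T" using fin finite_subset by blast
      then show "finite (?H T)" using fin by (simp add: finite_PiE)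
    qed
    show "\<forall>T\<in>?TT. \<forall>T'\<in>?TT. T \<noteq> T' \<longrightarrow> ?H T \<inter> ?H T' = {}" by blast
  qed
  also have "\<dots> = (\<Sum>T\<in>?TT. det_on S (\<lambda>i j. M i (b T j)) * det_on S (\<lambda>i j. M' (b T i) j))"
  proof (rule sum.cong[OF refl])
    fix T assume "T \<in> ?TT"
    then have bT: "bij_betw (b T) S T" using b by simp
    have "(\<Sum>h\<in>?H T. ?t h) = (\<Sum>p | p permutes S. ?t (restrict (b T \<circ> p) S))"
      by (rule sum.reindex_bij_betw[OF bij_betw_permutes_PiE[OF fin(1) bT], symmetric])
    also have "\<dots> = (\<Sum>p | p permutes S. (\<Prod>i\<in>S. M i (b T (p i))) * (sign p * det_on S (\<lambda>i j. M' (b T i) j)))"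
    proof (intro sum.cong refl arg_cong2[where f = "(*)"])
      fix p assume p: "p \<in> {p. p permutes S}"
      have "det_on S (\<lambda>i. M' (restrict (b T \<circ> p) S i)) = det_on S (\<lambda>i j. M' (b T (p i)) j)"
        by (rule det_on_cong) auto
      also have "\<dots> = sign p * det_on S (\<lambda>i j. M' (b T i) j)"
        using det_on_permute_rows[OF fin(1), of p "\<lambda>i j. M' (b T i) j"] p by simp
      finally show "det_on S (\<lambda>i. M' (restrict (b T \<circ> p) S i)) = sign p * det_on S (\<lambda>i j. M' (b T i) j)" .
    qed auto
    finally show "(\<Sum>h\<in>?H T. ?t h) = det_on S (\<lambda>i j. M i (b T j)) * det_on S (\<lambda>i j. M' (b T i) j)"
      unfolding det_on_int[of S "\<lambda>i j. M i (b T j)"]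
      by (simp add: sum_distrib_left sum_distrib_right algebra_simps)
  qed
  finally show ?thesis .
qed

corollary det_on_mult:
  fixes A B :: "'a \<Rightarrow> 'a \<Rightarrow> int"
  assumes "finite S"
  shows "det_on S (\<lambda>i j. \<Sum>l\<in>S. A i l * B l j) = det_on S A * det_on S B"
proof -
  have eq: "{T. T \<subseteq> S \<and> card T = card S} = {S}"
    using assms card_subset_eq by blast
  have "bij_betw id S T" if "T \<subseteq> S" "card T = card S" for T
    using that assms card_subset_eq[of S T] by simp
  from Cauchy_Binet_det_on[OF assms assms, of "\<lambda>_. id" A B, OF this] show ?thesis
    by (simp add: eq)
qed

lemma det_on_identity:
  assumes "finite S"
  shows "det_on S (\<lambda>i j. if i = j then 1 else 0 :: int) = 1"
proof -
  have "det_on S (\<lambda>i j. if i = j then 1 else 0 :: int) =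
      (\<Sum>p | p permutes S. if p = id then 1 else 0)"
    unfolding det_on_int
  proof (intro sum.cong refl)
    fix p assume p: "p \<in> {p. p permutes S}"
    show "sign p * (\<Prod>i\<in>S. if i = p i then 1 else 0) = (if p = id then 1 else 0)"
    proof (cases "p = id")
      case False
      then obtain i where "p i \<noteq> i" by (auto simp: fun_eq_iff)
      then have "i \<in> S" using p permutes_not_in by fastforce
      then have "(\<Prod>i\<in>S. if i = p i then 1 else 0 :: int) = 0"
        using \<open>p i \<noteq> i\<close> assms by (metis (mono_tags, lifting) prod_zero)
      then show ?thesis using False by simp
    qed simp
  qed
  also have "\<dots> = 1" using assms by (simp add: finite_permutations permutes_id)
  finally show ?thesis .
qed

text \<open>Laplace expansion along row \<open>v\<close>. The minor without column \<open>w\<close>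
  is kept on the index set \<open>S\<close>: the transposition lets column \<open>v\<close> take the
  place of column \<open>w\<close>, and this exchange is the source of the sign -1.\<close>

lemma det_on_insert:
  fixes A :: "'a \<Rightarrow> 'a \<Rightarrow> int"
  assumes "finite S" "v \<notin> S"
  shows "det_on (insert v S) A = (\<Sum>w\<in>insert v S.
    (if v = w then 1 else - 1) * A v w * det_on S (\<lambda>i j. A i (Transposition.transpose v w j)))"
proof -
  have "det_on (insert v S) A = (\<Sum>w\<in>insert v S. \<Sum>q | q permutes S.
      sign (Transposition.transpose v w \<circ> q) * (\<Prod>i \<in> insert v S. A i ((Transposition.transpose v w \<circ> q) i)))"
    unfolding det_on_int by (rule sum_over_permutations_insert[OF assms])
  also have "\<dots> = (\<Sum>w\<in>insert v S. \<Sum>q | q permutes S.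
      (if v = w then 1 else - 1) * A v w * (sign q * (\<Prod>i \<in> S. A i (Transposition.transpose v w (q i)))))"
  proof (intro sum.cong refl)
    fix w q assume "q \<in> {q. q permutes S}"
    then have q: "q permutes S" by simp
    then have "q v = v" using assms permutes_not_in by metis
    moreover have "sign (Transposition.transpose v w \<circ> q) = (if v = w then 1 else - 1) * sign q"
      using q assms permutation_permutes
      by (subst sign_compose) (auto simp: permutation_swap_id sign_swap_id)
    ultimately show "sign (Transposition.transpose v w \<circ> q) * (\<Prod>i \<in> insert v S. A i ((Transposition.transpose v w \<circ> q) i)) =
      (if v = w then 1 else - 1) * A v w * (sign q * (\<Prod>i \<in> S. A i (Transposition.transpose v w (q i))))"
      using assms by simp
  qed
  finally show ?thesis by (simp add: det_on_int sum_distrib_left)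
qed


section \<open>Smith normal form\<close>

definition im_on :: "'a set \<Rightarrow> ('a \<Rightarrow> 'a \<Rightarrow> int) \<Rightarrow> ('a \<Rightarrow> int) \<Rightarrow> bool" where
  "im_on S A x \<longleftrightarrow> (\<exists>f. \<forall>i\<in>S. x i = (\<Sum>j\<in>S. A i j * f j))"

text \<open>The gcd of the k-minors is encoded by its divisors \<open>g\<close>. The index maps may
  repeat values: repeated rows or columns give determinant 0, and products of matrices can then be
  expanded without sorting indices.\<close>

definition minors_dvd :: "'a set \<Rightarrow> nat \<Rightarrow> ('a \<Rightarrow> 'a \<Rightarrow> int) \<Rightarrow> int \<Rightarrow> bool" where
  "minors_dvd S k A g \<longleftrightarrow>
     (\<forall>f\<in>{..<k} \<rightarrow> S. \<forall>h\<in>{..<k} \<rightarrow> S. g dvd det_on {..<k} (\<lambda>i j. A (f i) (h j)))"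

text \<open>Here a minor is indexed by its row set \<open>I\<close>, with \<open>\<beta>\<close>
  naming the columns. Enumerating \<open>I\<close> does not change the determinant, and index maps
  that repeat a value give 0.\<close>

lemma minors_dvd_iff:
  assumes "finite S"
  shows "minors_dvd S k A g \<longleftrightarrow> (\<forall>I \<beta>. I \<subseteq> S \<and> card I = k \<and> inj_on \<beta> I \<and> \<beta> ` I \<subseteq> S \<longrightarrow>
    g dvd det_on I (\<lambda>i j. A i (\<beta> j)))"
proof (intro iffI allI impI)
  fix I \<beta> assume *: "minors_dvd S k A g" and I: "I \<subseteq> S \<and> card I = k \<and> inj_on \<beta> I \<and> \<beta> ` I \<subseteq> S"
  then have "finite I" using assms finite_subset by blast
  then obtain b where "bij_betw b {..<k} I"
    using I ex_bij_betw_nat_finite by (metis atLeast0LessThan)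
  then have b: "inj_on b {..<k}" "I = b ` {..<k}" by (auto simp: bij_betw_def)
  have "det_on I (\<lambda>i j. A i (\<beta> j)) = det_on {..<k} (\<lambda>i j. A (b i) (\<beta> (b j)))"
    unfolding b(2) by (rule det_on_reindex) (use b in auto)
  then show "g dvd det_on I (\<lambda>i j. A i (\<beta> j))"
    using *[unfolded minors_dvd_def, THEN bspec[of _ _ b], THEN bspec[of _ _ "\<beta> \<circ> b"]] I b
    by (simp add: Pi_iff image_subset_iff)
next
  assume *: "\<forall>I \<beta>. I \<subseteq> S \<and> card I = k \<and> inj_on \<beta> I \<and> \<beta> ` I \<subseteq> S \<longrightarrow> g dvd det_on I (\<lambda>i j. A i (\<beta> j))"
  show "minors_dvd S k A g"
    unfolding minors_dvd_def
  proof (intro ballI)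
    fix f h assume f: "f \<in> {..<k} \<rightarrow> S" and h: "h \<in> {..<k} \<rightarrow> S"
    show "g dvd det_on {..<k} (\<lambda>i j. A (f i) (h j))"
    proof (cases "inj_on f {..<k} \<and> inj_on h {..<k}")
      case True
      let ?\<beta> = "h \<circ> inv_into {..<k} f"
      have "inj_on ?\<beta> (f ` {..<k})"
        using True by (intro comp_inj_on) (auto intro: inj_on_inv_into simp: inv_into_into)
      moreover have "?\<beta> ` f ` {..<k} \<subseteq> S"
        using True h by (auto simp: inv_into_f_f)
      ultimately have "g dvd det_on (f ` {..<k}) (\<lambda>i j. A i (?\<beta> j))"
        using f True by (intro *[rule_format] conjI) (auto simp: card_image o_def)
      also have "det_on (f ` {..<k}) (\<lambda>i j. A i (?\<beta> j)) = det_on {..<k} (\<lambda>i j. A (f i) (?\<beta> (f j)))"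
        using True by (intro det_on_reindex) auto
      also have "\<dots> = det_on {..<k} (\<lambda>i j. A (f i) (h j))"
        using True by (intro det_on_cong) auto
      finally show ?thesis .
    next
      case False
      then consider "\<not> inj_on f {..<k}" | "\<not> inj_on h {..<k}" by blast
      then have "det_on {..<k} (\<lambda>i j. A (f i) (h j)) = 0"
      proof cases
        case 1
        then obtain a c where "a \<in> {..<k}" "c \<in> {..<k}" "a \<noteq> c" "f a = f c" by (auto simp: inj_on_def)
        then show ?thesis by (intro det_on_eq_rows[of _ a c]) auto
      next
        case 2
        then obtain a c where "a \<in> {..<k}" "c \<in> {..<k}" "a \<noteq> c" "h a = h c" by (auto simp: inj_on_def)
        then have "det_on {..<k} (\<lambda>i j. A (f j) (h i)) = 0" by (intro det_on_eq_rows[of _ a c]) auto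
        then show ?thesis using det_on_transpose[of "{..<k}" "\<lambda>i j. A (f i) (h j)"] by simp
      qed
      then show ?thesis by simp
    qed
  qed
qed

text \<open>An injection of the finite set \<open>S\<close> into itself is a permutation, so the
  full minors are the determinant up to sign.\<close>

lemma minors_dvd_card:
  assumes "finite S"
  shows "minors_dvd S (card S) A g \<longleftrightarrow> g dvd det_on S A"
proof
  assume "minors_dvd S (card S) A g"
  then show "g dvd det_on S A"
    unfolding minors_dvd_iff[OF assms] using spec[of _ "\<lambda>x. x"] by fastforce
next
  assume g: "g dvd det_on S A"
  show "minors_dvd S (card S) A g"
    unfolding minors_dvd_iff[OF assms]
  proof (intro allI impI, elim conjE)
    fix I \<beta> assume "I \<subseteq> S" "card I = card S" and \<beta>: "inj_on \<beta> I" "\<beta> ` I \<subseteq> S"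
    then have I: "I = S" using assms card_subset_eq by blast
    define q where "q = restrict_id \<beta> S"
    have "bij_betw \<beta> S S"
      using \<beta> I assms by (simp add: bij_betw_def endo_inj_surj)
    then have "bij_betw q S S"
      by (rule bij_betw_cong[THEN iffD1, rotated]) (auto simp: q_def)
    then have q: "q permutes S"
      by (rule bij_imp_permutes) (auto simp: q_def)
    have "det_on I (\<lambda>i j. A i (\<beta> j)) = det_on S (\<lambda>i j. A i (q j))"
      unfolding I by (rule det_on_cong) (auto simp: q_def)
    also have "\<dots> = sign q * det_on S A"
      by (rule det_on_permute_cols[OF assms q])
    finally show "g dvd det_on I (\<lambda>i j. A i (\<beta> j))" using g by simp
  qed
qed

lemma minors_dvd_transpose: "minors_dvd S k (\<lambda>i j. A j i) g \<longleftrightarrow> minors_dvd S k A g"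
proof -
  have "det_on {..<k} (\<lambda>i j. A (h j) (f i)) = det_on {..<k} (\<lambda>i j. A (h i) (f j))" for f h
    using det_on_transpose[of "{..<k}" "\<lambda>i j. A (h i) (f j)"] by simp
  then show ?thesis unfolding minors_dvd_def by auto
qed

lemma minors_dvd_mult:
  assumes "finite S" and "minors_dvd S k A g"
    and B: "\<And>i j. i \<in> S \<Longrightarrow> j \<in> S \<Longrightarrow> B i j = (\<Sum>l\<in>S. E i l * A l j)"
  shows "minors_dvd S k B g"
  unfolding minors_dvd_def
proof (intro ballI)
  fix f h assume f: "f \<in> {..<k} \<rightarrow> S" and h: "h \<in> {..<k} \<rightarrow> S"
  have "det_on {..<k} (\<lambda>i j. B (f i) (h j)) = det_on {..<k} (\<lambda>i j. \<Sum>l\<in>S. E (f i) l * A l (h j))"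
    using f h by (intro det_on_cong) (auto simp: B Pi_iff)
  also have "\<dots> = (\<Sum>r \<in> {..<k} \<rightarrow>\<^sub>E S. (\<Prod>i\<in>{..<k}. E (f i) (r i)) * det_on {..<k} (\<lambda>i j. A (r i) (h j)))"
    using assms by (intro det_on_row_expand) auto
  also have "g dvd \<dots>"
    using assms(2) h unfolding minors_dvd_def by (intro dvd_sum dvd_mult) (auto simp: PiE_iff Pi_iff)
  finally show "g dvd det_on {..<k} (\<lambda>i j. B (f i) (h j))" .
qed

section \<open>Elementary row and column operations\<close>

definition row_add :: "'a \<Rightarrow> 'a \<Rightarrow> int \<Rightarrow> ('a \<Rightarrow> 'a \<Rightarrow> int) \<Rightarrow> 'a \<Rightarrow> 'a \<Rightarrow> int" where
  "row_add a b c A = (\<lambda>i j. if i = a then A a j + c * A b j else A i j)"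

definition col_add :: "'a \<Rightarrow> 'a \<Rightarrow> int \<Rightarrow> ('a \<Rightarrow> 'a \<Rightarrow> int) \<Rightarrow> 'a \<Rightarrow> 'a \<Rightarrow> int" where
  "col_add a b c A = (\<lambda>i j. if j = a then A i a + c * A i b else A i j)"

lemma row_add_inverse: "a \<noteq> b \<Longrightarrow> row_add a b (- c) (row_add a b c A) = A"
  by (auto simp: row_add_def fun_eq_iff)

lemma col_add_inverse: "a \<noteq> b \<Longrightarrow> col_add a b (- c) (col_add a b c A) = A"
  by (auto simp: col_add_def fun_eq_iff)

lemma minors_dvd_row_add_aux:
  assumes "finite S" "a \<in> S" "b \<in> S" "minors_dvd S k A g"
  shows "minors_dvd S k (row_add a b c A) g"
proof (rule minors_dvd_mult[OF assms(1,4)])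
  fix i j assume "i \<in> S" "j \<in> S"
  \<comment> \<open>The multiplier is the identity matrix with \<open>c\<close> added in position
    \<open>(a, b)\<close>.\<close>
  show "row_add a b c A i j = (\<Sum>l\<in>S. ((if l = i then 1 else 0) + (if l = b then if i = a then c else 0 else 0)) * A l j)"
    using assms \<open>i \<in> S\<close> by (simp add: row_add_def distrib_right sum.distrib if_distrib[of "\<lambda>x. x * _"] cong: if_cong)
qed

lemma minors_dvd_row_add:
  assumes "finite S" "a \<in> S" "b \<in> S" "a \<noteq> b"
  shows "minors_dvd S k (row_add a b c A) g \<longleftrightarrow> minors_dvd S k A g"
  using minors_dvd_row_add_aux[OF assms(1-3)] row_add_inverse[OF assms(4)] by metis

lemma minors_dvd_col_add:
  assumes "finite S" "a \<in> S" "b \<in> S" "a \<noteq> b"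
  shows "minors_dvd S k (col_add a b c A) g \<longleftrightarrow> minors_dvd S k A g"
proof -
  have "(\<lambda>i j. col_add a b c A j i) = row_add a b c (\<lambda>i j. A j i)"
    by (auto simp: col_add_def row_add_def)
  then show ?thesis
    using minors_dvd_row_add[OF assms, of k c "\<lambda>i j. A j i" g] minors_dvd_transpose by metis
qed

text \<open>Additions alone generate the equivalence. They can also carry an entry onto the
  diagonal, and diagonal entries may end up negative; \<open>cokernel_Smith\<close> passes to
  absolute values.\<close>

inductive equiv_mat :: "'a set \<Rightarrow> ('a \<Rightarrow> 'a \<Rightarrow> int) \<Rightarrow> ('a \<Rightarrow> 'a \<Rightarrow> int) \<Rightarrow> bool"
  for S A where
  same: "equiv_mat S A A"
| row: "equiv_mat S A B \<Longrightarrow> a \<in> S \<Longrightarrow> b \<in> S \<Longrightarrow> a \<noteq> b \<Longrightarrow> equiv_mat S A (row_add a b c B)"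
| col: "equiv_mat S A B \<Longrightarrow> a \<in> S \<Longrightarrow> b \<in> S \<Longrightarrow> a \<noteq> b \<Longrightarrow> equiv_mat S A (col_add a b c B)"

lemma equiv_mat_minors_dvd:
  assumes "equiv_mat S A B" "finite S"
  shows "minors_dvd S k B g \<longleftrightarrow> minors_dvd S k A g"
  using assms by induction (auto simp: minors_dvd_row_add minors_dvd_col_add)

lemma im_on_col_add_aux:
  assumes "finite S" "a \<in> S" "b \<in> S" "a \<noteq> b" "im_on S (col_add a b c A) x"
  shows "im_on S A x"
proof -
  obtain f where f: "\<And>i. i \<in> S \<Longrightarrow> x i = (\<Sum>j\<in>S. col_add a b c A i j * f j)"
    using assms by (auto simp: im_on_def)
  \<comment> \<open>Column \<open>a\<close> now contains \<open>c\<close> times column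
    \<open>b\<close>, so its coefficient \<open>f a\<close> is also counted \<open>c\<close> times
    at \<open>b\<close>.\<close>
  have "x i = (\<Sum>j\<in>S. A i j * (f j + (if j = b then c * f a else 0)))" if "i \<in> S" for i
  proof -
    have "(\<Sum>j\<in>S. col_add a b c A i j * f j) = (\<Sum>j\<in>S. A i j * f j + (if j = a then c * A i b * f a else 0))"
      by (intro sum.cong) (auto simp: col_add_def algebra_simps)
    also have "\<dots> = (\<Sum>j\<in>S. A i j * f j) + c * A i b * f a"
      using assms by (simp add: sum.distrib)
    also have "\<dots> = (\<Sum>j\<in>S. A i j * (f j + (if j = b then c * f a else 0)))"
      using assms by (simp add: distrib_left sum.distrib if_distrib[of "\<lambda>x. _ * x"] cong: if_cong)
    finally show ?thesis using f that by simp
  qed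
  then show ?thesis unfolding im_on_def by (intro exI ballI)
qed

lemma im_on_col_add:
  assumes "finite S" "a \<in> S" "b \<in> S" "a \<noteq> b"
  shows "im_on S (col_add a b c A) x \<longleftrightarrow> im_on S A x"
  using im_on_col_add_aux[OF assms] im_on_col_add_aux[OF assms, of "- c" "col_add a b c A"]
    col_add_inverse[OF assms(4)] by metis

lemma im_on_row_add:
  assumes "finite S" "a \<in> S" "b \<in> S" "a \<noteq> b"
  shows "im_on S (row_add a b c A) (x(a := x a + c * x b)) \<longleftrightarrow> im_on S A x"
proof -
  have "(\<forall>i\<in>S. (x(a := x a + c * x b)) i = (\<Sum>j\<in>S. row_add a b c A i j * f j)) \<longleftrightarrow>
        (\<forall>i\<in>S. x i = (\<Sum>j\<in>S. A i j * f j))" (is "?l \<longleftrightarrow> ?r") for f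
  proof -
    have 1: "(\<Sum>j\<in>S. row_add a b c A i j * f j) =
        (\<Sum>j\<in>S. A i j * f j) + (if i = a then c * (\<Sum>j\<in>S. A b j * f j) else 0)" for i
      by (auto simp: row_add_def distrib_right sum.distrib sum_distrib_left mult.assoc)
    show ?thesis
    proof
      assume l: ?l
      then have "x b = (\<Sum>j\<in>S. A b j * f j)" using assms 1 by fastforce
      then show ?r using l assms 1 by (auto split: if_splits)
    next
      assume ?r then show ?l using assms 1 by auto
    qed
  qed
  then show ?thesis unfolding im_on_def by presburger
qed

text \<open>A column operation only changes the coefficients, while a row operation has to be
  applied to \<open>x\<close> as well; \<open>h\<close> collects the latter. Its additivity and
  surjectivity later make it a system of coordinates on the cokernel.\<close>

lemma equiv_mat_im_on:
  assumes "equiv_mat S A B" "finite S"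
  shows "\<exists>h. (\<forall>x y. h (\<lambda>i. x i + y i) = (\<lambda>i. h x i + h y i)) \<and> surj h \<and> (\<forall>x. im_on S A x \<longleftrightarrow> im_on S B (h x))"
  using assms
proof induction
  case same
  then show ?case by (intro exI[of _ "\<lambda>x. x"]) auto
next
  case (row B a b c)
  then obtain h where h: "\<And>x y. h (\<lambda>i. x i + y i) = (\<lambda>i. h x i + h y i)" "surj h"
    "\<And>x. im_on S A x \<longleftrightarrow> im_on S B (h x)" by auto
  let ?r = "\<lambda>x. x(a := x a + c * x b)"
  have "surj ?r"
  proof (rule surjI)
    fix y show "?r (y(a := y a - c * y b)) = y" using row by auto
  qed
  with h(2) have "surj (?r \<circ> h)" using comp_surj by blast
  then show ?case
    using h im_on_row_add[OF \<open>finite S\<close> row(2-4)]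
    by (intro exI[of _ "?r \<circ> h"] conjI allI) (simp_all add: fun_eq_iff algebra_simps del: fun_upd_apply, simp)
next
  case (col B a b c)
  then show ?case using im_on_col_add[OF \<open>finite S\<close> col(2-4)] by auto
qed

text \<open>Operations with indices in \<open>S - {a}\<close> do not disturb the cleared row and
  column of the pivot and commute with the factor \<open>m\<close>. Thus a reduction of the smaller
  matrix \<open>C\<close> lifts to the whole matrix.\<close>

lemma equiv_mat_block:
  assumes "equiv_mat (S - {a}) C D" "equiv_mat S A B" "a \<in> S"
    and "\<And>i j. i \<in> S \<Longrightarrow> j \<in> S \<Longrightarrow> B i j = (if i = a \<and> j = a then m else if i = a \<or> j = a then 0 else m * C i j)"
  shows "\<exists>B'. equiv_mat S A B' \<and> (\<forall>i\<in>S. \<forall>j\<in>S.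
    B' i j = (if i = a \<and> j = a then m else if i = a \<or> j = a then 0 else m * D i j))"
  using assms
proof induction
  case same
  then show ?case by blast
next
  case (row D u v c)
  then obtain B' where B': "equiv_mat S A B'" "\<And>i j. i \<in> S \<Longrightarrow> j \<in> S \<Longrightarrow>
    B' i j = (if i = a \<and> j = a then m else if i = a \<or> j = a then 0 else m * D i j)" by blast
  show ?case
    by (rule exI[of _ "row_add u v c B'"], intro conjI equiv_mat.row B' ballI)
       (use row B' in \<open>auto simp: row_add_def algebra_simps\<close>)
next
  case (col D u v c)
  then obtain B' where B': "equiv_mat S A B'" "\<And>i j. i \<in> S \<Longrightarrow> j \<in> S \<Longrightarrow>
    B' i j = (if i = a \<and> j = a then m else if i = a \<or> j = a then 0 else m * D i j)" by blast
  show ?case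
    by (rule exI[of _ "col_add u v c B'"], intro conjI equiv_mat.col B' ballI)
       (use col B' in \<open>auto simp: col_add_def algebra_simps\<close>)
qed

text \<open>A pivot of least absolute value among all equivalent matrices divides every entry once its row
  and column have been cleared, so a common factor splits off and the divisibility chain is automatic.\<close>

lemma equiv_mat_pivot:
  assumes "finite S" "i0 \<in> S" "j0 \<in> S" "A i0 j0 \<noteq> 0"
  shows "\<exists>a m B. a \<in> S \<and> equiv_mat S A B \<and> B a a = m \<and>
    (\<forall>i\<in>S. i \<noteq> a \<longrightarrow> B i a = 0 \<and> B a i = 0) \<and> (\<forall>i\<in>S. \<forall>j\<in>S. m dvd B i j)"
proof -
  define P where "P m \<longleftrightarrow> (\<exists>B i j. equiv_mat S A B \<and> i \<in> S \<and> j \<in> S \<and> B i j \<noteq> 0 \<and> nat \<bar>B i j\<bar> = m)" for m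
  define m where "m = (LEAST m. P m)"
  have "P (nat \<bar>A i0 j0\<bar>)" unfolding P_def using assms equiv_mat.same by blast
  then have "P m" unfolding m_def by (rule LeastI)
  have le: "m \<le> nat \<bar>B i j\<bar>" if "equiv_mat S A B" "i \<in> S" "j \<in> S" "B i j \<noteq> 0" for B i j
    unfolding m_def by (rule Least_le) (use that P_def in blast)
  have m0: "m > 0" using \<open>P m\<close> unfolding P_def by auto
  have small: "B i j = 0" if "equiv_mat S A B" "i \<in> S" "j \<in> S" "\<bar>B i j\<bar> < int m" for B i j
    using le[of B i j] that by force
  \<comment> \<open>Otherwise a column operation would leave the nonzero remainder as an entry
    smaller than \<open>m\<close>.\<close>
  have row_dvd: "B i j dvd B i j'" if B: "equiv_mat S A B" and ij: "i \<in> S" "j \<in> S" "j' \<in> S" and m: "\<bar>B i j\<bar> = int m" for B i j j'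
  proof (cases "j = j'")
    case False
    let ?B = "col_add j' j (- (B i j' div B i j)) B"
    have "?B i j' = B i j' mod B i j" by (simp add: col_add_def minus_div_mult_eq_mod)
    moreover have "\<bar>B i j' mod B i j\<bar> < int m" using abs_mod_less[of "B i j" "B i j'"] m m0 by auto
    moreover have "equiv_mat S A ?B" using B ij False by (intro equiv_mat.col) auto
    ultimately have "B i j' mod B i j = 0" using small[of ?B i j'] ij by simp
    then show ?thesis by auto
  qed auto
  have col_dvd: "B i j dvd B i' j" if B: "equiv_mat S A B" and ij: "i \<in> S" "j \<in> S" "i' \<in> S" and m: "\<bar>B i j\<bar> = int m" for B i j i'
  proof (cases "i = i'")
    case False
    let ?B = "row_add i' i (- (B i' j div B i j)) B"
    have "?B i' j = B i' j mod B i j" by (simp add: row_add_def minus_div_mult_eq_mod)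
    moreover have "\<bar>B i' j mod B i j\<bar> < int m" using abs_mod_less[of "B i j" "B i' j"] m m0 by auto
    moreover have "equiv_mat S A ?B" using B ij False by (intro equiv_mat.row) auto
    ultimately have "B i' j mod B i j = 0" using small[of ?B i' j] ij by simp
    then show ?thesis by auto
  qed auto
  obtain B0 a j where B0: "equiv_mat S A B0" "a \<in> S" "j \<in> S" "\<bar>B0 a j\<bar> = int m"
    using \<open>P m\<close> unfolding P_def by fastforce
  obtain B1 where B1: "equiv_mat S A B1" "\<bar>B1 a a\<bar> = int m"
  proof (cases "j = a")
    case False
    \<comment> \<open>With the multiplier \<open>1 - q\<close> the diagonal entry becomes
      \<open>q\<close> times plus \<open>1 - q\<close> times \<open>B0 a j\<close>, which is
      \<open>B0 a j\<close> itself.\<close>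
    obtain q where q: "B0 a a = B0 a j * q" using row_dvd[OF B0(1-3,2,4)] by blast
    let ?B = "col_add a j (1 - q) B0"
    have "?B a a = B0 a j" by (simp add: col_add_def q algebra_simps)
    moreover have "equiv_mat S A ?B" using B0 False by (intro equiv_mat.col) auto
    ultimately show ?thesis using that B0 by simp
  qed (use that B0 in auto)
  have "\<exists>B. equiv_mat S A B \<and> \<bar>B a a\<bar> = int m \<and> (\<forall>j\<in>T. B a j = 0)" if "T \<subseteq> S - {a}" for T
    using finite_subset[OF that finite_Diff[OF assms(1)]] that
  proof induction
    case empty
    then show ?case using B1 by auto
  next
    case (insert t T)
    then obtain B where B: "equiv_mat S A B" "\<bar>B a a\<bar> = int m" "\<forall>j\<in>T. B a j = 0" by auto
    have "B a a dvd B a t" using row_dvd[OF B(1) B0(2,2) _ B(2), of t] insert by auto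
    then obtain q where q: "B a t = B a a * q" ..
    show ?case
      using insert B B0 q by (intro exI[of _ "col_add t a (- q) B"] conjI equiv_mat.col) (auto simp: col_add_def)
  qed
  from this[OF order_refl] obtain B2 where B2: "equiv_mat S A B2" "\<bar>B2 a a\<bar> = int m" "\<forall>j\<in>S-{a}. B2 a j = 0" by blast
  \<comment> \<open>Clearing the column adds multiples of row \<open>a\<close> to other rows; row
    \<open>a\<close>, already zero off the pivot, stays as it is.\<close>
  have "\<exists>B. equiv_mat S A B \<and> \<bar>B a a\<bar> = int m \<and> (\<forall>j\<in>S-{a}. B a j = 0) \<and> (\<forall>i\<in>T. B i a = 0)" if "T \<subseteq> S - {a}" for T
    using finite_subset[OF that finite_Diff[OF assms(1)]] that
  proof induction
    case empty
    then show ?case using B2 by auto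
  next
    case (insert t T)
    then obtain B where B: "equiv_mat S A B" "\<bar>B a a\<bar> = int m" "\<forall>j\<in>S-{a}. B a j = 0" "\<forall>i\<in>T. B i a = 0" by auto
    have "B a a dvd B t a" using col_dvd[OF B(1) B0(2,2) _ B(2), of t] insert by auto
    then obtain q where q: "B t a = B a a * q" ..
    show ?case
      using insert B B0 q by (intro exI[of _ "row_add t a (- q) B"] conjI equiv_mat.row) (auto simp: row_add_def)
  qed
  from this[OF order_refl] obtain B where B: "equiv_mat S A B" "\<bar>B a a\<bar> = int m" "\<forall>j\<in>S-{a}. B a j = 0" "\<forall>j\<in>S-{a}. B j a = 0" by blast
  have "B a a dvd B i j" if ij: "i \<in> S" "j \<in> S" for i j
  proof (cases "i = a \<or> j = a")
    case True
    then show ?thesis using B ij by (cases "i = j") auto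
  next
    case False
    \<comment> \<open>As \<open>B i a = 0\<close>, adding row \<open>i\<close> to row
      \<open>a\<close> keeps the pivot and brings \<open>B i j\<close> into its row, where
      \<open>row_dvd\<close> applies.\<close>
    let ?B = "row_add a i 1 B"
    have "equiv_mat S A ?B" using B B0 ij False by (intro equiv_mat.row) auto
    moreover have "\<bar>?B a a\<bar> = int m" using B ij False by (simp add: row_add_def)
    ultimately have "?B a a dvd ?B a j" using row_dvd B0 ij by blast
    then show ?thesis using B ij False by (simp add: row_add_def)
  qed
  then show ?thesis using B B0 by blast
qed

lemma Smith_normal_form:
  assumes "finite S"
  shows "\<exists>B d e. equiv_mat S A B \<and> (\<forall>i\<in>S. \<forall>j\<in>S. B i j = (if i = j then d i else 0)) \<and>
    bij_betw e {1..card S} S \<and> (\<forall>i j. 1 \<le> i \<and> i \<le> j \<and> j \<le> card S \<longrightarrow> d (e i) dvd d (e j))"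
  using assms
proof (induction "card S" arbitrary: S A)
  case 0
  then show ?case using equiv_mat.same[of S A] by (auto simp: bij_betw_def)
next
  case (Suc n)
  show ?case
  proof (cases "\<exists>i\<in>S. \<exists>j\<in>S. A i j \<noteq> 0")
    case False
    obtain e where "bij_betw e {1..card S} S" using ex_bij_betw_nat_finite_1[OF Suc.prems] by blast
    then show ?thesis using False equiv_mat.same[of S A] by (intro exI[of _ A] exI[of _ "\<lambda>_. 0"] exI[of _ e]) auto
  next
    case True
    then obtain a m B where B: "a \<in> S" "equiv_mat S A B" "B a a = m"
      "\<forall>i\<in>S. i \<noteq> a \<longrightarrow> B i a = 0 \<and> B a i = 0" "\<forall>i\<in>S. \<forall>j\<in>S. m dvd B i j"
      using equiv_mat_pivot[OF Suc.prems] by metis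
    define C where "C i j = B i j div m" for i j
    have card: "card (S - {a}) = n" using Suc B by simp
    from Suc.hyps(1)[of "S - {a}" C] obtain D d e where D: "equiv_mat (S - {a}) C D"
      "\<forall>i\<in>S-{a}. \<forall>j\<in>S-{a}. D i j = (if i = j then d i else 0)" "bij_betw e {1..n} (S - {a})"
      "\<forall>i j. 1 \<le> i \<and> i \<le> j \<and> j \<le> n \<longrightarrow> d (e i) dvd d (e j)"
      using card Suc.prems by auto
    have "B i j = (if i = a \<and> j = a then m else if i = a \<or> j = a then 0 else m * C i j)"
      if "i \<in> S" "j \<in> S" for i j
      using B that by (auto simp: C_def)
    from equiv_mat_block[OF D(1) B(2,1) this] obtain B' where B': "equiv_mat S A B'" "\<forall>i\<in>S. \<forall>j\<in>S.
      B' i j = (if i = a \<and> j = a then m else if i = a \<or> j = a then 0 else m * D i j)" by blast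
    define d' where "d' i = (if i = a then m else m * d i)" for i
    \<comment> \<open>The pivot takes the first place; the enumeration of the remaining block is
      shifted by one.\<close>
    define e' where "e' k = (if k = 1 then a else e (k - 1))" for k
    have "bij_betw (\<lambda>k. k - 1) {2..Suc n} {1..n}"
      by (rule bij_betw_byWitness[where f' = "\<lambda>k. k + 1"]) auto
    then have "bij_betw (e \<circ> (\<lambda>k. k - 1)) {2..Suc n} (S - {a})" using D(3) bij_betw_trans by blast
    then have "bij_betw e' {2..Suc n} (S - {a})"
      by (rule bij_betw_cong[THEN iffD1, rotated]) (auto simp: e'_def)
    then have "bij_betw e' (insert 1 {2..Suc n}) (insert (e' 1) (S - {a}))"
      using notIn_Un_bij_betw[of 1 "{2..Suc n}" e' "S - {a}"] by (simp add: e'_def)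
    moreover have "insert 1 {2..Suc n} = {1..card S}" "insert (e' 1) (S - {a}) = S"
      using Suc(2) B by (auto simp: e'_def)
    ultimately have "bij_betw e' {1..card S} S" by simp
    moreover have "\<forall>i\<in>S. \<forall>j\<in>S. B' i j = (if i = j then d' i else 0)"
      using B' D(2) by (auto simp: d'_def)
    moreover have "d' (e' i) dvd d' (e' j)" if "1 \<le> i" "i \<le> j" "j \<le> card S" for i j
    proof -
      have ne: "e' k \<noteq> a" if "2 \<le> k" "k \<le> card S" for k
        using bij_betwE[OF D(3), rule_format, of "k - 1"] that Suc(2) by (force simp: e'_def)
      show ?thesis
      proof (cases "i = 1")
        case True
        then show ?thesis by (auto simp: d'_def e'_def)
      next
        case False
        then have "1 \<le> i - 1 \<and> i - 1 \<le> j - 1 \<and> j - 1 \<le> n" using that Suc(2) by linarith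
        then have "d (e' i) dvd d (e' j)" using D(4) False that by (auto simp: e'_def)
        then show ?thesis using ne[of i] ne[of j] that False by (auto simp: d'_def)
      qed
    qed
    ultimately show ?thesis using B' by blast
  qed
qed

text \<open>The largest of \<open>k\<close> distinct positive indices is at least \<open>k\<close>,
  so its factor is a multiple of \<open>D k\<close>; removing it gives an induction.\<close>

lemma chain_prod_dvd:
  fixes D :: "nat \<Rightarrow> int"
  assumes "\<And>i j. 1 \<le> i \<Longrightarrow> i \<le> j \<Longrightarrow> j \<le> n \<Longrightarrow> D i dvd D j" and "I \<subseteq> {1..n}" "card I = k"
  shows "(\<Prod>i=1..k. D i) dvd (\<Prod>i\<in>I. D i)"
  using assms(2,3)
proof (induction k arbitrary: I)
  case 0
  then show ?case by simp
next
  case (Suc k)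
  have fin: "finite I" "I \<noteq> {}" using Suc finite_subset by auto
  define M where "M = Max I"
  have M: "M \<in> I" unfolding M_def using fin by simp
  have "I \<subseteq> {1..M}" unfolding M_def using fin Suc.prems by auto
  then have "card I \<le> card {1..M}" by (intro card_mono) auto
  then have "Suc k \<le> M" using Suc by simp
  then have "D (Suc k) dvd D M" using assms(1) M Suc.prems by auto
  moreover have "(\<Prod>i=1..k. D i) dvd (\<Prod>i\<in>I - {M}. D i)"
    using Suc M fin by (intro Suc.IH) auto
  ultimately have "(\<Prod>i=1..k. D i) * D (Suc k) dvd (\<Prod>i\<in>I - {M}. D i) * D M"
    by (rule mult_dvd_mono[rotated])
  then show ?case using M fin by (simp add: prod.remove[of I M] mult.commute)
qed

lemma det_on_diagonal:
  fixes d :: "'a \<Rightarrow> int"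
  assumes "finite S"
  shows "det_on S (\<lambda>i j. if i = j then d i else 0) = (\<Prod>i\<in>S. d i)"
proof -
  have "det_on S (\<lambda>i j. if i = j then d i else 0) = (\<Sum>p | p permutes S. if p = id then \<Prod>i\<in>S. d i else 0)"
    unfolding det_on_int
  proof (rule sum.cong[OF refl])
    fix p assume p: "p \<in> {p. p permutes S}"
    show "sign p * (\<Prod>i\<in>S. if i = p i then d i else 0) = (if p = id then \<Prod>i\<in>S. d i else 0)"
    proof (cases "p = id")
      case False
      then obtain i where "p i \<noteq> i" by (auto simp: fun_eq_iff)
      then have "i \<in> S" using p permutes_not_in by fastforce
      then have "\<exists>i\<in>S. (if i = p i then d i else 0) = 0" using \<open>p i \<noteq> i\<close> by metis
      then have "(\<Prod>i\<in>S. if i = p i then d i else 0) = 0"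
        using assms by (intro prod_zero) auto
      then show ?thesis using False by simp
    qed simp
  qed
  also have "\<dots> = (\<Prod>i\<in>S. d i)" using assms by (simp add: finite_permutations permutes_id)
  finally show ?thesis .
qed

text \<open>The first \<open>k\<close> diagonal entries form a minor. In any minor a term with an
  off-diagonal factor vanishes, and a remaining term is a product of \<open>k\<close> diagonal
  entries up to sign, a multiple of the first product by \<open>chain_prod_dvd\<close>.\<close>

lemma minors_dvd_diagonal:
  assumes "finite S" and B: "\<forall>i\<in>S. \<forall>j\<in>S. B i j = (if i = j then d i else 0)"
    and e: "bij_betw e {1..card S} S" "\<forall>i j. 1 \<le> i \<and> i \<le> j \<and> j \<le> card S \<longrightarrow> d (e i) dvd d (e j)"
    and k: "k \<le> card S"
  shows "minors_dvd S k B g \<longleftrightarrow> g dvd (\<Prod>i=1..k. d (e i))"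
proof
  assume "minors_dvd S k B g"
  \<comment> \<open>\<open>e\<close> enumerates from 1 and minors are indexed from 0, hence
    \<open>Suc\<close>.\<close>
  moreover have eS: "(\<lambda>i. e (Suc i)) \<in> {..<k} \<rightarrow> S"
    using e(1) k by (auto simp: bij_betw_def)
  ultimately have "g dvd det_on {..<k} (\<lambda>i j. B (e (Suc i)) (e (Suc j)))"
    unfolding minors_dvd_def by auto
  also have "det_on {..<k} (\<lambda>i j. B (e (Suc i)) (e (Suc j))) =
      det_on {..<k} (\<lambda>i j. if i = j then d (e (Suc i)) else 0)"
  proof (rule det_on_cong)
    fix i j assume ij: "i \<in> {..<k}" "j \<in> {..<k}"
    then have "e (Suc i) = e (Suc j) \<longleftrightarrow> i = j"
      using e(1) k by (auto simp: bij_betw_def inj_on_eq_iff)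
    then show "B (e (Suc i)) (e (Suc j)) = (if i = j then d (e (Suc i)) else 0)"
      using B funcset_mem[OF eS ij(1)] funcset_mem[OF eS ij(2)] by simp
  qed
  also have "\<dots> = (\<Prod>i<k. d (e (Suc i)))" by (rule det_on_diagonal) simp
  also have "\<dots> = (\<Prod>i=1..k. d (e i))"
    by (simp add: prod.atLeast1_atMost_eq)
  finally show "g dvd (\<Prod>i=1..k. d (e i))" .
next
  assume g: "g dvd (\<Prod>i=1..k. d (e i))"
  show "minors_dvd S k B g"
    unfolding minors_dvd_iff[OF assms(1)]
  proof (intro allI impI, elim conjE)
    fix I \<beta> assume I: "I \<subseteq> S" "card I = k" and \<beta>: "inj_on \<beta> I" "\<beta> ` I \<subseteq> S"
    define J where "J = {i \<in> {1..card S}. e i \<in> I}"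
    have "e ` J = e ` {1..card S} \<inter> I" unfolding J_def by auto
    then have eJ: "e ` J = I" using e(1) I by (simp add: bij_betw_def inf_absorb2)
    have injJ: "inj_on e J"
      by (rule inj_on_subset[OF bij_betw_imp_inj_on[OF e(1)]]) (auto simp: J_def)
    have "card J = k" using card_image[OF injJ] eJ I by simp
    then have "(\<Prod>i=1..k. d (e i)) dvd (\<Prod>i\<in>J. d (e i))"
      using e(2) by (intro chain_prod_dvd[where n = "card S" and D = "\<lambda>i. d (e i)"]) (auto simp: J_def)
    also have "(\<Prod>i\<in>J. d (e i)) = (\<Prod>i\<in>I. d i)" using prod.reindex[OF injJ, of d] eJ by simp
    finally have gI: "g dvd (\<Prod>i\<in>I. d i)" using g dvd_trans by blast
    have "g dvd sign p * (\<Prod>i\<in>I. B i (\<beta> (p i)))" if p: "p permutes I" for p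
    proof (cases "\<forall>i\<in>I. \<beta> (p i) = i")
      case True
      then have "(\<Prod>i\<in>I. B i (\<beta> (p i))) = (\<Prod>i\<in>I. d i)" using B I by (intro prod.cong) auto
      then show ?thesis using gI by simp
    next
      case False
      then obtain i where i: "i \<in> I" "\<beta> (p i) \<noteq> i" by blast
      then have "B i (\<beta> (p i)) = 0" using B I \<beta> p by (metis (no_types, lifting) image_subset_iff permutes_in_image subsetD)
      moreover have "finite I" using I assms finite_subset by blast
      ultimately have "(\<Prod>i\<in>I. B i (\<beta> (p i))) = 0" using i by (metis prod_zero)
      then show ?thesis by simp
    qed
    then show "g dvd det_on I (\<lambda>i j. B i (\<beta> j))" unfolding det_on_int by (intro dvd_sum) auto
  qed
qed

text \<open>The same numbers \<open>d\<close> describe the cokernel and the gcds of the minors. The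
  cokernel is given by coordinates \<open>\<phi>\<close> and congruences instead of a quotient
  group, so that it can be pulled back to edge functions later. The nonzero determinant makes every
  \<open>d k\<close> positive, hence every cyclic factor finite.\<close>

theorem cokernel_Smith:
  assumes fin: "finite S" and n: "n = card S" and det: "det_on S A \<noteq> 0"
  shows "\<exists>(d :: nat \<Rightarrow> nat) (\<phi> :: ('a \<Rightarrow> int) \<Rightarrow> nat \<Rightarrow> int). (\<forall>k\<in>{1..n}. d k > 0) \<and>
    (\<forall>x y. \<phi> (\<lambda>i. x i + y i) = (\<lambda>k. \<phi> x k + \<phi> y k)) \<and>
    (\<forall>y. \<exists>x. \<forall>k\<in>{1..n}. \<phi> x k = y k) \<and>
    (\<forall>x. im_on S A x \<longleftrightarrow> (\<forall>k\<in>{1..n}. int (d k) dvd \<phi> x k)) \<and>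
    (\<forall>k\<in>{1..n}. \<forall>g. minors_dvd S k A g \<longleftrightarrow> g dvd int (\<Prod>i=1..k. d i))"
proof -
  obtain B d e where B: "equiv_mat S A B" "\<forall>i\<in>S. \<forall>j\<in>S. B i j = (if i = j then d i else 0)"
    and e: "bij_betw e {1..n} S" "\<forall>i j. 1 \<le> i \<and> i \<le> j \<and> j \<le> n \<longrightarrow> d (e i) dvd d (e j)"
    using Smith_normal_form[OF fin, of A] n by blast
  obtain h where h: "\<And>x y. h (\<lambda>i. x i + y i) = (\<lambda>i. h x i + h y i)" "surj h"
    "\<And>x. im_on S A x \<longleftrightarrow> im_on S B (h x)"
    using equiv_mat_im_on[OF B(1) fin] by blast
  define D where "D k = nat \<bar>d (e k)\<bar>" for k
  have minors: "minors_dvd S k A g \<longleftrightarrow> g dvd int (\<Prod>i=1..k. D i)" if "k \<in> {1..n}" for k g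
  proof -
    have "minors_dvd S k A g \<longleftrightarrow> g dvd (\<Prod>i=1..k. d (e i))"
      using minors_dvd_diagonal[OF fin B(2)] e n that equiv_mat_minors_dvd[OF B(1) fin] by auto
    also have "\<dots> \<longleftrightarrow> g dvd \<bar>\<Prod>i=1..k. d (e i)\<bar>" by simp
    also have "\<bar>\<Prod>i=1..k. d (e i)\<bar> = int (\<Prod>i=1..k. D i)" by (simp add: abs_prod D_def)
    finally show ?thesis .
  qed
  have "D k > 0" if k: "k \<in> {1..n}" for k
  proof -
    \<comment> \<open>The product of all \<open>D k\<close> divides the nonzero determinant, so no
      factor is 0.\<close>
    have "minors_dvd S n A (int (\<Prod>i=1..n. D i))" using minors[of n] k by simp
    then have "int (\<Prod>i=1..n. D i) dvd det_on S A" using minors_dvd_card[OF fin, of A] n by simp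
    then have "(\<Prod>i=1..n. D i) \<noteq> 0" using det by auto
    then show ?thesis using k by (metis bot_nat_0.not_eq_extremum finite_atLeastAtMost prod_zero)
  qed
  moreover have "im_on S A x \<longleftrightarrow> (\<forall>k\<in>{1..n}. int (D k) dvd h x (e k))" for x
  proof -
    have "im_on S B y \<longleftrightarrow> (\<forall>i\<in>S. d i dvd y i)" for y
    proof -
      have "(\<Sum>j\<in>S. B i j * f j) = d i * f i" if "i \<in> S" for i f
      proof -
        have "(\<Sum>j\<in>S. B i j * f j) = (\<Sum>j\<in>S. if j = i then d i * f i else 0)"
          using B that by (intro sum.cong) auto
        then show ?thesis using fin that by simp
      qed
      then have "im_on S B y \<longleftrightarrow> (\<exists>f. \<forall>i\<in>S. y i = d i * f i)" by (simp add: im_on_def)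
      also have "\<dots> \<longleftrightarrow> (\<forall>i\<in>S. d i dvd y i)" unfolding dvd_def by metis
      finally show ?thesis .
    qed
    then have "im_on S A x \<longleftrightarrow> (\<forall>i\<in>e ` {1..n}. d i dvd h x i)" using h e by (simp add: bij_betw_def)
    then show ?thesis by (simp add: D_def)
  qed
  moreover have "\<exists>x. \<forall>k\<in>{1..n}. h x (e k) = y k" for y
  proof -
    obtain x where "h x = (\<lambda>s. y (inv_into {1..n} e s))" using h(2) by (metis surjD)
    then show ?thesis using e by (intro exI[of _ x]) (auto simp: bij_betw_def)
  qed
  ultimately show ?thesis
    using minors h(1) by (intro exI[of _ D] exI[of _ "\<lambda>x k. h x (e k)"]) (auto simp: fun_eq_iff)
qed


section \<open>2-matchings and minors of a forest\<close>

lemma card_swap: "finite P \<Longrightarrow> e' \<in> P \<Longrightarrow> e \<notin> P \<Longrightarrow> card (insert e (P - {e'})) = card P"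
  using card_Suc_Diff1[of P e'] by simp

text \<open>Acyclicity is encoded by leaves: a nonempty set of edges of a finite forest has at least
  two leaves, hence one different from any prescribed vertex \<open>r\<close>. Edges are determined
  by their ends, because parallel edges would form a cycle.\<close>

locale forest =
  fixes V :: "'v set" and E :: "'e set" and en :: "'e \<Rightarrow> 'v set" and X :: "'v \<Rightarrow> int"
  assumes finV: "finite V" and finE: "finite E"
    and en_V: "e \<in> E \<Longrightarrow> en e \<subseteq> V" and en_card: "e \<in> E \<Longrightarrow> card (en e) = 2"
    and en_inj: "inj_on en E"
    and leaf: "D \<subseteq> E \<Longrightarrow> D \<noteq> {} \<Longrightarrow> \<exists>x e. x \<noteq> r \<and> e \<in> D \<and> x \<in> en e \<and> (\<forall>e'\<in>D. x \<in> en e' \<longrightarrow> e' = e)"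
begin

definition deg :: "'e set \<Rightarrow> 'v \<Rightarrow> nat" where
  "deg P v = card {e \<in> P. v \<in> en e}"

definition adj :: "'v \<Rightarrow> 'v \<Rightarrow> bool" where
  "adj u v \<longleftrightarrow> (\<exists>e\<in>E. en e = {u, v})"

definition A :: "'v \<Rightarrow> 'v \<Rightarrow> int" where
  "A u v = (if u = v then X u else if adj u v then - 1 else 0)"

text \<open>A 2-matching of the graph with loops, separated into its proper edges \<open>P\<close>
  and the vertices \<open>L\<close> carrying loops. A loop uses up both incidences at its vertex,
  hence degree 0 there.\<close>

definition matching2 :: "'e set \<Rightarrow> 'v set \<Rightarrow> bool" where
  "matching2 P L \<longleftrightarrow> P \<subseteq> E \<and> L \<subseteq> V \<and> (\<forall>v\<in>V. deg P v \<le> 2) \<and> (\<forall>v\<in>L. deg P v = 0)"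

lemma finP: "P \<subseteq> E \<Longrightarrow> finite P"
  using finE finite_subset by blast

lemma deg_insert: "P \<subseteq> E \<Longrightarrow> e \<notin> P \<Longrightarrow> deg (insert e P) v = deg P v + (if v \<in> en e then 1 else 0)"
proof -
  assume "P \<subseteq> E" "e \<notin> P"
  have "{e' \<in> insert e P. v \<in> en e'} = (if v \<in> en e then insert e {e' \<in> P. v \<in> en e'} else {e' \<in> P. v \<in> en e'})"
    by auto
  then show ?thesis using finP[OF \<open>P \<subseteq> E\<close>] \<open>e \<notin> P\<close> by (simp add: deg_def)
qed

lemma deg_remove: "P \<subseteq> E \<Longrightarrow> e \<in> P \<Longrightarrow> deg P v = deg (P - {e}) v + (if v \<in> en e then 1 else 0)"
  using deg_insert[of "P - {e}" e v] by (simp add: insert_absorb subset_eq)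

lemma deg_mono: "P \<subseteq> Q \<Longrightarrow> Q \<subseteq> E \<Longrightarrow> deg P v \<le> deg Q v"
  unfolding deg_def using finP[of Q] by (intro card_mono) auto

lemma deg_0_iff: "P \<subseteq> E \<Longrightarrow> deg P v = 0 \<longleftrightarrow> (\<forall>e\<in>P. v \<notin> en e)"
  unfolding deg_def using finP[of P] by auto

lemma edge_ends:
  assumes "e \<in> E" "x \<in> en e"
  obtains y where "en e = {x, y}" "y \<noteq> x" "x \<in> V" "y \<in> V"
proof -
  obtain a b where "en e = {a, b}" "a \<noteq> b" using en_card[OF assms(1)] by (auto simp: card_2_iff)
  then show ?thesis using that[of a] that[of b] assms en_V[OF assms(1)] by fastforce
qed

text \<open>Besides \<open>e\<close>, \<open>P\<close> has at most one edge at \<open>y\<close>, and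
  \<open>e\<close> is not in \<open>P'\<close>; this cannot account for two edges of
  \<open>P'\<close> at \<open>y\<close>.\<close>

lemma ex_new_edge:
  assumes "P \<subseteq> E" "P' \<subseteq> E" "e \<in> P - P'" "y \<in> en e" "deg P y \<le> 2" "deg P' y = 2"
  shows "\<exists>e'\<in>P' - P. y \<in> en e'"
proof (rule ccontr)
  assume "\<not> ?thesis"
  then have "{e'\<in>P'. y \<in> en e'} \<subseteq> {e'\<in>P. y \<in> en e'} - {e}" using assms by auto
  then have "deg P' y \<le> card ({e'\<in>P. y \<in> en e'} - {e})"
    unfolding deg_def using finP[OF assms(1)] by (intro card_mono) auto
  also have "\<dots> = deg P y - 1" unfolding deg_def using assms by (intro card_Diff_singleton) auto
  finally show False using assms by simp
qed

text \<open>Induction on the symmetric difference of \<^term>\<open>P\<close> and \<^term>\<open>P'\<close>: it is a forest, and each kind of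
  leaf allows one to shrink it.\<close>

lemma exchange:
  assumes "P \<subseteq> E" "P' \<subseteq> E" "\<forall>v\<in>V. deg P v \<le> 2" "\<forall>v\<in>V. deg P' v \<le> 2" "L \<subseteq> V" "L \<noteq> {}"
    and "\<forall>v\<in>L. deg P v = 0" "card P + card L \<le> card P'"
  shows "\<exists>Q w. Q \<subseteq> P \<union> P' \<and> card Q = card P + 1 \<and> (\<forall>v\<in>V. deg Q v \<le> 2) \<and> w \<in> L \<and> deg Q w \<le> 1 \<and>
    (\<forall>v\<in>L - {w}. deg Q v = 0)"
  using assms
proof (induction "card ((P - P') \<union> (P' - P))" arbitrary: P P' L rule: less_induct)
  case less
  let ?D = "\<lambda>P P'. (P - P') \<union> (P' - P)"
  have finD: "finite (?D P P')" using less.prems finP by auto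
  have finL: "finite L" using less.prems finV finite_subset by blast
  then have "card L > 0" using less.prems by (simp add: card_gt_0_iff)
  then have "P' \<noteq> P" "\<not> P' \<subseteq> P" using less.prems card_mono[OF finP[OF less.prems(1)], of P'] by auto
  then have D: "?D P P' \<subseteq> E" "?D P P' \<noteq> {}" using less.prems by auto
  \<comment> \<open>Prescribing the only vertex of a singleton \<open>L\<close> as \<open>r\<close>
    guarantees that \<open>L - {x}\<close> is nonempty whenever the leaf \<open>x\<close> lies in
    \<open>L\<close>.\<close>
  obtain r where r: "L = {r} \<or> (\<forall>l. L \<noteq> {l})" by blast
  obtain x e where xe: "x \<noteq> r" "e \<in> ?D P P'" "x \<in> en e" "\<forall>e'\<in>?D P P'. x \<in> en e' \<longrightarrow> e' = e"
    using leaf[OF D] by blast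
  then have "e \<in> E" using D by blast
  then obtain y where y: "en e = {x, y}" "y \<noteq> x" "x \<in> V" "y \<in> V" using xe edge_ends by blast
  have eqx: "{e'\<in>P - {e}. x \<in> en e'} = {e'\<in>P' - {e}. x \<in> en e'}" using xe by blast
  then have degx: "deg (P - {e}) x = deg (P' - {e}) x" by (simp add: deg_def)
  show ?case
  proof (cases "e \<in> P")
    case True
    then have eP': "e \<notin> P'" using xe by auto
    have dx: "deg P' x \<le> 1"
      using degx deg_remove[OF less.prems(1) True, of x] eP' xe(3) less.prems(3)[THEN bspec, OF y(3)] by simp
    show ?thesis
    proof (cases "deg P' y \<le> 1")
      \<comment> \<open>The leaf edge belongs to \<open>P\<close> only, and both its ends have room
        in \<open>P'\<close>. Adding it to \<open>P'\<close> keeps the union of the two sets and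
        shrinks their difference.\<close>
      case dy: True
      let ?P' = "insert e P'"
      have "?D P ?P' = ?D P P' - {e}" using True by auto
      then have lt: "card (?D P ?P') < card (?D P P')"
        using xe finD by (metis card_Diff1_less)
      moreover have dd: "\<forall>v\<in>V. deg ?P' v \<le> 2"
        using dx dy less.prems y by (auto simp: deg_insert[OF less.prems(2) eP'])
      moreover have cc: "card P + card L \<le> card ?P'" using less.prems eP' finP by simp
      moreover have sE: "?P' \<subseteq> E" using \<open>e \<in> E\<close> less.prems by simp
      ultimately obtain Q w where Qw: "Q \<subseteq> P \<union> ?P'" "card Q = card P + 1" "\<forall>v\<in>V. deg Q v \<le> 2" "w \<in> L"
        "deg Q w \<le> 1" "\<forall>v\<in>L - {w}. deg Q v = 0"
        using less.hyps[of P ?P' L, OF lt less.prems(1) sE less.prems(3) dd less.prems(5,6,7) cc] by (elim exE conjE) (rule that)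
      show ?thesis using True Qw by (intro exI[of _ Q] exI[of _ w]) auto
    next
      case False
      then have dy: "deg P' y = 2" using less.prems(4) y by (metis One_nat_def le_antisym not_less_eq_eq numeral_2_eq_2)
      \<comment> \<open>\<open>y\<close> is saturated in \<open>P'\<close>; the leaf edge replaces
        an edge of \<open>P'\<close> at \<open>y\<close> that is not in \<open>P\<close>.\<close>
      obtain e' where e': "e' \<in> P' - P" "y \<in> en e'"
        using ex_new_edge[OF less.prems(1,2), of e y] True eP' y less.prems(3) dy by auto
      let ?P' = "insert e (P' - {e'})"
      have "?D P ?P' \<subset> ?D P P'" using True e' eP' by auto
      then have lt: "card (?D P ?P') < card (?D P P')"
        using finD by (rule psubset_card_mono[rotated])
      moreover have "deg ?P' v \<le> 2" if "v \<in> V" for v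
      proof -
        have 1:  "deg ?P' v = deg (P' - {e'}) v + (if v \<in> en e then 1 else 0)"
          using less.prems eP' by (intro deg_insert) auto
        have 2: "deg P' v = deg (P' - {e'}) v + (if v \<in> en e' then 1 else 0)"
          using less.prems e' by (intro deg_remove) auto
        show ?thesis using 1 2 dx dy y(1,2) e'(2) bspec[OF less.prems(4) that]
          by (cases "v = x"; cases "v = y") (simp_all split: if_splits)
      qed
      then have dd: "\<forall>v\<in>V. deg ?P' v \<le> 2" by blast
      have "card ?P' = card P'" using e' eP' card_swap[OF finP[OF less.prems(2)], of e' e] by simp
      then have cc: "card P + card L \<le> card ?P'" using less.prems(8) by simp
      moreover have sE: "?P' \<subseteq> E" using \<open>e \<in> E\<close> less.prems(2) by auto
      ultimately obtain Q w where Qw: "Q \<subseteq> P \<union> ?P'" "card Q = card P + 1" "\<forall>v\<in>V. deg Q v \<le> 2" "w \<in> L"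
        "deg Q w \<le> 1" "\<forall>v\<in>L - {w}. deg Q v = 0"
        using less.hyps[of P ?P' L, OF lt less.prems(1) sE less.prems(3) dd less.prems(5,6,7) cc] by (elim exE conjE) (rule that)
      show ?thesis using True Qw by (intro exI[of _ Q] exI[of _ w]) auto
    qed
  next
    case False
    then have eP': "e \<in> P'" using xe by auto
    have dx: "deg P' x = deg P x + 1"
      using degx deg_remove[OF less.prems(2) eP', of x] False xe(3) by simp
    then have dx1: "deg P x \<le> 1" using less.prems(4) y by fastforce
    show ?thesis
    proof (cases "x \<in> L")
      case True
      \<comment> \<open>The leaf edge and the vertex \<open>x\<close> are given up together, so both
        sides of the size condition drop by 1. No remaining edge of \<open>P\<close> or
        \<open>P'\<close> meets \<open>x\<close>, so the resulting \<open>Q\<close> avoids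
        it.\<close>
      then have L': "L - {x} \<noteq> {}" using r xe(1) by auto
      let ?P' = "P' - {e}"
      have "?D P ?P' \<subset> ?D P P'" using eP' False by auto
      then have lt: "card (?D P ?P') < card (?D P P')"
        using finD by (rule psubset_card_mono[rotated])
      moreover have "deg ?P' v \<le> 2" if "v \<in> V" for v
        using deg_mono[of ?P' P' v] less.prems(2) bspec[OF less.prems(4) that] by fastforce
      then have dd: "\<forall>v\<in>V. deg ?P' v \<le> 2" by blast
      have cc: "card P + card (L - {x}) \<le> card ?P'"
        using less.prems(8) eP' finP[OF less.prems(2)] True finL \<open>card L > 0\<close> by (simp add: card_Diff_singleton)
      moreover have L'V: "L - {x} \<subseteq> V" and L'0: "\<forall>v\<in>L - {x}. deg P v = 0" and sE: "?P' \<subseteq> E"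
        using less.prems(2,5,7) by auto
      ultimately obtain Q w where Q: "Q \<subseteq> P \<union> ?P'" "card Q = card P + 1" "\<forall>v\<in>V. deg Q v \<le> 2" "w \<in> L - {x}"
        "deg Q w \<le> 1" "\<forall>v\<in>L - {x} - {w}. deg Q v = 0"
        using less.hyps[of P ?P' "L - {x}", OF lt less.prems(1) sE less.prems(3) dd L'V L' L'0 cc] by (elim exE conjE) (rule that)
      have "deg P x = 0" using True less.prems by blast
      then have "\<forall>e'\<in>P. x \<notin> en e'" using deg_0_iff less.prems by blast
      moreover then have "\<forall>e'\<in>?P'. x \<notin> en e'" using eqx by blast
      ultimately have "deg Q x = 0" using Q(1) less.prems by (subst deg_0_iff) auto
      then have "deg Q v = 0" if "v \<in> L - {w}" for v using Q(6) that by (cases "v = x") auto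
      then show ?thesis using Q by (intro exI[of _ Q] exI[of _ w]) auto
    next
      case xL: False
      show ?thesis
      proof (cases "deg P y \<le> 1")
        case True
        \<comment> \<open>\<open>P\<close> can be enlarged at once. The only vertex of
          \<open>L\<close> that the new edge can meet is \<open>y\<close>, which is then chosen as
          \<open>w\<close>.\<close>
        let ?Q = "insert e P"
        have dQ: "deg ?Q v = deg P v + (if v \<in> en e then 1 else 0)" for v
          using less.prems False by (intro deg_insert) auto
        have "\<forall>v\<in>V. deg ?Q v \<le> 2" using dQ dx1 True y less.prems by auto
        moreover obtain w where "w \<in> L" "y \<in> L \<longrightarrow> w = y" using less.prems(6) by blast
        moreover have "card ?Q = card P + 1" using False finP less.prems by simp
        ultimately show ?thesis using dQ less.prems(7) xL y eP'
          by (intro exI[of _ ?Q] exI[of _ w]) auto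
      next
        case F2: False
        then have dy: "deg P y = 2" using less.prems(3) y by (metis One_nat_def le_antisym not_less_eq_eq numeral_2_eq_2)
        \<comment> \<open>\<open>y\<close> is saturated in \<open>P\<close>, hence outside
          \<open>L\<close>. The leaf edge can replace an edge of \<open>P\<close> at
          \<open>y\<close>: the size stays the same and \<open>L\<close> is still avoided.\<close>
        then have yL: "y \<notin> L" using less.prems(7) by auto
        obtain e' where e': "e' \<in> P - P'" "y \<in> en e'"
          using ex_new_edge[OF less.prems(2,1), of e y] False eP' y less.prems(4) dy by auto
        let ?P = "insert e (P - {e'})"
        have "?D ?P P' \<subset> ?D P P'" using False e' eP' by auto
        then have lt: "card (?D ?P P') < card (?D P P')"
          using finD by (rule psubset_card_mono[rotated])
        moreover have d: "deg ?P v = deg (P - {e'}) v + (if v \<in> en e then 1 else 0)"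
          "deg P v = deg (P - {e'}) v + (if v \<in> en e' then 1 else 0)" for v
          using deg_insert[of "P - {e'}" e v] deg_remove[of P e' v] less.prems(1) e' False by blast+
        moreover have "deg ?P v \<le> 2" if "v \<in> V" for v
          using d[of v] dx1 dy y(1,2) e'(2) bspec[OF less.prems(3) that]
          by (cases "v = x"; cases "v = y") (simp_all split: if_splits)
        then have dd: "\<forall>v\<in>V. deg ?P v \<le> 2" by blast
        have "deg ?P v = 0" if "v \<in> L" for v
          using d[of v] that xL yL y(1) bspec[OF less.prems(7) that] by (auto split: if_splits)
        then have L0: "\<forall>v\<in>L. deg ?P v = 0" by blast
        have cP: "card ?P = card P" using e' False card_swap[OF finP[OF less.prems(1)], of e' e] by simp
        then have cc: "card ?P + card L \<le> card P'" using less.prems(8) by simp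
        moreover have sE: "?P \<subseteq> E" using \<open>e \<in> E\<close> less.prems(1) by auto
        ultimately obtain Q w where Qw: "Q \<subseteq> ?P \<union> P'" "card Q = card ?P + 1" "\<forall>v\<in>V. deg Q v \<le> 2" "w \<in> L"
          "deg Q w \<le> 1" "\<forall>v\<in>L - {w}. deg Q v = 0"
          using less.hyps[of ?P P' L, OF lt sE less.prems(2) dd less.prems(4,5,6) L0 cc] by (elim exE conjE) (rule that)
        show ?thesis using eP' Qw cP by (intro exI[of _ Q] exI[of _ w]) auto
      qed
    qed
  qed
qed

section \<open>Minors of the matrix of a forest\<close>

lemma adj_sym: "adj u v \<longleftrightarrow> adj v u"
  by (simp add: adj_def insert_commute)

lemma adj_irrefl: "\<not> adj u u"
  unfolding adj_def using en_card by force

definition the_edge :: "'v \<Rightarrow> 'v \<Rightarrow> 'e" where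
  "the_edge u v = inv_into E en {u, v}"

lemma the_edge:
  assumes "adj u v"
  shows "the_edge u v \<in> E" "en (the_edge u v) = {u, v}"
proof -
  have "{u, v} \<in> en ` E" using assms by (auto simp: adj_def)
  then show "the_edge u v \<in> E" "en (the_edge u v) = {u, v}"
    unfolding the_edge_def by (auto intro: inv_into_into simp: f_inv_into_f)
qed

text \<open>The injection \<^term>\<open>\<sigma>\<close> is a set of arcs and loops. The difference of the unit flows along the arcs
  of \<^term>\<open>\<sigma>\<close> and \<^term>\<open>\<tau>\<close> has no divergence, and a forest carries no such flow except 0.\<close>

lemma same_paths:
  assumes I: "I \<subseteq> V" and \<sigma>: "inj_on \<sigma> I" "\<sigma> ` I \<subseteq> V" "\<forall>i\<in>I. \<sigma> i = i \<or> adj i (\<sigma> i)"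
    and \<tau>: "inj_on \<tau> I" "\<tau> ` I = \<sigma> ` I" "\<forall>i\<in>I. \<tau> i = i \<or> adj i (\<tau> i)"
    and i: "i \<in> I" "\<sigma> i \<noteq> i" "\<not> (\<sigma> i \<in> I \<and> \<sigma> (\<sigma> i) = i)"
  shows "\<tau> i = \<sigma> i"
proof -
  \<comment> \<open>Unit flow along all arcs of \<open>r\<close>, antisymmetric in its two vertices,
    so that fixed points and 2-cycles cancel. Its divergence depends only on the domain and the
    image, which \<open>\<sigma>\<close> and \<open>\<tau>\<close> share.\<close>
  define fl where "fl r u w = (of_bool (u \<in> I \<and> r u = w) - of_bool (w \<in> I \<and> r w = u) :: int)" for r :: "'v \<Rightarrow> 'v" and u w
  define g where "g u w = fl \<sigma> u w - fl \<tau> u w" for u w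
  have anti: "g u w = - g w u" for u w by (simp add: g_def fl_def)
  have div_fl: "(\<Sum>w\<in>V. fl r u w) = of_bool (u \<in> I) - of_bool (u \<in> r ` I)"
    if r: "inj_on r I" "r ` I \<subseteq> V" for r u
  proof -
    have "(\<Sum>w\<in>V. of_bool (u \<in> I \<and> r u = w)) = (of_bool (u \<in> I) :: int)"
    proof (cases "u \<in> I")
      case True
      then have "r u \<in> V" using r by blast
      then show ?thesis using True finV by (simp add: of_bool_def)
    qed simp
    moreover have "(\<Sum>w\<in>V. of_bool (w \<in> I \<and> r w = u)) = (of_bool (u \<in> r ` I) :: int)"
    proof (cases "u \<in> r ` I")
      case True
      then obtain z where z: "z \<in> I" "u = r z" by blast
      then have "w \<in> I \<and> r w = u \<longleftrightarrow> w = z" for w using r by (auto simp: inj_on_eq_iff)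
      moreover have "z \<in> V" using z I by blast
      ultimately show ?thesis using True finV by (simp add: of_bool_def)
    next
      case False
      then show ?thesis by (auto intro!: sum.neutral)
    qed
    ultimately show ?thesis by (simp add: fl_def sum_subtractf)
  qed
  have div0: "(\<Sum>w\<in>V. g u w) = 0" for u
    unfolding g_def sum_subtractf using div_fl[of \<sigma> u] div_fl[of \<tau> u] \<sigma> \<tau> by simp
  have supp: "adj u w" if "g u w \<noteq> 0" for u w
  proof -
    have "u \<noteq> w" using that anti[of u u] by auto
    have "(u \<in> I \<and> \<sigma> u = w) \<or> (w \<in> I \<and> \<sigma> w = u) \<or> (u \<in> I \<and> \<tau> u = w) \<or> (w \<in> I \<and> \<tau> w = u)"
      using that unfolding g_def fl_def by (auto simp: of_bool_def split: if_splits)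
    then show ?thesis using \<open>u \<noteq> w\<close> \<sigma>(3) \<tau>(3) adj_sym by metis
  qed
  \<comment> \<open>At a leaf of the support the single nonzero value would be the whole
    divergence.\<close>
  define D where "D = {e\<in>E. \<exists>u w. en e = {u, w} \<and> g u w \<noteq> 0}"
  have "D = {}"
  proof (rule ccontr)
    assume "D \<noteq> {}"
    moreover have "D \<subseteq> E" by (auto simp: D_def)
    ultimately obtain x e where e: "e \<in> D" "x \<in> en e" "\<forall>e'\<in>D. x \<in> en e' \<longrightarrow> e' = e"
      using leaf[of D] by blast
    then obtain y where y: "en e = {x, y}" "y \<noteq> x" "x \<in> V" "y \<in> V" using edge_ends \<open>D \<subseteq> E\<close> by blast
    obtain u w where "{u, w} = {x, y}" "g u w \<noteq> 0" using e(1) y by (auto simp: D_def)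
    then have gxy: "g x y \<noteq> 0" using anti[of x y] by (auto simp: doubleton_eq_iff)
    have "g x w = 0" if "w \<noteq> y" for w
    proof (rule ccontr)
      assume "g x w \<noteq> 0"
      then have "the_edge x w \<in> D" "x \<in> en (the_edge x w)"
        using the_edge[OF supp] unfolding D_def by blast+
      then have "en e = {x, w}" using e(3) the_edge[OF supp[OF \<open>g x w \<noteq> 0\<close>]] by auto
      then show False using y that by (auto simp: doubleton_eq_iff)
    qed
    then have "(\<Sum>w\<in>V. g x w) = (\<Sum>w\<in>V. if w = y then g x y else 0)" by (intro sum.cong) auto
    then show False using div0[of x] gxy y finV by simp
  qed
  have "g i (\<sigma> i) = 0"
  proof (rule ccontr)
    assume "g i (\<sigma> i) \<noteq> 0"
    then have "the_edge i (\<sigma> i) \<in> D" using the_edge[OF supp] unfolding D_def by blast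
    then show False using \<open>D = {}\<close> by blast
  qed
  moreover have "fl \<sigma> i (\<sigma> i) = 1" using i by (auto simp: fl_def)
  ultimately have "fl \<tau> i (\<sigma> i) = 1" by (simp add: g_def)
  then show ?thesis using i by (auto simp: fl_def of_bool_def split: if_splits)
qed

text \<open>Outside \<open>Ip\<close> every index is fixed by \<open>\<sigma>\<close> or swapped
  with another, so \<open>\<sigma>\<close> permutes \<open>I - Ip\<close>. By
  \<open>same_paths\<close> a nonzero term of the determinant agrees with \<open>\<sigma>\<close> on
  \<open>Ip\<close>, where each entry is -1; what remains is the principal minor on
  \<open>I - Ip\<close> up to sign.\<close>

lemma partial_injection_minor:
  assumes I: "I \<subseteq> V" and \<sigma>: "inj_on \<sigma> I" "\<sigma> ` I \<subseteq> V" "\<forall>i\<in>I. \<sigma> i = i \<or> adj i (\<sigma> i)"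
    and Ip: "Ip = {i\<in>I. \<sigma> i \<noteq> i \<and> \<not> (\<sigma> i \<in> I \<and> \<sigma> (\<sigma> i) = i)}"
  shows "\<bar>det_on I (\<lambda>i j. A i (\<sigma> j))\<bar> = \<bar>det_on (I - Ip) A\<bar>"
proof -
  define L where "L = I - Ip"
  have finI: "finite I" using I finV finite_subset by blast
  have finL: "finite L" "finite Ip" using finI by (auto simp: L_def Ip)
  have \<sigma>L: "\<sigma> ` L \<subseteq> L"
    using \<sigma>(1) by (auto simp: L_def Ip)
  have sub: "{p. p permutes L} \<subseteq> {p. p permutes I}"
    by (auto simp: L_def intro: permutes_subset)
  have "det_on I (\<lambda>i j. A i (\<sigma> j)) = (\<Sum>p | p permutes L. sign p * (\<Prod>i\<in>I. A i (\<sigma> (p i))))"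
    unfolding det_on_int
  proof (rule sum.mono_neutral_right[OF _ sub], simp add: finI finite_permutations)
    show "\<forall>p\<in>{p. p permutes I} - {p. p permutes L}. sign p * (\<Prod>i\<in>I. A i (\<sigma> (p i))) = 0"
    proof (clarify, rule ccontr)
      fix p assume p: "p permutes I" "\<not> p permutes L" "sign p * (\<Prod>i\<in>I. A i (\<sigma> (p i))) \<noteq> 0"
      then have "A i (\<sigma> (p i)) \<noteq> 0" if "i \<in> I" for i using that finI prod_zero by fastforce
      then have \<tau>: "\<forall>i\<in>I. (\<sigma> \<circ> p) i = i \<or> adj i ((\<sigma> \<circ> p) i)" unfolding A_def by (metis comp_apply)
      have im: "(\<sigma> \<circ> p) ` I = \<sigma> ` I" using p(1) by (metis image_comp permutes_image)
      have inj: "inj_on (\<sigma> \<circ> p) I" using p(1) \<sigma>(1) by (simp add: comp_inj_on permutes_image permutes_inj_on)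
      have "p i = i" if "i \<in> I - L" for i
      proof -
        have i: "i \<in> I" "\<sigma> i \<noteq> i" "\<not> (\<sigma> i \<in> I \<and> \<sigma> (\<sigma> i) = i)" using that by (auto simp: L_def Ip)
        have "\<sigma> (p i) = \<sigma> i" using same_paths[OF I \<sigma> inj im \<tau> i] by simp
        then show ?thesis using \<sigma>(1) i p(1) by (metis inj_on_eq_iff permutes_in_image)
      qed
      then show False using permutes_superset[OF p(1)] p(2) by blast
    qed
  qed
  also have "\<dots> = (\<Sum>p | p permutes L. (- 1) ^ card Ip * (sign p * (\<Prod>i\<in>L. A i (\<sigma> (p i)))))"
  proof (rule sum.cong[OF HOL.refl])
    fix p assume "p \<in> {p. p permutes L}"
    then have p: "p permutes L" by simp
    have "(\<Prod>i\<in>I. A i (\<sigma> (p i))) = (\<Prod>i\<in>Ip. A i (\<sigma> (p i))) * (\<Prod>i\<in>L. A i (\<sigma> (p i)))"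
      unfolding L_def by (rule prod.subset_diff[THEN trans, OF _ finI mult.commute]) (auto simp: Ip)
    also have "(\<Prod>i\<in>Ip. A i (\<sigma> (p i))) = (\<Prod>i\<in>Ip. - 1)"
    proof (rule prod.cong[OF HOL.refl])
      fix i assume i: "i \<in> Ip"
      then have "p i = i" using permutes_not_in[OF p] by (simp add: L_def)
      then show "A i (\<sigma> (p i)) = - 1" using i \<sigma>(3) by (auto simp: A_def Ip)
    qed
    finally show "sign p * (\<Prod>i\<in>I. A i (\<sigma> (p i))) = (- 1) ^ card Ip * (sign p * (\<Prod>i\<in>L. A i (\<sigma> (p i))))"
      by simp
  qed
  also have "\<dots> = (- 1) ^ card Ip * det_on L (\<lambda>i j. A i (\<sigma> j))"
    by (simp add: det_on_int sum_distrib_left)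
  finally have 1: "\<bar>det_on I (\<lambda>i j. A i (\<sigma> j))\<bar> = \<bar>det_on L (\<lambda>i j. A i (\<sigma> j))\<bar>"
    by (simp add: abs_mult power_abs)
  define q where "q = restrict_id \<sigma> L"
  have "inj_on \<sigma> L" using \<sigma>(1) by (auto simp: L_def intro: inj_on_subset)
  then have "bij_betw \<sigma> L L" using \<sigma>L finL by (simp add: bij_betw_def endo_inj_surj)
  then have "bij_betw q L L"
    by (rule bij_betw_cong[THEN iffD1, rotated]) (auto simp: q_def)
  then have q: "q permutes L"
    by (rule bij_imp_permutes) (auto simp: q_def)
  have "det_on L (\<lambda>i j. A i (\<sigma> j)) = det_on L (\<lambda>i j. A i (q j))"
    by (rule det_on_cong) (auto simp: q_def)
  also have "\<dots> = sign q * det_on L A" by (rule det_on_permute_cols[OF finL(1) q])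
  finally show ?thesis using 1 by (simp add: abs_mult L_def)
qed

text \<open>Forgetting directions, the arcs on \<open>Ip\<close> become proper edges and the other
  indices carry loops. A vertex has at most one outgoing and one incoming arc; stating this through
  domain and image is what \<open>dvd_all_matchings\<close> needs at its exceptional vertex.\<close>

lemma partial_injection_matching:
  assumes I: "I \<subseteq> V" and \<sigma>: "inj_on \<sigma> I" "\<sigma> ` I \<subseteq> V" "\<forall>i\<in>I. \<sigma> i = i \<or> adj i (\<sigma> i)"
    and Ip: "Ip = {i\<in>I. \<sigma> i \<noteq> i \<and> \<not> (\<sigma> i \<in> I \<and> \<sigma> (\<sigma> i) = i)}"
  shows "\<exists>P. matching2 P (I - Ip) \<and> card P + card (I - Ip) = card I \<and>
    (\<forall>v. deg P v \<le> of_bool (v \<in> I) + of_bool (v \<in> \<sigma> ` I)) \<and> \<Union>(en ` P) \<subseteq> I \<union> \<sigma> ` I"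
proof -
  define f where "f i = the_edge i (\<sigma> i)" for i
  define P where "P = f ` Ip"
  have finI: "finite I" using I finV finite_subset by blast
  have f: "f i \<in> E" "en (f i) = {i, \<sigma> i}" if "i \<in> Ip" for i
    unfolding f_def using that \<sigma>(3) the_edge Ip by auto
  \<comment> \<open>Two arcs on one edge would form a 2-cycle, which \<open>Ip\<close>
    excludes.\<close>
  have "inj_on f Ip"
  proof (rule inj_onI)
    fix i j assume ij: "i \<in> Ip" "j \<in> Ip" "f i = f j"
    then have "{i, \<sigma> i} = {j, \<sigma> j}" using f by metis
    then show "i = j" using ij Ip by (auto simp: doubleton_eq_iff)
  qed
  then have cP: "card P = card Ip" by (simp add: P_def card_image)
  have PE: "P \<subseteq> E" using f by (auto simp: P_def)
  have one: "card {i\<in>J. h i = v} \<le> of_bool (v \<in> h ` J)" if "inj_on h J" for J h and v :: 'v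
  proof (cases "v \<in> h ` J")
    case True
    then obtain z where "z \<in> J" "v = h z" by blast
    then have "{i\<in>J. h i = v} = {z}" using that by (auto simp: inj_on_eq_iff)
    then show ?thesis using True by simp
  next
    case False
    then have none: "{i\<in>J. h i = v} = {}" by auto
    show ?thesis unfolding none by simp
  qed
  have injIp: "inj_on \<sigma> Ip" using \<sigma>(1) by (auto simp: Ip intro: inj_on_subset)
  have dP: "deg P v \<le> of_bool (v \<in> Ip) + of_bool (v \<in> \<sigma> ` Ip)" for v
  proof -
    have "{e\<in>P. v \<in> en e} \<subseteq> f ` ({i\<in>Ip. i = v} \<union> {i\<in>Ip. \<sigma> i = v})"
      using f by (auto simp: P_def)
    moreover have fin: "finite ({i\<in>Ip. i = v} \<union> {i\<in>Ip. \<sigma> i = v})" using finI by (auto simp: Ip)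
    ultimately have "deg P v \<le> card ({i\<in>Ip. i = v} \<union> {i\<in>Ip. \<sigma> i = v})"
      unfolding deg_def by (meson card_image_le card_mono finite_imageI le_trans)
    also have "\<dots> \<le> card {i\<in>Ip. i = v} + card {i\<in>Ip. \<sigma> i = v}" by (rule card_Un_le)
    finally show ?thesis using one[of "\<lambda>i. i" Ip v] one[OF injIp, of v] by simp
  qed
  have "deg P v = 0" if "v \<in> I - Ip" for v
  proof -
    have "v \<notin> \<sigma> ` Ip" using that \<sigma>(1) by (auto simp: Ip inj_on_eq_iff)
    then show ?thesis using dP[of v] that by simp
  qed
  moreover have "deg P v \<le> 2" for v
    by (rule order_trans[OF dP[of v]]) (simp add: of_bool_def)
  ultimately have "matching2 P (I - Ip)" using PE I unfolding matching2_def by auto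
  moreover have "card P + card (I - Ip) = card I"
  proof -
    have "Ip \<subseteq> I" by (auto simp: Ip)
    then show ?thesis using cP finI card_mono[of I Ip] by (simp add: card_Diff_subset finite_subset)
  qed
  moreover have "deg P v \<le> of_bool (v \<in> I) + of_bool (v \<in> \<sigma> ` I)" for v
    by (rule order_trans[OF dP[of v]]) (auto simp: of_bool_def Ip)
  moreover have "\<Union>(en ` P) \<subseteq> I \<union> \<sigma> ` I" using f by (auto simp: P_def Ip)
  ultimately show ?thesis by blast
qed

lemma minor_is_matching:
  assumes I: "I \<subseteq> V" and \<beta>: "inj_on \<beta> I" "\<beta> ` I \<subseteq> V" and nz: "det_on I (\<lambda>i j. A i (\<beta> j)) \<noteq> 0"
  shows "\<exists>P L. matching2 P L \<and> card P + card L = card I \<and> L \<subseteq> I \<and>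
    \<bar>det_on I (\<lambda>i j. A i (\<beta> j))\<bar> = \<bar>det_on L A\<bar> \<and>
    (\<forall>v. deg P v \<le> of_bool (v \<in> I) + of_bool (v \<in> \<beta> ` I)) \<and> \<Union>(en ` P) \<subseteq> I \<union> \<beta> ` I"
proof -
  have finI: "finite I" using I finV finite_subset by blast
  \<comment> \<open>A nonzero term of the determinant replaces the given matching of rows and
    columns by one that moves along edges or stays put; this only changes the sign.\<close>
  obtain p where p: "p permutes I" "sign p * (\<Prod>i\<in>I. A i (\<beta> (p i))) \<noteq> 0"
    using nz unfolding det_on_int by (metis (no_types, lifting) mem_Collect_eq sum.neutral)
  define \<sigma> where "\<sigma> = \<beta> \<circ> p"
  have "A i (\<beta> (p i)) \<noteq> 0" if "i \<in> I" for i using p(2) that finI prod_zero by fastforce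
  then have \<sigma>3: "\<forall>i\<in>I. \<sigma> i = i \<or> adj i (\<sigma> i)" unfolding A_def \<sigma>_def by (metis comp_apply)
  have im: "\<sigma> ` I = \<beta> ` I" using p(1) unfolding \<sigma>_def by (metis image_comp permutes_image)
  have inj: "inj_on \<sigma> I" using p(1) \<beta>(1) unfolding \<sigma>_def by (simp add: comp_inj_on permutes_image permutes_inj_on)
  have "det_on I (\<lambda>i j. A i (\<sigma> j)) = sign p * det_on I (\<lambda>i j. A i (\<beta> j))"
    unfolding \<sigma>_def comp_def by (rule det_on_permute_cols[OF finI p(1)])
  then have "\<bar>det_on I (\<lambda>i j. A i (\<beta> j))\<bar> = \<bar>det_on I (\<lambda>i j. A i (\<sigma> j))\<bar>" by (simp add: abs_mult)
  then show ?thesis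
    using partial_injection_minor[OF I inj _ \<sigma>3 HOL.refl] partial_injection_matching[OF I inj _ \<sigma>3 HOL.refl] \<beta> im
    by (metis (no_types, lifting) Diff_subset)
qed

text \<open>The edges form disjoint paths, and each is directed from one end to the other. In the
  induction the leaf edge continues the path at \<open>y\<close>: it is directed towards
  \<open>x\<close> if \<open>y\<close> is not yet a tail, and away from \<open>x\<close>
  otherwise.\<close>

lemma orientation:
  assumes "P \<subseteq> E" "\<forall>v\<in>V. deg P v \<le> 2"
  shows "\<exists>Ip \<sigma>. inj_on \<sigma> Ip \<and> (\<forall>i\<in>Ip. \<exists>e\<in>P. en e = {i, \<sigma> i}) \<and> card Ip = card P \<and>
    (\<forall>i\<in>Ip. \<not> (\<sigma> i \<in> Ip \<and> \<sigma> (\<sigma> i) = i)) \<and> Ip \<union> \<sigma> ` Ip \<subseteq> \<Union>(en ` P)"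
  using assms
proof (induction "card P" arbitrary: P)
  case 0
  then have "P = {}" using finP by simp
  then show ?case by (intro exI[of _ "{}"]) auto
next
  case (Suc n)
  then have "P \<noteq> {}" by auto
  then obtain x e where xe: "e \<in> P" "x \<in> en e" "\<forall>e'\<in>P. x \<in> en e' \<longrightarrow> e' = e"
    using leaf[OF Suc.prems(1), of undefined] by blast
  then obtain y where y: "en e = {x, y}" "y \<noteq> x" "x \<in> V" "y \<in> V" using edge_ends Suc.prems by blast
  let ?P = "P - {e}"
  have nP: "n = card ?P" using Suc.hyps(2) xe(1) finP[OF Suc.prems(1)] by simp
  moreover have PE: "?P \<subseteq> E" using Suc by auto
  moreover have dP: "\<forall>v\<in>V. deg ?P v \<le> 2" using deg_mono[of ?P P] Suc.prems by (meson Diff_subset le_trans)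
  ultimately obtain Ip \<sigma> where IH: "inj_on \<sigma> Ip" "\<forall>i\<in>Ip. \<exists>e\<in>?P. en e = {i, \<sigma> i}" "card Ip = card ?P"
    "\<forall>i\<in>Ip. \<not> (\<sigma> i \<in> Ip \<and> \<sigma> (\<sigma> i) = i)" "Ip \<union> \<sigma> ` Ip \<subseteq> \<Union>(en ` ?P)"
    using Suc.hyps(1)[OF nP PE dP] by (elim exE conjE) (rule that)
  have x: "x \<notin> \<Union>(en ` ?P)"
  proof
    assume "x \<in> \<Union>(en ` ?P)"
    then obtain e' where "e' \<in> P" "e' \<noteq> e" "x \<in> en e'" by blast
    then show False using xe(3) by blast
  qed
  have finIp: "finite Ip"
  proof (rule finite_subset[OF _ finV])
    have "\<Union>(en ` ?P) \<subseteq> V" using PE en_V by blast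
    then show "Ip \<subseteq> V" using IH(5) by blast
  qed
  have cI: "card (insert z Ip) = card P" if "z \<notin> Ip" for z
    using that finIp IH(3) card_Suc_Diff1[OF finP[OF Suc.prems(1)] xe(1)] by simp
  have "deg P y = deg ?P y + 1" using deg_remove[OF Suc.prems(1) xe(1), of y] y by simp
  then have dy: "deg ?P y \<le> 1" using Suc.prems(2) y by fastforce
  have eP: "\<exists>e'\<in>P. en e' = {i, \<sigma> i}" if "i \<in> Ip" for i using IH(2) that by blast
  show ?case
  proof (cases "y \<in> Ip")
    case False
    let ?\<sigma> = "\<sigma>(y := x)"
    have same: "?\<sigma> i = \<sigma> i" if "i \<in> Ip" for i using that False by auto
    have "inj_on ?\<sigma> (insert y Ip)"
      using IH(1,5) x False by (auto simp: inj_on_def)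
    moreover have "\<forall>i\<in>insert y Ip. \<exists>e\<in>P. en e = {i, ?\<sigma> i}"
      using eP xe(1) y False by (auto simp: insert_commute)
    moreover have "\<forall>i\<in>insert y Ip. \<not> (?\<sigma> i \<in> insert y Ip \<and> ?\<sigma> (?\<sigma> i) = i)"
      using IH(4,5) x False y by (auto split: if_splits)
    moreover have "insert y Ip \<union> ?\<sigma> ` insert y Ip \<subseteq> \<Union>(en ` P)"
      using IH(5) xe(1) y by auto
    ultimately show ?thesis using cI[OF False] by blast
  next
    case True
    \<comment> \<open>An arc into \<open>y\<close> besides the one leaving it would be a second edge
      at \<open>y\<close>, or the same edge in the other direction; the degree bound and the
      exclusion of 2-cycles forbid these.\<close>
    have y\<sigma>: "y \<notin> \<sigma> ` Ip"
    proof
      assume "y \<in> \<sigma> ` Ip"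
      then obtain j where j: "j \<in> Ip" "y = \<sigma> j" by blast
      obtain e1 e2 where e12: "e1 \<in> ?P" "en e1 = {y, \<sigma> y}" "e2 \<in> ?P" "en e2 = {j, y}"
        using IH(2) True j by metis
      have "e1 = e2"
      proof (rule ccontr)
        assume "e1 \<noteq> e2"
        then have "card {e1, e2} \<le> deg ?P y" unfolding deg_def
          using e12 finP[OF PE] by (intro card_mono) auto
        then show False using dy \<open>e1 \<noteq> e2\<close> by simp
      qed
      moreover have "card {j, y} = 2" using e12 en_card PE by (metis subsetD)
      moreover have "{y, \<sigma> y} = {j, y}" using \<open>e1 = e2\<close> e12(2,4) by simp
      ultimately have "\<sigma> y = j" by (auto simp: doubleton_eq_iff)
      then show False using IH(4) j True by auto
    qed
    let ?\<sigma> = "\<sigma>(x := y)"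
    have xI: "x \<notin> Ip" "x \<notin> \<sigma> ` Ip" using x IH(5) by auto
    have "inj_on ?\<sigma> (insert x Ip)"
      using IH(1) xI y\<sigma> by (auto simp: inj_on_def)
    moreover have "\<forall>i\<in>insert x Ip. \<exists>e\<in>P. en e = {i, ?\<sigma> i}"
      using eP xe(1) y xI by auto
    moreover have "\<forall>i\<in>insert x Ip. \<not> (?\<sigma> i \<in> insert x Ip \<and> ?\<sigma> (?\<sigma> i) = i)"
      using IH(4) xI y by (auto split: if_splits)
    moreover have "insert x Ip \<union> ?\<sigma> ` insert x Ip \<subseteq> \<Union>(en ` P)"
      using IH(5) xe(1) y by auto
    ultimately show ?thesis using cI[OF xI(1)] by blast
  qed
qed

text \<open>Converse of \<open>minor_is_matching\<close>: the rows are the tails of the oriented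
  edges and the vertices with loops, the columns are the heads and again the vertices with
  loops.\<close>

lemma matching_is_minor:
  assumes "matching2 P L"
  shows "\<exists>I \<beta>. I \<subseteq> V \<and> card I = card P + card L \<and> inj_on \<beta> I \<and> \<beta> ` I \<subseteq> V \<and>
    \<bar>det_on I (\<lambda>i j. A i (\<beta> j))\<bar> = \<bar>det_on L A\<bar>"
proof -
  have P: "P \<subseteq> E" "\<forall>v\<in>V. deg P v \<le> 2" and L: "L \<subseteq> V" "\<forall>v\<in>L. deg P v = 0"
    using assms by (auto simp: matching2_def)
  obtain Ip \<sigma> where \<sigma>: "inj_on \<sigma> Ip" "\<forall>i\<in>Ip. \<exists>e\<in>P. en e = {i, \<sigma> i}" "card Ip = card P"
    "\<forall>i\<in>Ip. \<not> (\<sigma> i \<in> Ip \<and> \<sigma> (\<sigma> i) = i)" "Ip \<union> \<sigma> ` Ip \<subseteq> \<Union>(en ` P)"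
    using orientation[OF P] by (elim exE conjE) (rule that)
  have PV: "\<Union>(en ` P) \<subseteq> V" using P en_V by blast
  have LP: "L \<inter> \<Union>(en ` P) = {}" using L deg_0_iff[OF P(1)] by blast
  define \<beta> where "\<beta> i = (if i \<in> Ip then \<sigma> i else i)" for i
  have disj: "Ip \<inter> L = {}" "\<sigma> ` Ip \<inter> L = {}" using LP \<sigma>(5) by blast+
  let ?I = "Ip \<union> L"
  have fin: "finite Ip" "finite L" using \<sigma>(5) PV L finV by (meson Un_subset_iff finite_subset order_trans)+
  have I: "?I \<subseteq> V" using \<sigma>(5) PV L by auto
  have inj: "inj_on \<beta> ?I" using \<sigma>(1) disj by (auto simp: \<beta>_def inj_on_def)
  have "\<sigma> ` Ip \<subseteq> V" using \<sigma>(5) PV by blast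
  then have im: "\<beta> ` ?I \<subseteq> V" using L by (auto simp: \<beta>_def)
  have adj: "adj i (\<sigma> i)" if "i \<in> Ip" for i using \<sigma>(2) that P(1) unfolding adj_def by blast
  then have v: "\<forall>i\<in>?I. \<beta> i = i \<or> adj i (\<beta> i)" by (auto simp: \<beta>_def)
  have Ip: "Ip = {i\<in>?I. \<beta> i \<noteq> i \<and> \<not> (\<beta> i \<in> ?I \<and> \<beta> (\<beta> i) = i)}"
    using adj adj_irrefl \<sigma>(4) disj by (auto simp: \<beta>_def split: if_splits)
  have "?I - Ip = L" using disj by auto
  then have "\<bar>det_on ?I (\<lambda>i j. A i (\<beta> j))\<bar> = \<bar>det_on L A\<bar>"
    using partial_injection_minor[OF I inj im v Ip] by simp
  moreover have "card ?I = card P + card L" using fin disj \<sigma>(3) by (simp add: card_Un_disjoint)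
  ultimately show ?thesis using I inj im by blast
qed

section \<open>Reduction to minimal 2-matchings\<close>

definition minimal2 :: "'e set \<Rightarrow> 'v set \<Rightarrow> bool" where
  "minimal2 P L \<longleftrightarrow> matching2 P L \<and>
     (\<nexists>P' L'. matching2 P' L' \<and> card P' + card L' = card P + card L \<and> L' \<subset> L)"

text \<open>If the 2-matching is not minimal, exchange yields \<^term>\<open>Q\<close>, with one edge more than \<^term>\<open>P\<close>, which
  meets \<^term>\<open>L\<close> in a single vertex \<^term>\<open>w\<close> of degree at most 1. The minors in the Laplace expansion
  of \<^term>\<open>det_on L A\<close> along row \<^term>\<open>w\<close> come from 2-matchings inside \<^term>\<open>L\<close> which can be added to \<^term>\<open>Q\<close>.\<close>

lemma dvd_all_matchings:
  assumes min: "\<And>P L. minimal2 P L \<Longrightarrow> card P + card L = k \<Longrightarrow> g dvd det_on L A"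
    and "matching2 P L" "card P + card L = k"
  shows "g dvd det_on L A"
  using assms(2,3)
proof (induction "card L" arbitrary: P L rule: less_induct)
  case less
  show ?case
  proof (cases "minimal2 P L")
    case True
    then show ?thesis using min less.prems by blast
  next
    case False
    then obtain P' L' where P': "matching2 P' L'" "card P' + card L' = k" "L' \<subset> L"
      using less.prems by (auto simp: minimal2_def)
    have P: "P \<subseteq> E" "\<forall>v\<in>V. deg P v \<le> 2" and L: "L \<subseteq> V" "\<forall>v\<in>L. deg P v = 0"
      using less.prems by (auto simp: matching2_def)
    have finL: "finite L" using L finV finite_subset by blast
    have finL': "finite L'" using P' finL finite_subset by blast
    have PP: "P' \<subseteq> E" "\<forall>v\<in>V. deg P' v \<le> 2" "\<forall>v\<in>L'. deg P' v = 0" using P' by (auto simp: matching2_def)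
    \<comment> \<open>The two matchings have equal size, so \<open>P'\<close> has exactly as many
      edges as \<open>P\<close> has edges and \<open>L - L'\<close> has vertices together, the size
      condition of \<open>exchange\<close>.\<close>
    have "card (L - L') = card L - card L'" "card L' \<le> card L"
      using P'(3) finL by (auto intro: card_Diff_subset card_mono simp: finL')
    then have "card P + card (L - L') \<le> card P'" using P' less.prems by linarith
    then obtain Q w where Q: "Q \<subseteq> P \<union> P'" "card Q = card P + 1" "\<forall>v\<in>V. deg Q v \<le> 2" "w \<in> L - L'" "deg Q w \<le> 1"
      "\<forall>v\<in>L - L' - {w}. deg Q v = 0"
      using exchange[OF P(1) PP(1) P(2) PP(2), of "L - L'"] L P'(3) by blast
    have QE: "Q \<subseteq> E" using Q P PP by auto
    have "deg Q v = 0" if "v \<in> L'" for v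
    proof -
      have "v \<in> L" using that P' by blast
      then show ?thesis using that L(2) PP(3) Q(1) P(1) PP(1) QE by (auto simp: deg_0_iff)
    qed
    then have Q0: "\<forall>v\<in>L - {w}. deg Q v = 0" using Q by blast
    have w: "w \<in> L" using Q by blast
    define S where "S = L - {w}"
    have S: "L = insert w S" "w \<notin> S" "finite S" "S \<subseteq> V" using w finL L by (auto simp: S_def)
    have "g dvd det_on S (\<lambda>i j. A i (Transposition.transpose w z j))" if z: "z \<in> L" for z
    proof (cases "det_on S (\<lambda>i j. A i (Transposition.transpose w z j)) = 0")
      case False
      \<comment> \<open>The column map of the Laplace expansion. The minor has rows in
        \<open>S\<close> and columns in \<open>L\<close>, so the 2-matching obtained from it stays
        within \<open>L\<close>.\<close>
      let ?\<beta> = "Transposition.transpose w z"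
      have \<beta>L: "?\<beta> ` S \<subseteq> L" using z w by (auto simp: S_def Transposition.transpose_def)
      have "inj_on ?\<beta> S" by (meson inj_on_subset inj_transpose subset_UNIV)
      with minor_is_matching[OF S(4) _ _ False] \<beta>L L obtain P2 L2 where
        P2: "matching2 P2 L2" "card P2 + card L2 = card S" "L2 \<subseteq> S"
        "\<bar>det_on S (\<lambda>i j. A i (?\<beta> j))\<bar> = \<bar>det_on L2 A\<bar>"
        "\<forall>v. deg P2 v \<le> of_bool (v \<in> S) + of_bool (v \<in> ?\<beta> ` S)" "\<Union>(en ` P2) \<subseteq> S \<union> ?\<beta> ` S"
        by blast
      have P2E: "P2 \<subseteq> E" "\<forall>v\<in>V. deg P2 v \<le> 2" "\<forall>v\<in>L2. deg P2 v = 0" using P2 by (auto simp: matching2_def)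
      have P2L: "\<Union>(en ` P2) \<subseteq> L" using P2(6) \<beta>L S by auto
      \<comment> \<open>An edge of \<open>P2\<close> has both ends in \<open>L\<close>, an edge of
        \<open>Q\<close> can meet \<open>L\<close> only in \<open>w\<close>.\<close>
      have disj: "P2 \<inter> Q = {}"
      proof (rule ccontr)
        assume "P2 \<inter> Q \<noteq> {}"
        then obtain e where e: "e \<in> P2" "e \<in> Q" by blast
        then obtain u v where uv: "en e = {u, v}" "u \<noteq> v" using en_card P2E by (metis card_2_iff subsetD)
        then have "u \<in> L" "v \<in> L" using e P2L by auto
        then obtain t where "t \<in> L - {w}" "t \<in> en e" using uv by blast
        then show False using Q0 deg_0_iff[OF QE] e by blast
      qed
      have dU: "deg (P2 \<union> Q) v = deg P2 v + deg Q v" for v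
      proof -
        have "{e \<in> P2 \<union> Q. v \<in> en e} = {e\<in>P2. v \<in> en e} \<union> {e\<in>Q. v \<in> en e}" by auto
        then show ?thesis unfolding deg_def
          using disj finP[OF P2E(1)] finP[OF QE] by (simp add: card_Un_disjoint disjoint_iff)
      qed
      have "deg (P2 \<union> Q) v \<le> 2" if v: "v \<in> V" for v
      proof (cases "v \<in> L")
        case True
        show ?thesis
        proof (cases "v = w")
          case True
          \<comment> \<open>\<open>w\<close> is no row of the minor and at most a column, which
            leaves room for one edge of \<open>Q\<close> at \<open>w\<close>.\<close>
          have "deg P2 w \<le> 1" using P2(5)[rule_format, of w] S(2) by (cases "w \<in> ?\<beta> ` S") simp_all
          then show ?thesis using dU[of v] True Q by simp
        next
          case False
          then show ?thesis using dU[of v] Q0 \<open>v \<in> L\<close> P2E(2) v by simp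
        qed
      next
        case False
        then have "deg P2 v = 0" using P2L deg_0_iff[OF P2E(1)] by blast
        then show ?thesis using dU[of v] Q(3) v by simp
      qed
      moreover have "deg (P2 \<union> Q) v = 0" if "v \<in> L2" for v
        using that P2(3) P2E(3) Q0 dU[of v] by (auto simp: S_def)
      moreover have "L2 \<subseteq> V" using P2(3) S by auto
      ultimately have "matching2 (P2 \<union> Q) L2" using P2E QE by (auto simp: matching2_def)
      \<comment> \<open>The row lost in passing from \<open>L\<close> to \<open>S\<close> is made up
        by the additional edge of \<open>Q\<close>.\<close>
      moreover have "card (P2 \<union> Q) + card L2 = k"
        using disj finP[OF P2E(1)] finP[OF QE] P2(2) Q(2) less.prems(2) S by (simp add: card_Un_disjoint)
      moreover have "card L2 < card L"
        using P2(3) S finL by (intro psubset_card_mono) auto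
      ultimately have "g dvd det_on L2 A" using less.hyps by blast
      then show ?thesis using P2(4) by (metis dvd_abs_iff)
    qed simp
    then show ?thesis unfolding S(1) det_on_insert[OF S(3,2)]
      using S(1) by (intro dvd_sum dvd_mult) auto
  qed
qed

theorem minimal_matchings_minors:
  "(\<forall>P L. minimal2 P L \<and> card P + card L = k \<longrightarrow> g dvd det_on L A) \<longleftrightarrow>
   (\<forall>I \<beta>. I \<subseteq> V \<and> card I = k \<and> inj_on \<beta> I \<and> \<beta> ` I \<subseteq> V \<longrightarrow> g dvd det_on I (\<lambda>i j. A i (\<beta> j)))"
proof (intro iffI allI impI)
  fix I \<beta> assume *: "\<forall>P L. minimal2 P L \<and> card P + card L = k \<longrightarrow> g dvd det_on L A"
    and I: "I \<subseteq> V \<and> card I = k \<and> inj_on \<beta> I \<and> \<beta> ` I \<subseteq> V"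
  show "g dvd det_on I (\<lambda>i j. A i (\<beta> j))"
  proof (cases "det_on I (\<lambda>i j. A i (\<beta> j)) = 0")
    case False
    then obtain P L where P: "matching2 P L" "card P + card L = k" "\<bar>det_on I (\<lambda>i j. A i (\<beta> j))\<bar> = \<bar>det_on L A\<bar>"
      using minor_is_matching[of I \<beta>] I by blast
    have "g dvd det_on L A" using dvd_all_matchings[of k g, OF _ P(1,2)] * by blast
    then show ?thesis using P(3) by (metis dvd_abs_iff)
  qed simp
next
  fix P L assume *: "\<forall>I \<beta>. I \<subseteq> V \<and> card I = k \<and> inj_on \<beta> I \<and> \<beta> ` I \<subseteq> V \<longrightarrow> g dvd det_on I (\<lambda>i j. A i (\<beta> j))"
    and P: "minimal2 P L \<and> card P + card L = k"
  then obtain I \<beta> where "I \<subseteq> V \<and> card I = k \<and> inj_on \<beta> I \<and> \<beta> ` I \<subseteq> V"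
    "\<bar>det_on I (\<lambda>i j. A i (\<beta> j))\<bar> = \<bar>det_on L A\<bar>"
    using matching_is_minor[of P L] by (auto simp: minimal2_def)
  then show "g dvd det_on L A" using * by (metis dvd_abs_iff)
qed

end


section \<open>Walks in multigraphs\<close>

text \<open>A walk is a list of darts: an edge together with its start and its end. Loops are not traversed.\<close>

type_synonym ('v, 'e) dart = "'v \<times> 'e \<times> 'v"

fun walk :: "('v, 'e) mgraph \<Rightarrow> 'v \<Rightarrow> ('v, 'e) dart list \<Rightarrow> 'v \<Rightarrow> bool" where
  "walk G a [] b \<longleftrightarrow> a = b"
| "walk G a ((u, e, v) # ds) b \<longleftrightarrow> u = a \<and> e \<in> edges G \<and> ends G e = {u, v} \<and> u \<noteq> v \<and> walk G v ds b"

abbreviation tails :: "('v, 'e) dart list \<Rightarrow> 'v list" where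
  "tails \<equiv> map fst"

abbreviation dedges :: "('v, 'e) dart list \<Rightarrow> 'e list" where
  "dedges \<equiv> map (fst \<circ> snd)"

definition dpath :: "('v, 'e) mgraph \<Rightarrow> 'v \<Rightarrow> ('v, 'e) dart list \<Rightarrow> 'v \<Rightarrow> bool" where
  "dpath G a ds b \<longleftrightarrow> walk G a ds b \<and> distinct (tails ds @ [b])"

text \<open>Distinct edges are required separately: running along one edge and back has distinct
  tails but is not a cycle.\<close>

definition dcycle :: "('v, 'e) mgraph \<Rightarrow> ('v, 'e) dart list \<Rightarrow> bool" where
  "dcycle G ds \<longleftrightarrow> ds \<noteq> [] \<and> walk G (fst (hd ds)) ds (fst (hd ds)) \<and> distinct (tails ds) \<and> distinct (dedges ds)"

definition adj_rel :: "('v, 'e) mgraph \<Rightarrow> ('v \<times> 'v) set" where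
  "adj_rel G = {(x, y). \<exists>e \<in> edges G. ends G e = {x, y}}"

lemma walk_append: "walk G a (p @ q) b \<longleftrightarrow> (\<exists>c. walk G a p c \<and> walk G c q b)"
  by (induction p arbitrary: a) auto

lemma walk_mono:
  assumes "walk G a ds b" "edges G \<subseteq> edges H" "\<And>e. e \<in> edges G \<Longrightarrow> ends H e = ends G e"
  shows "walk H a ds b"
  using assms(1) by (induction ds arbitrary: a) (use assms(2,3) in auto)

lemma walk_dart: "walk G a ds b \<Longrightarrow> (u, e, v) \<in> set ds \<Longrightarrow> e \<in> edges G \<and> ends G e = {u, v} \<and> u \<noteq> v"
  by (induction ds arbitrary: a) auto

lemma walk_dedges: "walk G a ds b \<Longrightarrow> set (dedges ds) \<subseteq> edges G"
proof (induction ds arbitrary: a)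
  case (Cons d ds)
  then show ?case by (cases d) auto
qed simp

lemma walk_heads: "walk G a ds b \<Longrightarrow> a # map (snd \<circ> snd) ds = tails ds @ [b]"
  by (induction ds arbitrary: a) auto

lemma walk_vertices: "walk G a ds b \<Longrightarrow> (u, e, v) \<in> set ds \<Longrightarrow> u \<in> set (tails ds) \<and> v \<in> set (tails ds @ [b])"
  using walk_heads[of G a ds b] by (metis (no_types, lifting) comp_apply fst_conv image_eqI list.set_intros(2) list.set_map snd_conv)

lemma walk_head: "walk G a ds b \<Longrightarrow> ds \<noteq> [] \<Longrightarrow> fst (hd ds) = a"
  by (cases ds) auto

lemma walk_nth:
  assumes "walk G a ds b" "i < length ds"
  shows "snd (snd (ds ! i)) = (if Suc i < length ds then fst (ds ! Suc i) else b)"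
  using assms
proof (induction ds arbitrary: a i)
  case (Cons d ds)
  obtain u e v where d: "d = (u, e, v)" by (cases d)
  show ?case
  proof (cases i)
    case 0
    then show ?thesis using Cons.prems d by (cases ds) auto
  next
    case (Suc j)
    then show ?thesis using Cons.IH[of v j] Cons.prems d by auto
  qed
qed simp

lemma walk_upt:
  assumes "i \<le> n" "\<And>j. i \<le> j \<Longrightarrow> j < n \<Longrightarrow> es j \<in> edges G \<and> ends G (es j) = {vs j, vs (Suc j)} \<and> vs j \<noteq> vs (Suc j)"
  shows "walk G (vs i) (map (\<lambda>j. (vs j, es j, vs (Suc j))) [i..<n]) (vs n)"
  using assms
proof (induction "n - i" arbitrary: i)
  case (Suc k)
  then have "[i..<n] = i # [Suc i..<n]" by (simp add: upt_conv_Cons)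
  then show ?case using Suc by auto
qed simp

lemma dpath_dedges_distinct:
  assumes "dpath G a ds b"
  shows "distinct (dedges ds)"
  using assms unfolding dpath_def
proof (induction ds arbitrary: a)
  case (Cons d ds)
  obtain u e v where d: "d = (u, e, v)" by (cases d)
  have "e \<notin> set (dedges ds)"
  proof
    assume "e \<in> set (dedges ds)"
    then obtain x y where "(x, e, y) \<in> set ds" by auto
    then have "x \<in> set (tails ds @ [b])" "y \<in> set (tails ds @ [b])" "{x, y} = {u, v}"
      using walk_vertices[of G v ds b] walk_dart[of G v ds b] Cons.prems d by auto
    then show False using Cons.prems d by (auto simp: doubleton_eq_iff)
  qed
  then show ?case using Cons d by auto
qed simp

lemma walk_imp_dpath:
  assumes "walk G a ds b"
  shows "\<exists>p. dpath G a p b"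
  using assms
proof (induction ds arbitrary: a)
  case Nil
  then show ?case by (intro exI[of _ "[]"]) (simp add: dpath_def)
next
  case (Cons d ds)
  obtain u e v where d: "d = (u, e, v)" by (cases d)
  then obtain p where p: "dpath G v p b" using Cons by auto
  show ?case
  proof (cases "u \<in> set (tails p @ [b])")
    case False
    then have "dpath G a (d # p) b" using p d Cons.prems by (auto simp: dpath_def)
    then show ?thesis by blast
  next
    case True
    show ?thesis
    proof (cases "u = b")
      case True
      then show ?thesis using Cons.prems d by (intro exI[of _ "[]"]) (auto simp: dpath_def)
    next
      case False
      then obtain x y where xy: "(u, x, y) \<in> set p" using True by auto
      then obtain p1 p2 where "p = p1 @ (u, x, y) # p2" by (meson split_list)
      then have "dpath G u ((u, x, y) # p2) b" using p by (auto simp: dpath_def walk_append)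
      then show ?thesis using Cons.prems d by auto
    qed
  qed
qed

lemma rtrancl_imp_dpath:
  assumes "(a, b) \<in> (adj_rel G)\<^sup>*"
  shows "\<exists>p. dpath G a p b"
proof -
  have "\<exists>ds. walk G a ds b"
    using assms
  proof (induction rule: converse_rtrancl_induct)
    case base
    then show ?case by (intro exI[of _ "[]"]) simp
  next
    case (step x y)
    then obtain ds e where *: "walk G y ds b" "e \<in> edges G" "ends G e = {x, y}" by (auto simp: adj_rel_def)
    show ?case
    proof (cases "x = y")
      case False
      then show ?thesis using * by (intro exI[of _ "(x, e, y) # ds"]) auto
    qed (use * in blast)
  qed
  then show ?thesis using walk_imp_dpath by metis
qed

lemma adj_rel_sym: "sym (adj_rel G)"
  unfolding adj_rel_def sym_def by (auto simp: insert_commute)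

lemma rtrancl_adj_rel_sym: "(a, b) \<in> (adj_rel G)\<^sup>* \<Longrightarrow> (b, a) \<in> (adj_rel G)\<^sup>*"
  using sym_rtrancl[OF adj_rel_sym[of G]] by (metis symD)

lemma connected_graph_adj_rel:
  "connected_graph G \<longleftrightarrow> verts G \<noteq> {} \<and> (\<forall>u \<in> verts G. \<forall>v \<in> verts G. (u, v) \<in> (adj_rel G)\<^sup>*)"
  by (simp add: connected_graph_def adj_rel_def)

lemma dcycle_dedges: "dcycle G C \<Longrightarrow> set (dedges C) \<subseteq> edges G"
  using walk_dedges[of G "fst (hd C)" C "fst (hd C)"] by (simp add: dcycle_def)

lemma dcycle_last:
  assumes "dcycle G C"
  shows "\<exists>a b ds e. C = ds @ [(b, e, a)] \<and> dpath G a ds b \<and> e \<notin> set (dedges ds) \<and> e \<in> edges G \<and>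
    ends G e = {b, a} \<and> b \<noteq> a"
proof -
  obtain ds b e a where C: "C = ds @ [(b, e, a)]" using assms by (metis dcycle_def rev_exhaust surj_pair)
  then have "walk G (fst (hd C)) C (fst (hd C))" using assms by (simp add: dcycle_def)
  then have *: "walk G a ds b" "e \<in> edges G" "ends G e = {b, a}" "b \<noteq> a" using C by (auto simp: walk_append)
  moreover have "distinct (tails ds @ [b])" "e \<notin> set (dedges ds)" using assms C by (auto simp: dcycle_def)
  ultimately show ?thesis using C by (auto simp: dpath_def)
qed

lemma dedges_dart: "e \<in> set (dedges ds) \<Longrightarrow> \<exists>u v. (u, e, v) \<in> set ds"
  by force

lemma dcycle_is_cycle:
  assumes "dcycle G ds" "\<And>e. e \<in> edges G \<Longrightarrow> ends G e \<subseteq> verts G"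
  shows "is_cycle G (tails ds) (dedges ds)"
  unfolding is_cycle_def
proof (intro conjI allI impI)
  let ?a = "fst (hd ds)"
  have w: "walk G ?a ds ?a" and ne: "ds \<noteq> []" and d: "distinct (tails ds)" "distinct (dedges ds)"
    using assms by (auto simp: dcycle_def)
  show "dedges ds \<noteq> []" "length (tails ds) = length (dedges ds)" "distinct (tails ds)" "distinct (dedges ds)"
    using ne d by auto
  show "set (dedges ds) \<subseteq> edges G" by (rule walk_dedges[OF w])
  show "set (tails ds) \<subseteq> verts G"
    using walk_dart[OF w] assms(2) by fastforce
  fix i assume i: "i < length (dedges ds)"
  obtain u e v where uev: "ds ! i = (u, e, v)" by (cases "ds ! i")
  then have "ends G e = {u, v}" using walk_dart[OF w] i by (metis length_map nth_mem)
  moreover have "v = tails ds ! (Suc i mod length (dedges ds))"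
  proof (cases "Suc i < length ds")
    case True
    then show ?thesis using walk_nth[OF w, of i] uev by simp
  next
    case False
    then have "Suc i = length ds" using i by simp
    then show ?thesis using walk_nth[OF w, of i] uev ne by (simp add: hd_conv_nth)
  qed
  ultimately show "ends G (dedges ds ! i) = {tails ds ! i, tails ds ! (Suc i mod length (dedges ds))}"
    using uev i by simp
qed

lemma is_cycle_dcycle:
  assumes "is_cycle G vs es" "\<And>e. e \<in> edges G \<Longrightarrow> card (ends G e) = 2"
  shows "\<exists>ds. dcycle G ds \<and> dedges ds = es"
proof -
  let ?n = "length es"
  have c: "es \<noteq> []" "length vs = ?n" "distinct vs" "distinct es" "set es \<subseteq> edges G"
    "\<forall>i < ?n. ends G (es ! i) = {vs ! i, vs ! (Suc i mod ?n)}"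
    using assms by (auto simp: is_cycle_def)
  define vv where "vv i = vs ! (i mod ?n)" for i
  define ds where "ds = map (\<lambda>j. (vv j, es ! j, vv (Suc j))) [0..<?n]"
  have e: "es ! j \<in> edges G \<and> ends G (es ! j) = {vv j, vv (Suc j)} \<and> vv j \<noteq> vv (Suc j)" if "j < ?n" for j
  proof -
    have "es ! j \<in> edges G" using c that by auto
    moreover have en: "ends G (es ! j) = {vv j, vv (Suc j)}" using c that by (simp add: vv_def)
    ultimately show ?thesis using assms(2)[of "es ! j"] by (auto simp: card_insert_if split: if_splits)
  qed
  have "walk G (vv 0) ds (vv ?n)" unfolding ds_def by (rule walk_upt) (use e in auto)
  moreover have "vv ?n = vv 0" by (simp add: vv_def)
  moreover have "tails ds = vs" using c by (auto simp: ds_def vv_def intro: nth_equalityI)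
  moreover have es: "dedges ds = es" by (auto simp: ds_def intro: nth_equalityI)
  moreover have "ds \<noteq> []" "fst (hd ds) = vv 0" using c by (auto simp: ds_def hd_map)
  ultimately have "dcycle G ds" using c unfolding dcycle_def by simp
  then show ?thesis using es by blast
qed

lemma dpath_close_dcycle:
  assumes "dpath G a ds b" "e \<in> edges G" "ends G e = {a, b}" "a \<noteq> b" "e \<notin> set (dedges ds)"
  shows "dcycle G (ds @ [(b, e, a)])"
proof -
  have w: "walk G a ds b" "distinct (tails ds @ [b])" using assms by (auto simp: dpath_def)
  have "ds \<noteq> []" using w assms by auto
  then have "fst (hd (ds @ [(b, e, a)])) = a" using walk_head[OF w(1)] by simp
  then show ?thesis
    using w assms dpath_dedges_distinct[OF assms(1)] by (auto simp: dcycle_def walk_append insert_commute)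
qed

lemma dpath_add_dart:
  assumes "dpath G a ds b" "e \<in> edges G" "ends G e = {b, w}" "b \<noteq> w" "w \<notin> set (tails ds)"
  shows "dpath G a (ds @ [(b, e, w)]) w"
  using assms by (auto simp: dpath_def walk_append)

text \<open>The end of a longest path is a leaf: another edge there would prolong the path or close
  a cycle. Starting the path at \<open>r\<close> whenever \<open>r\<close> is met by
  \<open>D\<close> makes the end different from \<open>r\<close>.\<close>

lemma acyclic_leaf:
  assumes fin: "finite D" and D: "D \<subseteq> edges G" "D \<noteq> {}" and card: "\<And>e. e \<in> D \<Longrightarrow> card (ends G e) = 2"
    and acyclic: "\<nexists>ds. dcycle G ds"
  shows "\<exists>x e. x \<noteq> r \<and> e \<in> D \<and> x \<in> ends G e \<and> (\<forall>e'\<in>D. x \<in> ends G e' \<longrightarrow> e' = e)"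
proof -
  let ?H = "G\<lparr>edges := D\<rparr>"
  have other: "\<exists>w. ends G e = {v, w} \<and> v \<noteq> w" if "e \<in> D" "v \<in> ends G e" for e v
    using card[OF that(1)] that(2) by (auto simp: card_2_iff)
  obtain s where s: "s \<in> \<Union>(ends G ` D)" "r \<in> \<Union>(ends G ` D) \<longrightarrow> s = r"
  proof (cases "r \<in> \<Union>(ends G ` D)")
    case False
    obtain e where "e \<in> D" using D by blast
    then have "ends G e \<noteq> {}" using card by fastforce
    then show ?thesis using that False \<open>e \<in> D\<close> by blast
  qed (use that in blast)
  define Q where "Q ds \<longleftrightarrow> (\<exists>b. dpath ?H s ds b) \<and> ds \<noteq> []" for ds
  obtain e0 where e0_s: "e0 \<in> D" "s \<in> ends G e0" using s(1) by blast
  then obtain w0 where e0: "e0 \<in> D" "ends G e0 = {s, w0}" "s \<noteq> w0" using other by blast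
  then have "Q [(s, e0, w0)]" by (auto simp: Q_def dpath_def)
  moreover have "length ds < card D + 1" if Qds: "Q ds" for ds
  proof -
    obtain b where b: "dpath ?H s ds b" using Qds by (auto simp: Q_def)
    have "length ds = card (set (dedges ds))"
      using dpath_dedges_distinct[OF b] by (metis distinct_card length_map)
    also have "\<dots> \<le> card D" using b walk_dedges[of ?H s ds b] fin by (auto simp: dpath_def intro!: card_mono)
    finally show ?thesis by simp
  qed
  ultimately obtain ds where ds: "Q ds" "\<forall>ds'. Q ds' \<longrightarrow> length ds' \<le> length ds"
    using ex_has_greatest_nat[of Q "[(s, e0, w0)]" length "card D + 1"] by blast
  then obtain b where b: "dpath ?H s ds b" and ne: "ds \<noteq> []" by (auto simp: Q_def)
  have w: "walk ?H s ds b" and dist: "distinct (tails ds @ [b])" using b by (auto simp: dpath_def)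
  have "hd (tails ds) = s" using walk_head[OF w ne] ne by (simp add: hd_map)
  then have "s \<in> set (tails ds)" using ne by (metis hd_in_set map_is_Nil_conv)
  then have bs: "b \<noteq> s" using dist by auto
  obtain ds' t e v where ds': "ds = ds' @ [(t, e, v)]" using ne by (metis rev_exhaust surj_pair)
  have v: "v = b" using w ds' by (auto simp: walk_append)
  have e: "e \<in> D" "ends G e = {t, b}" "t \<noteq> b" using w ds' v by (auto simp: walk_append)
  have "e' = e" if e': "e' \<in> D" "b \<in> ends G e'" for e'
  proof (rule ccontr)
    assume "e' \<noteq> e"
    obtain w where w': "ends G e' = {b, w}" "b \<noteq> w" using other[OF e'] by blast
    show False
    proof (cases "w \<in> set (tails ds)")
      case False
      then have "dpath ?H s (ds @ [(b, e', w)]) w" using w' e' by (intro dpath_add_dart[OF b]) auto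
      then have "Q (ds @ [(b, e', w)])" by (auto simp: Q_def)
      then show False using ds(2) by fastforce
    next
      case True
      then obtain x y where "(w, x, y) \<in> set ds" by auto
      then obtain p q where pq: "ds = p @ (w, x, y) # q" by (meson split_list)
      let ?q = "(w, x, y) # q"
      have q: "dpath ?H w ?q b" using b pq by (auto simp: dpath_def walk_append)
      have "e' \<notin> set (dedges ds')"
      proof
        assume "e' \<in> set (dedges ds')"
        then obtain x' y' where xy: "(x', e', y') \<in> set ds'" by auto
        have "walk ?H s ds' t" using \<open>walk ?H s ds b\<close> ds' by (auto simp: walk_append)
        from walk_vertices[OF this xy] walk_dart[OF this xy]
        have "x' \<in> set (tails ds)" "y' \<in> set (tails ds)" "ends G e' = {x', y'}" using ds' by auto
        then show False using dist w' by (auto simp: doubleton_eq_iff)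
      qed
      then have "e' \<notin> set (dedges ds)" using ds' \<open>e' \<noteq> e\<close> by auto
      then have "e' \<notin> set (dedges ?q)" using pq by auto
      then have "dcycle ?H (?q @ [(b, e', w)])" using q e' w' by (intro dpath_close_dcycle) auto
      then have "dcycle G (?q @ [(b, e', w)])"
        unfolding dcycle_def using walk_mono[of ?H _ _ _ G] D by auto
      then show False using acyclic by blast
    qed
  qed
  moreover have "b \<noteq> r" using bs s(2) e by auto
  ultimately show ?thesis using e by blast
qed

section \<open>Ears and cycles in biconnected graphs\<close>

lemma prefix_dpath_to_set:
  assumes "dpath G x ds c" "c \<in> S" "x \<notin> S"
  shows "\<exists>p b. dpath G x p b \<and> p \<noteq> [] \<and> b \<in> S \<and> set (tails p) \<inter> S = {} \<and> set p \<subseteq> set ds"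
  using assms
proof (induction ds arbitrary: x)
  case Nil
  then show ?case by (auto simp: dpath_def)
next
  case (Cons d ds)
  obtain u e v where d: "d = (u, e, v)" by (cases d)
  have d1: "u = x" "e \<in> edges G" "ends G e = {x, v}" "x \<noteq> v" and v: "dpath G v ds c" and x: "x \<notin> set (tails ds @ [c])"
    using Cons.prems(1) d by (auto simp: dpath_def)
  show ?case
  proof (cases "v \<in> S")
    case True
    then have "dpath G x [d] v" "set (tails [d]) \<inter> S = {}" using d1 d Cons.prems(3) by (auto simp: dpath_def)
    then show ?thesis using True by (intro exI[of _ "[d]"]) auto
  next
    case False
    then obtain p b where p: "dpath G v p b" "b \<in> S" "set (tails p) \<inter> S = {}" "set p \<subseteq> set ds"
      using Cons.IH[OF v Cons.prems(2)] by blast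
    have "x \<notin> set (tails p)" using p(4) x by auto
    moreover have "x \<noteq> b" using p(2) Cons.prems(3) by auto
    ultimately have "dpath G x (d # p) b" using p(1) d1 d by (auto simp: dpath_def)
    then show ?thesis using p d d1 Cons.prems(3) by (intro exI[of _ "d # p"] exI[of _ b]) auto
  qed
qed

lemma biconnected_delete_vert:
  assumes "biconnected G" "z \<in> verts G" "x \<in> verts G" "y \<in> verts G" "x \<noteq> z" "y \<noteq> z"
  shows "(x, y) \<in> (adj_rel (delete_vert G z))\<^sup>*"
proof -
  have "connected_graph (delete_vert G z)" using assms(1,2) by (simp add: biconnected_def)
  moreover have "x \<in> verts (delete_vert G z)" "y \<in> verts (delete_vert G z)" using assms by (simp_all add: delete_vert_def)
  ultimately show ?thesis unfolding connected_graph_adj_rel by blast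
qed

lemma walk_delete_vert:
  "walk (delete_vert G v) a ds b \<Longrightarrow> walk G a ds b \<and> v \<notin> set (tails ds) \<and> (ds \<noteq> [] \<longrightarrow> b \<noteq> v)"
proof (induction ds arbitrary: a)
  case (Cons d ds)
  obtain u e w where d: "d = (u, e, w)" by (cases d)
  then have "u = a" "e \<in> edges G" "ends G e = {a, w}" "a \<noteq> w" "v \<noteq> a" "v \<noteq> w" "walk (delete_vert G v) w ds b"
    using Cons.prems by (auto simp: delete_vert_def)
  moreover from this Cons.IH have "walk G w ds b \<and> v \<notin> set (tails ds) \<and> (ds \<noteq> [] \<longrightarrow> b \<noteq> v)" by blast
  ultimately show ?case using d by (cases ds) auto
qed simp

text \<open>By connectedness some edge \<open>f\<close> leaves the cycle, from \<open>a\<close> to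
  \<open>x\<close>; as deleting \<open>a\<close> leaves the graph connected, \<open>x\<close> can
  return to the cycle elsewhere. The first dart is displayed to exhibit the vertex \<open>x\<close>
  off the cycle.\<close>

lemma biconnected_ear:
  assumes bi: "biconnected G" and wf: "\<And>e. e \<in> edges G \<Longrightarrow> ends G e \<subseteq> verts G"
    and C: "dcycle G C" and ne: "set (tails C) \<noteq> verts G"
  shows "\<exists>a f x p b. a \<in> set (tails C) \<and> b \<in> set (tails C) \<and> a \<noteq> b \<and> x \<notin> set (tails C) \<and>
    dpath G a ((a, f, x) # p) b \<and> set (tails p) \<inter> set (tails C) = {}"
proof -
  let ?S = "set (tails C)"
  have w: "walk G (fst (hd C)) C (fst (hd C))" and Cne: "C \<noteq> []" using C by (auto simp: dcycle_def)
  have SV: "?S \<subseteq> verts G" using walk_dart[OF w] wf by fastforce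
  then obtain w where w: "w \<in> verts G" "w \<notin> ?S" using ne by blast
  obtain s where s: "s \<in> ?S" using Cne by (cases C) auto
  have "(w, s) \<in> (adj_rel G)\<^sup>*" using bi SV s w by (auto simp: biconnected_def connected_graph_adj_rel)
  then obtain ds where "dpath G w ds s" using rtrancl_imp_dpath by metis
  then obtain p0 a where p0: "dpath G w p0 a" "p0 \<noteq> []" "a \<in> ?S" "set (tails p0) \<inter> ?S = {}"
    using prefix_dpath_to_set[of G w ds s ?S] s w by blast
  then obtain q x f a' where q: "p0 = q @ [(x, f, a')]" by (metis rev_exhaust surj_pair)
  have f: "f \<in> edges G" "ends G f = {x, a}" "x \<noteq> a" "x \<notin> ?S"
    using p0 q by (auto simp: dpath_def walk_append)
  have xV: "x \<in> verts G" "a \<in> verts G" using f wf by auto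
  obtain c where c: "c \<in> ?S" "c \<noteq> a"
  proof -
    obtain u e v C' where C': "C = (u, e, v) # C'" using Cne by (metis list.exhaust surj_pair)
    have "C' \<noteq> []" using C C' by (auto simp: dcycle_def)
    then obtain d C'' where "C' = d # C''" by (cases C') auto
    then have "fst d \<in> ?S" "u \<in> ?S" "fst d \<noteq> u" using C C' by (auto simp: dcycle_def)
    then show ?thesis using that by metis
  qed
  have "(x, c) \<in> (adj_rel (delete_vert G a))\<^sup>*"
    using biconnected_delete_vert[OF bi xV(2,1), of c] c SV f by blast
  then obtain ds' where "dpath (delete_vert G a) x ds' c" using rtrancl_imp_dpath by metis
  then obtain p b where p: "dpath (delete_vert G a) x p b" "p \<noteq> []" "b \<in> ?S" "set (tails p) \<inter> ?S = {}"
    using prefix_dpath_to_set[of _ x ds' c ?S] c f by blast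
  then have p': "walk G x p b" "a \<notin> set (tails p)" "b \<noteq> a" "distinct (tails p @ [b])"
    using walk_delete_vert[of G a x p b] by (auto simp: dpath_def)
  then have "dpath G a ((a, f, x) # p) b" using f by (auto simp: dpath_def insert_commute)
  then show ?thesis using p p' p0 f by blast
qed

text \<open>Unless the graph is a single edge, the ends of an edge stay connected without it: by a
  parallel edge if there are only two vertices, otherwise through a third vertex \<open>w\<close>,
  which is joined to each end with the other end deleted.\<close>

lemma biconnected_cycle_or_edge:
  assumes bi: "biconnected G" and wf: "\<And>e. e \<in> edges G \<Longrightarrow> ends G e \<subseteq> verts G \<and> card (ends G e) = 2"
  shows "(\<exists>C. dcycle G C) \<or> (\<exists>e. edges G = {e} \<and> verts G = ends G e)"
proof (rule disjCI)
  assume nex: "\<nexists>e. edges G = {e} \<and> verts G = ends G e"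
  have "card (verts G) \<ge> 2" "connected_graph G" using bi by (auto simp: biconnected_def)
  then obtain s t where "s \<in> verts G" "t \<in> verts G" "s \<noteq> t"
    by (metis card_2_iff' card_le_Suc0_iff_eq card.infinite not_less_eq_eq numeral_2_eq_2 zero_le zero_less_Suc le_zero_eq nat.distinct(1))
  then obtain p where "dpath G s p t" using bi rtrancl_imp_dpath by (metis biconnected_def connected_graph_adj_rel)
  then have "p \<noteq> []" using \<open>s \<noteq> t\<close> by (auto simp: dpath_def)
  then obtain e where e: "e \<in> edges G" using \<open>dpath G s p t\<close> by (cases p) (auto simp: dpath_def)
  then obtain u v where uv: "ends G e = {u, v}" "u \<noteq> v" using wf by (meson card_2_iff)
  have uvV: "u \<in> verts G" "v \<in> verts G" using wf e uv by auto
  let ?H = "G\<lparr>edges := edges G - {e}\<rparr>"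
  have "(u, v) \<in> (adj_rel ?H)\<^sup>*"
  proof (cases "verts G = {u, v}")
    case True
    then obtain e' where e': "e' \<in> edges G" "e' \<noteq> e" using nex e uv by blast
    then have "ends G e' \<subseteq> {u, v}" "card (ends G e') = 2" using wf True by auto
    then have "ends G e' = {u, v}" using uv by (intro card_subset_eq) auto
    then have "(u, v) \<in> adj_rel ?H" using e' by (auto simp: adj_rel_def)
    then show ?thesis by blast
  next
    case False
    then obtain w where w: "w \<in> verts G" "w \<noteq> u" "w \<noteq> v" using uvV by blast
    have sub: "adj_rel (delete_vert G z) \<subseteq> adj_rel ?H" if "z \<in> {u, v}" for z
      using that uv by (auto simp: adj_rel_def delete_vert_def)
    have "(w, v) \<in> (adj_rel (delete_vert G u))\<^sup>*" "(w, u) \<in> (adj_rel (delete_vert G v))\<^sup>*"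
      using biconnected_delete_vert[OF bi uvV(1) w(1) uvV(2)] biconnected_delete_vert[OF bi uvV(2) w(1) uvV(1)] w uv
      by auto
    then have "(w, v) \<in> (adj_rel ?H)\<^sup>*" "(w, u) \<in> (adj_rel ?H)\<^sup>*"
      using rtrancl_mono[OF sub[of u]] rtrancl_mono[OF sub[of v]] by auto
    then show ?thesis using rtrancl_adj_rel_sym by (meson rtrancl_trans)
  qed
  then obtain p where p: "dpath ?H u p v" using rtrancl_imp_dpath by metis
  then have "walk ?H u p v" by (simp add: dpath_def)
  then have "e \<notin> set (dedges p)" using walk_dedges by fastforce
  moreover have "dpath G u p v" using p unfolding dpath_def by (auto intro: walk_mono)
  ultimately show "\<exists>C. dcycle G C" using dpath_close_dcycle uv e by metis
qed


section \<open>Cycle bases, the Laplacian and spanning trees\<close>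

text \<open>Let \<open>B\<close> be the identity with row \<open>a\<close> replaced by
  \<open>w\<close>. Its determinant is \<open>w a\<close>, while the product of \<open>B\<close> and
  \<open>A\<close> has a zero row; so \<open>A\<close> need not be inverted over the
  rationals.\<close>

lemma det_on_row_kernel:
  fixes A :: "'a \<Rightarrow> 'a \<Rightarrow> int"
  assumes fin: "finite S" and det: "det_on S A \<noteq> 0" and w: "\<forall>j\<in>S. (\<Sum>l\<in>S. w l * A l j) = 0" and a: "a \<in> S"
  shows "w a = 0"
proof -
  define B where "B i l = (if i = a then w l else if i = l then 1 else 0)" for i l
  have "det_on S (\<lambda>i j. \<Sum>l\<in>S. B i l * A l j) = 0"
    unfolding det_on_int
  proof (intro sum.neutral ballI)
    fix p assume "p \<in> {p. p permutes S}"
    then have "(\<Sum>l\<in>S. B a l * A l (p a)) = 0" using w a by (simp add: B_def permutes_in_image)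
    then have "(\<Prod>i\<in>S. \<Sum>l\<in>S. B i l * A l (p i)) = 0" using a fin by (intro prod_zero) auto
    then show "sign p * (\<Prod>i\<in>S. \<Sum>l\<in>S. B i l * A l (p i)) = 0" by simp
  qed
  then have "det_on S B = 0" using det_on_mult[OF fin, of B A] det by simp
  moreover have "det_on S B = (\<Sum>p | p permutes S. if p = id then w a else 0)"
    unfolding det_on_int
  proof (rule sum.cong[OF HOL.refl])
    fix p assume "p \<in> {p. p permutes S}"
    then have p: "p permutes S" by simp
    show "sign p * (\<Prod>i\<in>S. B i (p i)) = (if p = id then w a else 0)"
    proof (cases "\<forall>i\<in>S - {a}. p i = i")
      case True
      then have "p permutes {a}" using permutes_superset[OF p, of "{a}"] by blast
      then have id: "p = id" by simp
      have "(\<Prod>i\<in>S. B i i) = B a a * (\<Prod>i\<in>S - {a}. B i i)" using a fin by (simp add: prod.remove)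
      also have "(\<Prod>i\<in>S - {a}. B i i) = 1" by (intro prod.neutral) (auto simp: B_def)
      finally show ?thesis using id by (simp add: B_def)
    next
      case False
      then obtain i where "i \<in> S - {a}" "p i \<noteq> i" by blast
      then have "B i (p i) = 0" "i \<in> S" by (auto simp: B_def)
      then have "(\<Prod>i\<in>S. B i (p i)) = 0" using fin by (intro prod_zero) blast+
      moreover have "p \<noteq> id" using \<open>p i \<noteq> i\<close> by auto
      ultimately show ?thesis by simp
    qed
  qed
  ultimately show ?thesis using fin by (simp add: finite_permutations permutes_id)
qed

lemma det_on_col_kernel:
  fixes A :: "'a \<Rightarrow> 'a \<Rightarrow> int"
  assumes fin: "finite S" and det: "det_on S A \<noteq> 0" and w: "\<forall>i\<in>S. (\<Sum>l\<in>S. A i l * w l) = 0" and a: "a \<in> S"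
  shows "w a = 0"
  using det_on_row_kernel[of S "\<lambda>i j. A j i" w a] assms det_on_transpose[OF fin, of A] by (simp add: mult.commute)

locale oriented_graph =
  fixes G :: "('v, 'e) mgraph" and src tgt :: "'e \<Rightarrow> 'v"
  assumes finV: "finite (verts G)" and finE: "finite (edges G)"
    and ends: "e \<in> edges G \<Longrightarrow> ends G e = {src e, tgt e}" and no_loop: "e \<in> edges G \<Longrightarrow> src e \<noteq> tgt e"
    and src_V: "e \<in> edges G \<Longrightarrow> src e \<in> verts G" and tgt_V: "e \<in> edges G \<Longrightarrow> tgt e \<in> verts G"
begin

section \<open>Pairings, gradients and boundaries on the edges\<close>

definition sg :: "'v \<Rightarrow> 'e \<Rightarrow> int" where
  "sg u e = (if src e = u then 1 else - 1)"

text \<open>The discrete line integral of \<open>y\<close> along the walk, relative to the reference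
  orientation.\<close>

definition pair :: "('v, 'e) dart list \<Rightarrow> ('e \<Rightarrow> int) \<Rightarrow> int" where
  "pair ds y = (\<Sum>(u, e, v)\<leftarrow>ds. sg u e * y e)"

definition zvec :: "('v, 'e) dart list \<Rightarrow> 'e \<Rightarrow> int" where
  "zvec ds e = pair ds (\<lambda>e'. of_bool (e' = e))"

definition grad :: "('v \<Rightarrow> int) \<Rightarrow> 'e \<Rightarrow> int" where
  "grad p e = p (tgt e) - p (src e)"

definition bd :: "('e \<Rightarrow> int) \<Rightarrow> 'v \<Rightarrow> int" where
  "bd c v = (\<Sum>e\<in>edges G. c e * (of_bool (tgt e = v) - of_bool (src e = v)))"

lemma sg_sq [simp]: "sg u e * sg u e = 1" "sg u e * (sg u e * x) = x"
  by (auto simp: sg_def)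

lemma sg_neq_0 [simp]: "sg u e \<noteq> 0"
  by (simp add: sg_def)

lemma pair_simps [simp]:
  "pair [] y = 0" "pair ((u, e, v) # ds) y = sg u e * y e + pair ds y"
  "pair (p @ q) y = pair p y + pair q y"
  by (simp_all add: pair_def)

lemma pair_add: "pair ds (\<lambda>e. x e + y e) = pair ds x + pair ds y"
  by (induction ds) (auto simp: algebra_simps)

lemma pair_scale: "pair ds (\<lambda>e. c * y e) = c * pair ds y"
  by (induction ds) (auto simp: algebra_simps)

lemma pair_diff: "pair ds (\<lambda>e. x e - y e) = pair ds x - pair ds y"
  by (induction ds) (auto simp: algebra_simps)

lemma pair_sum: "pair ds (\<lambda>e. \<Sum>i\<in>I. f i e) = (\<Sum>i\<in>I. pair ds (f i))"
  by (induction ds) (auto simp: sum.distrib sum_distrib_left)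

lemma pair_cong: "(\<And>e. e \<in> set (dedges ds) \<Longrightarrow> x e = y e) \<Longrightarrow> pair ds x = pair ds y"
  by (induction ds) auto

lemma zvec_simps [simp]:
  "zvec [] e = 0" "zvec ((u, e', v) # ds) e = (if e' = e then sg u e' else 0) + zvec ds e"
  "zvec (p @ q) e = zvec p e + zvec q e"
  by (auto simp: zvec_def)

lemma zvec_notin: "e \<notin> set (dedges ds) \<Longrightarrow> zvec ds e = 0"
  by (induction ds) auto

lemma zvec_dart: "distinct (dedges ds) \<Longrightarrow> (u, e, v) \<in> set ds \<Longrightarrow> zvec ds e = sg u e"
proof (induction ds)
  case (Cons d ds)
  show ?case
  proof (cases "d = (u, e, v)")
    case True
    then show ?thesis using Cons.prems zvec_notin[of e ds] by auto
  next
    case False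
    then have "(u, e, v) \<in> set ds" using Cons.prems by auto
    moreover have "e \<in> set (dedges ds)" using calculation by force
    then have "fst (snd d) \<noteq> e" using Cons.prems(1) by auto
    ultimately show ?thesis using Cons by (cases d) auto
  qed
qed simp

lemma sum_zvec:
  assumes "set (dedges ds) \<subseteq> edges G"
  shows "(\<Sum>e\<in>edges G. zvec ds e * y e) = pair ds y"
  using assms
proof (induction ds)
  case (Cons d ds)
  obtain u e v where d: "d = (u, e, v)" by (cases d)
  have "(\<Sum>e'\<in>edges G. zvec (d # ds) e' * y e') =
      (\<Sum>e'\<in>edges G. (if e' = e then sg u e * y e else 0) + zvec ds e' * y e')"
    by (intro sum.cong) (auto simp: d distrib_right)
  also have "\<dots> = sg u e * y e + pair ds y" using Cons d finE by (simp add: sum.distrib)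
  finally show ?case by (simp add: d)
qed simp

lemma grad_dart:
  assumes "e \<in> edges G" "ends G e = {u, v}"
  shows "sg u e * grad p e = p v - p u" "sg u e = - sg v e"
  using assms ends[OF assms(1)] no_loop[OF assms(1)] by (auto simp: sg_def grad_def doubleton_eq_iff)

lemma pair_grad: "walk G a ds b \<Longrightarrow> pair ds (grad p) = p b - p a"
proof (induction ds arbitrary: a)
  case (Cons d ds)
  obtain u e v where d: "d = (u, e, v)" by (cases d)
  then show ?case using Cons grad_dart(1)[of e u v p] by auto
qed simp

lemma dcycle_pair_grad: "dcycle G C \<Longrightarrow> pair C (grad p) = 0"
  using pair_grad by (auto simp: dcycle_def)

lemma bd_eq: "bd c v = (\<Sum>e\<in>edges G. c e * grad (\<lambda>u. of_bool (u = v)) e)"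
  by (simp add: bd_def grad_def)

text \<open>Summation by parts: gradient and boundary are adjoint.\<close>

lemma sum_grad: "(\<Sum>e\<in>edges G. c e * grad p e) = (\<Sum>v\<in>verts G. p v * bd c v)"
proof -
  have "(\<Sum>v\<in>verts G. p v * bd c v) =
      (\<Sum>e\<in>edges G. \<Sum>v\<in>verts G. c e * (p v * (of_bool (tgt e = v) - of_bool (src e = v))))"
    unfolding bd_def sum_distrib_left by (subst sum.swap) (simp add: algebra_simps)
  also have "\<dots> = (\<Sum>e\<in>edges G. c e * grad p e)"
  proof (rule sum.cong[OF HOL.refl])
    fix e assume e: "e \<in> edges G"
    have "(\<Sum>v\<in>verts G. p v * (of_bool (tgt e = v) - of_bool (src e = v))) =
        (\<Sum>v\<in>verts G. (if v = tgt e then p (tgt e) else 0) - (if v = src e then p (src e) else 0))"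
      by (intro sum.cong) auto
    also have "\<dots> = grad p e" using src_V[OF e] tgt_V[OF e] finV by (simp add: sum_subtractf grad_def)
    finally show "(\<Sum>v\<in>verts G. c e * (p v * (of_bool (tgt e = v) - of_bool (src e = v)))) = c e * grad p e"
      by (simp flip: sum_distrib_left)
  qed
  finally show ?thesis by simp
qed

lemma bd_zvec: "walk G a ds b \<Longrightarrow> bd (zvec ds) v = of_bool (b = v) - of_bool (a = v)"
  unfolding bd_eq using sum_zvec[OF walk_dedges] pair_grad[of a ds b "\<lambda>u. of_bool (u = v)"] by simp

lemma bd_diff: "bd (\<lambda>e. x e - y e) v = bd x v - bd y v"
  by (simp add: bd_def left_diff_distrib sum_subtractf)

lemma bd_scale: "bd (\<lambda>e. c * x e) v = c * bd x v"
  by (simp add: bd_def sum_distrib_left mult.assoc)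

lemma bd_sum: "bd (\<lambda>e. \<Sum>i\<in>I. f i e) v = (\<Sum>i\<in>I. bd (f i) v)"
  unfolding bd_def by (simp add: sum_distrib_right) (rule sum.swap)

lemma bd_cong: "(\<And>e. e \<in> edges G \<Longrightarrow> x e = y e) \<Longrightarrow> bd x v = bd y v"
  unfolding bd_def by (intro sum.cong) auto

lemma bd_dcycle: "dcycle G C \<Longrightarrow> bd (zvec C) v = 0"
  using bd_zvec by (auto simp: dcycle_def)

text \<open>Three integral conditions: the cycles span the flows supported in \<open>E'\<close>; the
  pairings with them attain every integer vector, which includes independence; and a function
  pairing to 0 with all of them is a gradient on \<open>E'\<close>. The last two identify edge
  functions modulo gradients with integer functions on \<open>\<C>\<close>.\<close>

definition cycle_basis :: "'e set \<Rightarrow> ('v, 'e) dart list set \<Rightarrow> bool" where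
  "cycle_basis E' \<C> \<longleftrightarrow> finite \<C> \<and> (\<forall>C\<in>\<C>. dcycle G C \<and> set (dedges C) \<subseteq> E') \<and>
    (\<forall>c. (\<forall>e. e \<notin> E' \<longrightarrow> c e = 0) \<and> (\<forall>v. bd c v = 0) \<longrightarrow> (\<exists>a. \<forall>e. c e = (\<Sum>C\<in>\<C>. a C * zvec C e))) \<and>
    (\<forall>t. \<exists>y. \<forall>C\<in>\<C>. pair C y = t C) \<and>
    (\<forall>y. (\<forall>C\<in>\<C>. pair C y = 0) \<longrightarrow> (\<exists>p. \<forall>e\<in>E'. y e = grad p e))"

lemma cycle_basisD:
  assumes "cycle_basis E' \<C>"
  shows "finite \<C>" "C \<in> \<C> \<Longrightarrow> dcycle G C \<and> set (dedges C) \<subseteq> E'"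
    "(\<forall>e. e \<notin> E' \<longrightarrow> c e = 0) \<Longrightarrow> (\<forall>v. bd c v = 0) \<Longrightarrow> \<exists>k. \<forall>e. c e = (\<Sum>C\<in>\<C>. k C * zvec C e)"
    "\<exists>y. \<forall>C\<in>\<C>. pair C y = t C"
    "(\<forall>C\<in>\<C>. pair C y = 0) \<Longrightarrow> \<exists>p. \<forall>e\<in>E'. y e = grad p e"
proof -
  note 1 = assms[unfolded cycle_basis_def]
  show "finite \<C>" by (rule 1[THEN conjunct1])
  show "C \<in> \<C> \<Longrightarrow> dcycle G C \<and> set (dedges C) \<subseteq> E'" by (rule 1[THEN conjunct2, THEN conjunct1, THEN bspec])
  show "(\<forall>e. e \<notin> E' \<longrightarrow> c e = 0) \<Longrightarrow> (\<forall>v. bd c v = 0) \<Longrightarrow> \<exists>k. \<forall>e. c e = (\<Sum>C\<in>\<C>. k C * zvec C e)"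
    by (rule 1[THEN conjunct2, THEN conjunct2, THEN conjunct1, THEN spec, THEN mp, OF conjI])
  show "\<exists>y. \<forall>C\<in>\<C>. pair C y = t C"
    by (rule 1[THEN conjunct2, THEN conjunct2, THEN conjunct2, THEN conjunct1, THEN spec])
  show "(\<forall>C\<in>\<C>. pair C y = 0) \<Longrightarrow> \<exists>p. \<forall>e\<in>E'. y e = grad p e"
    by (rule 1[THEN conjunct2, THEN conjunct2, THEN conjunct2, THEN conjunct2, THEN spec, THEN mp])
qed

text \<open>The potential is built backwards from the end of the path; the new first vertex does not
  occur later, so its value can be chosen to fit the first edge.\<close>

lemma dpath_potential:
  assumes "dpath G a ds b"
  shows "\<exists>p. \<forall>e\<in>set (dedges ds). y e = grad p e"
  using assms
proof (induction ds arbitrary: a)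
  case (Cons d ds)
  obtain u e v where d: "d = (u, e, v)" by (cases d)
  have e: "e \<in> edges G" "ends G e = {u, v}" "u \<noteq> v" and v: "dpath G v ds b" and u: "u \<notin> set (tails ds @ [b])"
    using Cons.prems d by (auto simp: dpath_def)
  obtain p where p: "\<forall>e\<in>set (dedges ds). y e = grad p e" using Cons.IH[OF v] by blast
  let ?p = "p(u := p v - sg u e * y e)"
  have "sg u e * grad ?p e = sg u e * y e" using grad_dart(1)[OF e(1,2), of ?p] e by simp
  then have "y e = grad ?p e" by simp
  moreover have "y e' = grad ?p e'" if e': "e' \<in> set (dedges ds)" for e'
  proof -
    obtain x w where "(x, e', w) \<in> set ds" using e' by auto
    then have "x \<in> set (tails ds @ [b])" "w \<in> set (tails ds @ [b])" "e' \<in> edges G" "ends G e' = {x, w}"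
      using walk_vertices[of G v ds b] walk_dart[of G v ds b] v by (auto simp: dpath_def)
    then have "src e' \<noteq> u" "tgt e' \<noteq> u" using ends[of e'] u by auto
    then have "grad ?p e' = grad p e'" by (simp add: grad_def)
    moreover have "y e' = grad p e'" using p e' by (rule bspec)
    ultimately show ?thesis by simp
  qed
  ultimately have "\<forall>e'\<in>insert e (set (dedges ds)). y e' = grad ?p e'" by blast
  moreover have "set (dedges (d # ds)) = insert e (set (dedges ds))" using d by simp
  ultimately show ?case by (intro exI[of _ ?p]) (simp only:)
qed simp

text \<open>All three conditions are settled at the closing edge \<open>e\<close>, since on the path
  \<open>ds\<close> that is left without it every function is a gradient.\<close>

lemma cycle_basis_cycle:
  assumes C: "dcycle G C"
  shows "cycle_basis (set (dedges C)) {C}"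
proof -
  obtain a b ds e where ds: "C = ds @ [(b, e, a)]" "dpath G a ds b" "e \<notin> set (dedges ds)" "e \<in> edges G"
    "ends G e = {b, a}" "b \<noteq> a"
    using dcycle_last[OF C] by blast
  have w: "walk G a ds b" using ds by (simp add: dpath_def)
  have zC: "zvec C e = sg b e" using ds zvec_notin[of e ds] by simp
  have "\<exists>k. \<forall>e. c e = (\<Sum>D\<in>{C}. k D * zvec D e)"
    if c: "\<forall>e. e \<notin> set (dedges C) \<longrightarrow> c e = 0" "\<forall>v. bd c v = 0" for c
  proof -
    \<comment> \<open>Subtracting this multiple of the cycle clears \<open>e\<close>, where the
      cycle has the value \<open>sg b e\<close>, its own inverse.\<close>
    define c' where "c' e' = c e' - sg b e * c e * zvec C e'" for e'
    have bd0: "bd c' v = 0" for v unfolding c'_def bd_diff bd_scale using c bd_dcycle[OF C] by simp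
    have supp: "c' e' = 0" if "e' \<notin> set (dedges ds)" for e'
    proof (cases "e' = e")
      case True
      then show ?thesis unfolding c'_def by (simp add: zC algebra_simps)
    next
      case False
      then have "e' \<notin> set (dedges C)" using that ds by auto
      then show ?thesis unfolding c'_def using c zvec_notin by simp
    qed
    obtain p where p: "\<forall>e\<in>set (dedges ds). c' e = grad p e" using dpath_potential[OF ds(2)] by blast
    \<comment> \<open>A flow that is also a gradient on its support is orthogonal to itself, hence
      0.\<close>
    have "(\<Sum>e\<in>edges G. c' e * c' e) = (\<Sum>e\<in>edges G. c' e * grad p e)"
    proof (rule sum.cong[OF HOL.refl])
      fix e' assume "e' \<in> edges G"
      show "c' e' * c' e' = c' e' * grad p e'"
        using p supp by (cases "e' \<in> set (dedges ds)") (simp_all del: set_map)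
    qed
    also have "\<dots> = 0" unfolding sum_grad by (simp add: bd0)
    finally have "\<forall>e\<in>edges G. c' e * c' e = 0" using finE by (subst (asm) sum_nonneg_eq_0_iff) auto
    moreover have "c' e' = 0" if "e' \<notin> edges G" for e'
      using that supp walk_dedges[OF w] by blast
    ultimately have z: "c' e' = 0" for e' by fastforce
    have "c e' = (\<Sum>D\<in>{C}. sg b e * c e * zvec D e')" for e' using z[of e'] by (simp add: c'_def)
    then show ?thesis by (intro exI[of _ "\<lambda>_. sg b e * c e"] allI)
  qed
  moreover have "\<exists>y. \<forall>D\<in>{C}. pair D y = t D" for t
  proof -
    let ?y = "\<lambda>e'. if e' = e then sg b e * t C else 0"
    have "pair ds ?y = pair ds (\<lambda>_. 0)" using ds(3) by (intro pair_cong) auto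
    also have "\<dots> = 0" by (induction ds) auto
    finally show ?thesis using ds by (intro exI[of _ ?y]) simp
  qed
  moreover have "\<exists>p. \<forall>e\<in>set (dedges C). y e = grad p e" if y: "pair C y = 0" for y
  proof -
    obtain p where p: "\<forall>e\<in>set (dedges ds). y e = grad p e" using dpath_potential[OF ds(2)] by blast
    then have "pair ds y = pair ds (grad p)" by (intro pair_cong) auto
    also have "\<dots> = p b - p a" by (rule pair_grad[OF w])
    also have "\<dots> = - (sg b e * grad p e)" using grad_dart(1)[OF ds(4,5), of p] by simp
    finally have "sg b e * y e = sg b e * grad p e" using y ds(1) by simp
    then have "y e = grad p e" by simp
    then show ?thesis using p ds(1) by (intro exI[of _ p]) auto
  qed
  ultimately show ?thesis using C unfolding cycle_basis_def by auto
qed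

text \<open>As chains, \<open>C\<close> is the sum of \<open>C1\<close> and \<open>C2\<close>,
  because these traverse \<open>e0\<close> in opposite directions, and \<open>e0\<close> occurs in
  no old cycle. So \<open>e0\<close> is a free coordinate that adjusts the new cycles without
  affecting the old ones.\<close>

lemma cycle_basis_chord:
  assumes basis: "cycle_basis E' \<C>" and C: "C \<in> \<C>" and e0: "e0 \<in> edges G - E'" "ends G e0 = {a, b}"
    and p: "walk G a p b" and q: "walk G b q a" and pair_pq: "\<And>y. pair C y = pair p y + pair q y"
    and pq: "set (dedges p) \<union> set (dedges q) \<subseteq> E'"
    and C1: "C1 = p @ [(b, e0, a)]" "dcycle G C1" and C2: "C2 = q @ [(a, e0, b)]" "dcycle G C2"
  shows "cycle_basis (insert e0 E') (insert C1 (insert C2 (\<C> - {C})))" "C1 \<noteq> C2" "C1 \<notin> \<C>" "C2 \<notin> \<C>"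
proof -
  note fin = cycle_basisD(1)[OF basis] and cyc = cycle_basisD(2)[OF basis] and cycle_in_span = cycle_basisD(3)[OF basis]
    and pair_onto = cycle_basisD(4)[OF basis] and pair_zero_grad = cycle_basisD(5)[OF basis]
  define s where "s = sg b e0"
  have s: "s * s = 1" "s * (s * x) = x" "s \<noteq> 0" for x by (auto simp: s_def)
  have sa: "sg a e0 = - s" using grad_dart(2)[of e0 a b] e0 by (simp add: s_def)
  have e0_notin: "e0 \<notin> set (dedges D)" if "D \<in> \<C>" for D using cyc[OF that] e0 by blast
  have "e0 \<notin> set (dedges p)" "e0 \<notin> set (dedges q)" using pq e0 by blast+
  then have z0: "zvec p e0 = 0" "zvec q e0 = 0" by (simp_all add: zvec_notin)
  have z1: "zvec C1 e0 = s" and z2: "zvec C2 e0 = - s" using z0 C1 C2 sa by (simp_all add: s_def)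
  show C12: "C1 \<noteq> C2" using z1 z2 s by auto
  show C1n: "C1 \<notin> \<C>" and C2n: "C2 \<notin> \<C>" using e0_notin C1 C2 by fastforce+
  have pair1: "pair C1 y = pair p y + s * y e0" and pair2: "pair C2 y = pair q y - s * y e0" for y
    using C1 C2 sa by (simp_all add: s_def)
  have pairC: "pair C y = pair C1 y + pair C2 y" for y using pair1 pair2 pair_pq by simp
  then have zC: "zvec C e = zvec C1 e + zvec C2 e" for e by (simp add: zvec_def)
  let ?\<C> = "insert C1 (insert C2 (\<C> - {C}))"
  have sum': "(\<Sum>D\<in>?\<C>. f D) = f C1 + (f C2 + (\<Sum>D\<in>\<C> - {C}. f D))" for f :: "_ \<Rightarrow> int"
    using fin C12 C1n C2n by simp
  have sumC: "(\<Sum>D\<in>\<C>. f D) = f C + (\<Sum>D\<in>\<C> - {C}. f D)" for f :: "_ \<Rightarrow> int"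
    using fin C by (simp add: sum.remove)
  have "\<exists>k. \<forall>e. c e = (\<Sum>D\<in>?\<C>. k D * zvec D e)"
    if c: "\<forall>e. e \<notin> insert e0 E' \<longrightarrow> c e = 0" "\<forall>v. bd c v = 0" for c
  proof -
    \<comment> \<open>\<open>C1\<close> has the value \<open>s\<close> on the chord and
      \<open>s * s = 1\<close>, so this multiple of \<open>C1\<close> removes the chord from
      \<open>c\<close>.\<close>
    define \<alpha> where "\<alpha> = s * c e0"
    define c' where "c' e = c e - \<alpha> * zvec C1 e" for e
    have "bd c' v = 0" for v unfolding c'_def bd_diff bd_scale using c bd_dcycle[OF C1(2)] by simp
    moreover have "c' e = 0" if "e \<notin> E'" for e
    proof (cases "e = e0")
      case True
      then show ?thesis unfolding c'_def \<alpha>_def using z1 s by (simp add: algebra_simps)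
    next
      case False
      then have "e \<notin> set (dedges C1)" using that pq C1 by auto
      then show ?thesis unfolding c'_def using c that False zvec_notin by simp
    qed
    ultimately obtain k where k: "\<And>e. c' e = (\<Sum>D\<in>\<C>. k D * zvec D e)" using cycle_in_span[of c'] by blast
    \<comment> \<open>The coefficient of \<open>C\<close> goes to both parts; \<open>C1\<close> also
      gets back what was subtracted.\<close>
    define k' where "k' = k(C1 := k C + \<alpha>, C2 := k C)"
    have "(\<Sum>D\<in>\<C> - {C}. k' D * zvec D e) = (\<Sum>D\<in>\<C> - {C}. k D * zvec D e)" for e
      using C1n C2n by (intro sum.cong) (auto simp: k'_def)
    then have "c e = (\<Sum>D\<in>?\<C>. k' D * zvec D e)" for e
      using k[of e] zC[of e] C12 unfolding sum' sumC c'_def by (simp add: k'_def algebra_simps)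
    then show ?thesis by blast
  qed
  moreover have "\<exists>y. \<forall>D\<in>?\<C>. pair D y = t D" for t
  proof -
    \<comment> \<open>The old cycle receives the sum of the two prescribed values; the value at
      \<open>e0\<close> then settles \<open>C1\<close>, and \<open>C2\<close> follows.\<close>
    obtain y where y: "\<forall>D\<in>\<C>. pair D y = (t(C := t C1 + t C2)) D" using pair_onto by blast
    define y' where "y' = y(e0 := s * (t C1 - pair p y))"
    have same: "pair D y' = pair D y" if "e0 \<notin> set (dedges D)" for D
      using that by (intro pair_cong) (auto simp: y'_def)
    have "pair D y' = t D" if "D \<in> \<C> - {C}" for D
      using that same[OF e0_notin] y by auto
    moreover have "pair C1 y' = t C1" using pair1[of y'] same[of p] \<open>e0 \<notin> set (dedges p)\<close> s by (simp add: y'_def)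
    moreover have "pair C2 y' = t C2"
      using pair2[of y'] same[of q] \<open>e0 \<notin> set (dedges q)\<close> s pair_pq[of y] y C by (simp add: y'_def)
    ultimately show ?thesis by (intro exI[of _ y']) auto
  qed
  moreover have "\<exists>P. \<forall>e\<in>insert e0 E'. y e = grad P e" if y: "\<forall>D\<in>?\<C>. pair D y = 0" for y
  proof -
    have "pair C y = 0" using pairC y by simp
    then have "\<forall>D\<in>\<C>. pair D y = 0" using y by auto
    then obtain P where P: "\<forall>e\<in>E'. y e = grad P e" using pair_zero_grad by blast
    then have "pair p y = pair p (grad P)" using pq by (intro pair_cong) auto
    also have "\<dots> = P b - P a" by (rule pair_grad[OF p])
    also have "\<dots> = - (s * grad P e0)"
      using grad_dart(1)[of e0 b a P] e0 by (simp add: s_def insert_commute)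
    finally have "s * y e0 = s * grad P e0" using pair1[of y] y by simp
    then have "y e0 = grad P e0" using s by simp
    then show ?thesis using P by blast
  qed
  moreover have "dcycle G D \<and> set (dedges D) \<subseteq> insert e0 E'" if "D \<in> ?\<C>" for D
  proof -
    have "set (dedges C1) = insert e0 (set (dedges p))" "set (dedges C2) = insert e0 (set (dedges q))"
      using C1 C2 by simp_all
    then show ?thesis using that cyc C1(2) C2(2) pq by blast
  qed
  ultimately show "cycle_basis (insert e0 E') ?\<C>"
    using fin unfolding cycle_basis_def by auto
qed

section \<open>The Laplacian as the boundary of the gradient\<close>

lemma laplacian_eq:
  "laplacian G u v = (\<Sum>e\<in>edges G. (of_bool (tgt e = u) - of_bool (src e = u)) *
     (of_bool (tgt e = v) - of_bool (src e = v)))"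
proof -
  have inc: "incidences G e u = of_bool (u \<in> {src e, tgt e})" if "e \<in> edges G" for e u
    using ends[OF that] no_loop[OF that] by (simp add: incidences_def)
  have adj: "int (adjacency G u v) = (\<Sum>e\<in>edges G. of_bool (ends G e = {u, v} \<and> u \<in> {src e, tgt e}))"
    unfolding adjacency_def of_nat_sum
    by (rule sum.mono_neutral_cong_left) (use finE inc in auto)
  show ?thesis
  proof (cases "u = v")
    case True
    have "int (adjacency G u v) = 0"
      unfolding adj using ends no_loop True by (intro sum.neutral) force
    moreover have "int (\<Sum>e\<in>edges G. incidences G e u) =
        (\<Sum>e\<in>edges G. (of_bool (tgt e = u) - of_bool (src e = u)) * (of_bool (tgt e = v) - of_bool (src e = v)))"
      unfolding of_nat_sum using no_loop True by (intro sum.cong) (auto simp: inc)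
    ultimately show ?thesis using True by (simp add: laplacian_def)
  next
    case False
    have "- int (adjacency G u v) =
        (\<Sum>e\<in>edges G. (of_bool (tgt e = u) - of_bool (src e = u)) * (of_bool (tgt e = v) - of_bool (src e = v)))"
      unfolding adj sum_negf[symmetric]
    proof (rule sum.cong[OF HOL.refl])
      fix e assume e: "e \<in> edges G"
      show "- of_bool (ends G e = {u, v} \<and> u \<in> {src e, tgt e}) =
        (of_bool (tgt e = u) - of_bool (src e = u)) * (of_bool (tgt e = v) - of_bool (src e = v) :: int)"
        by (cases "tgt e = u"; cases "src e = u"; cases "tgt e = v"; cases "src e = v")
          (use ends[OF e] no_loop[OF e] False in \<open>simp_all add: doubleton_eq_iff\<close>)
    qed
    then show ?thesis using False by (simp add: laplacian_def)
  qed
qed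

lemma laplacian_grad:
  "(\<Sum>v\<in>verts G. laplacian G u v * f v) = bd (grad f) u"
proof -
  have "(\<Sum>v\<in>verts G. laplacian G u v * f v) = (\<Sum>v\<in>verts G. f v * bd (\<lambda>e. of_bool (tgt e = u) - of_bool (src e = u)) v)"
    unfolding laplacian_eq bd_def by (simp add: mult.commute)
  also have "\<dots> = (\<Sum>e\<in>edges G. (of_bool (tgt e = u) - of_bool (src e = u)) * grad f e)"
    by (rule sum_grad[symmetric])
  finally show ?thesis by (simp add: bd_def mult.commute)
qed

lemma bd_total: "(\<Sum>v\<in>verts G. bd y v) = 0"
  using sum_grad[of y "\<lambda>_. 1"] by (simp add: grad_def)

lemma bd_surj:
  assumes conn: "connected_graph G" and x: "(\<Sum>v\<in>verts G. x v) = 0"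
  shows "\<exists>y. \<forall>v\<in>verts G. bd y v = x v"
proof -
  obtain r where r: "r \<in> verts G" using conn by (auto simp: connected_graph_def)
  have "\<exists>ds. walk G r ds v" if "v \<in> verts G" for v
  proof -
    have "(r, v) \<in> (adj_rel G)\<^sup>*" using conn r that by (simp add: connected_graph_adj_rel)
    then obtain ds where "dpath G r ds v" using rtrancl_imp_dpath by metis
    then show ?thesis unfolding dpath_def by blast
  qed
  then obtain W where W: "\<And>v. v \<in> verts G \<Longrightarrow> walk G r (W v) v" by metis
  \<comment> \<open>\<open>x v\<close> units are sent from \<open>r\<close> to every
    \<open>v\<close>; the total drawn from \<open>r\<close> is the sum of \<open>x\<close>, which is
    0.\<close>
  define y where "y e = (\<Sum>v\<in>verts G. x v * zvec (W v) e)" for e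
  have "bd y u = x u" if u: "u \<in> verts G" for u
  proof -
    have "bd y u = (\<Sum>v\<in>verts G. x v * (of_bool (v = u) - of_bool (r = u)))"
      unfolding y_def bd_sum bd_scale using W by (intro sum.cong) (auto simp: bd_zvec)
    also have "\<dots> = (\<Sum>v\<in>verts G. if v = u then x u else 0) - (\<Sum>v\<in>verts G. x v) * of_bool (r = u)"
      by (auto simp: sum_distrib_right right_diff_distrib sum_subtractf intro!: sum.cong)
    finally show ?thesis using x u finV by simp
  qed
  then show ?thesis by blast
qed

definition gram :: "('v, 'e) dart list \<Rightarrow> ('v, 'e) dart list \<Rightarrow> int" where
  "gram C D = (\<Sum>e\<in>edges G. zvec C e * zvec D e)"

context
  fixes \<C> assumes basis: "cycle_basis (edges G) \<C>" and conn: "connected_graph G"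
begin

lemmas fin\<C> = cycle_basisD(1)[OF basis] and cycle_in_span = cycle_basisD(3)[OF basis]
  and pair_onto = cycle_basisD(4)[OF basis] and pair_zero_grad = cycle_basisD(5)[OF basis]

lemma cyc: "C \<in> \<C> \<Longrightarrow> dcycle G C"
  using cycle_basisD(2)[OF basis] by blast

lemma pair_sum_edges: "C \<in> \<C> \<Longrightarrow> pair C y = (\<Sum>e\<in>edges G. zvec C e * y e)"
  using sum_zvec[OF dcycle_dedges] cyc by simp

text \<open>If the boundary of \<open>y\<close> lies in the Laplacian image, then \<open>y\<close>
  minus a gradient is a flow, hence a combination of the cycles; pairing kills the gradient and
  turns the combination into a Gram image. Conversely, what pairs to 0 is a gradient, and
  subtracting cycles does not change the boundary.\<close>

lemma laplacian_image_iff: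
  "(\<exists>f. \<forall>u\<in>verts G. bd y u = (\<Sum>v\<in>verts G. laplacian G u v * f v)) \<longleftrightarrow> im_on \<C> gram (\<lambda>C. pair C y)"
proof
  assume "\<exists>f. \<forall>u\<in>verts G. bd y u = (\<Sum>v\<in>verts G. laplacian G u v * f v)"
  then obtain f where f: "\<forall>u\<in>verts G. bd y u = bd (grad f) u" by (auto simp: laplacian_grad)
  define c where "c e = (if e \<in> edges G then y e - grad f e else 0)" for e
  have "bd c u = 0" for u
  proof (cases "u \<in> verts G")
    case True
    have "bd c u = bd (\<lambda>e. y e - grad f e) u" by (rule bd_cong) (simp add: c_def)
    then show ?thesis using f True by (simp add: bd_diff)
  next
    case False
    then show ?thesis unfolding bd_def using src_V tgt_V by (intro sum.neutral) auto
  qed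
  then obtain k where k: "\<And>e. c e = (\<Sum>C\<in>\<C>. k C * zvec C e)" using cycle_in_span[of c] by (auto simp: c_def)
  have "pair C y = (\<Sum>D\<in>\<C>. gram C D * k D)" if C: "C \<in> \<C>" for C
  proof -
    have "pair C y = pair C (\<lambda>e. grad f e + c e)"
      using dcycle_dedges[OF cyc[OF C]] by (intro pair_cong) (auto simp: c_def)
    also have "\<dots> = pair C c" by (simp add: pair_add dcycle_pair_grad[OF cyc[OF C]])
    also have "\<dots> = (\<Sum>D\<in>\<C>. k D * pair C (zvec D))" unfolding k[abs_def] pair_sum pair_scale ..
    finally show ?thesis using C by (simp add: gram_def pair_sum_edges mult.commute)
  qed
  then show "im_on \<C> gram (\<lambda>C. pair C y)" unfolding im_on_def by blast
next
  assume "im_on \<C> gram (\<lambda>C. pair C y)"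
  then obtain k where k: "\<And>C. C \<in> \<C> \<Longrightarrow> pair C y = (\<Sum>D\<in>\<C>. gram C D * k D)" unfolding im_on_def by blast
  define c where "c e = (\<Sum>D\<in>\<C>. k D * zvec D e)" for e
  have "pair C (\<lambda>e. y e - c e) = 0" if C: "C \<in> \<C>" for C
    using k[OF C] C by (simp add: pair_diff c_def pair_sum pair_scale gram_def pair_sum_edges mult.commute)
  then obtain p where p: "\<forall>e\<in>edges G. y e - c e = grad p e" using pair_zero_grad[of "\<lambda>e. y e - c e"] by blast
  have "bd y u = bd (grad p) u" for u
  proof -
    have "bd (grad p) u = bd (\<lambda>e. y e - c e) u" using p by (intro bd_cong) auto
    also have "\<dots> = bd y u" by (simp add: bd_diff c_def bd_sum bd_scale bd_dcycle[OF cyc])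
    finally show ?thesis by simp
  qed
  then show "\<exists>f. \<forall>u\<in>verts G. bd y u = (\<Sum>v\<in>verts G. laplacian G u v * f v)" by (auto simp: laplacian_grad)
qed

section \<open>Spanning trees and the minors of the cycle matrix\<close>

lemma grad_const:
  assumes "(u, v) \<in> (adj_rel H)\<^sup>*" "\<And>e. e \<in> edges H \<Longrightarrow> e \<in> edges G \<and> ends H e = ends G e \<and> grad p e = 0"
  shows "p u = p v"
  using assms(1)
proof induction
  case (step y z)
  then obtain e where "e \<in> edges H" "ends H e = {y, z}" by (auto simp: adj_rel_def)
  then have "grad p e = 0" "{src e, tgt e} = {y, z}" using assms(2) ends by metis+
  then show ?case using step by (auto simp: grad_def doubleton_eq_iff)
qed simp

text \<open>Deleting the edge \<open>e\<close> from a tree separates its ends; the indicator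
  \<open>P e\<close> of the side of \<open>tgt e\<close> has gradient 1 on \<open>e\<close> and 0 on
  the other tree edges. Weighted sums of these cut functions give every function on the
  tree.\<close>

lemma tree_potential:
  assumes S: "S \<subseteq> edges G" and tree: "is_tree (G\<lparr>edges := S\<rparr>)"
  shows "\<exists>p. \<forall>e\<in>S. y e = grad p e"
proof -
  let ?R = "\<lambda>e. (adj_rel (G\<lparr>edges := S - {e}\<rparr>))\<^sup>*"
  define P where "P e x = (of_bool ((tgt e, x) \<in> ?R e) :: int)" for e x
  have wfS: "ends G e \<subseteq> verts G" if "e \<in> S" for e
    using that S ends[of e] src_V[of e] tgt_V[of e] by auto
  have bridge: "(tgt e, src e) \<notin> ?R e" if e: "e \<in> S" for e
  proof
    assume "(tgt e, src e) \<in> ?R e"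
    then obtain ds where ds: "dpath (G\<lparr>edges := S - {e}\<rparr>) (tgt e) ds (src e)" using rtrancl_imp_dpath by metis
    then have "dpath (G\<lparr>edges := S\<rparr>) (tgt e) ds (src e)" unfolding dpath_def by (auto intro: walk_mono)
    moreover have "e \<notin> set (dedges ds)" using ds walk_dedges unfolding dpath_def by fastforce
    ultimately have "dcycle (G\<lparr>edges := S\<rparr>) (ds @ [(src e, e, tgt e)])"
      using e S ends[of e] no_loop[of e] by (intro dpath_close_dcycle) (auto simp: insert_commute)
    then have "is_cycle (G\<lparr>edges := S\<rparr>) (tails (ds @ [(src e, e, tgt e)])) (dedges (ds @ [(src e, e, tgt e)]))"
      using wfS by (intro dcycle_is_cycle) auto
    then show False using tree unfolding is_tree_def by blast
  qed
  have P1: "grad (P e) e' = of_bool (e = e')" if "e \<in> S" "e' \<in> S" for e e'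
  proof (cases "e = e'")
    case True
    then show ?thesis using bridge[OF that(1)] by (simp add: grad_def P_def)
  next
    case False
    then have "(src e', tgt e') \<in> adj_rel (G\<lparr>edges := S - {e}\<rparr>)"
      using that S ends by (auto simp: adj_rel_def)
    then have 1: "(src e', tgt e') \<in> ?R e" by (rule r_into_rtrancl)
    note 1 rtrancl_adj_rel_sym[OF 1]
    then have "(tgt e, tgt e') \<in> ?R e \<longleftrightarrow> (tgt e, src e') \<in> ?R e" by (meson rtrancl_trans)
    then show ?thesis using False by (simp add: grad_def P_def)
  qed
  have finS: "finite S" using S finE finite_subset by blast
  have "y e' = grad (\<lambda>x. \<Sum>e\<in>S. y e * P e x) e'" if e': "e' \<in> S" for e'
  proof -
    have "grad (\<lambda>x. \<Sum>e\<in>S. y e * P e x) e' = (\<Sum>e\<in>S. y e * grad (P e) e')"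
      by (simp add: grad_def right_diff_distrib sum_subtractf)
    also have "\<dots> = (\<Sum>e\<in>S. if e = e' then y e' else 0)" using P1 e' by (intro sum.cong) auto
    finally show ?thesis using finS e' by simp
  qed
  then show ?thesis by blast
qed

text \<open>The columns of the inverse are edge functions dual to the cycles, made to vanish on the
  tree by subtracting gradients. Both products are computed because \<open>S\<close> and
  \<open>\<C>\<close> are not yet known to have equal size.\<close>

lemma tree_inverse:
  assumes S: "S \<subseteq> edges G" and tree: "is_tree (G\<lparr>edges := edges G - S\<rparr>)"
  shows "\<exists>B. (\<forall>C\<in>\<C>. \<forall>D\<in>\<C>. (\<Sum>e\<in>S. zvec C e * B e D) = of_bool (C = D)) \<and>
    (\<forall>e\<in>S. \<forall>e'\<in>S. (\<Sum>C\<in>\<C>. B e C * zvec C e') = of_bool (e = e'))"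
proof -
  let ?S' = "edges G - S"
  have finS: "finite S" using S finE finite_subset by blast
  have sumS: "(\<Sum>e\<in>edges G. zvec C e * y e) = (\<Sum>e\<in>S. zvec C e * y e)" if "\<forall>e\<in>?S'. y e = 0" for y C
    using that S finE by (intro sum.mono_neutral_right) auto
  have "\<exists>y. (\<forall>C\<in>\<C>. pair C y = of_bool (C = D)) \<and> (\<forall>e\<in>?S'. y e = 0)" for D
  proof -
    obtain y where y: "\<forall>C\<in>\<C>. pair C y = of_bool (C = D)" using pair_onto[of "\<lambda>C. of_bool (C = D)"] by blast
    obtain p where p: "\<forall>e\<in>?S'. y e = grad p e" using tree_potential[OF _ tree] by blast
    then show ?thesis using y
      by (intro exI[of _ "\<lambda>e. y e - grad p e"]) (simp add: pair_diff dcycle_pair_grad[OF cyc])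
  qed
  then obtain Y where Y: "\<And>C D. C \<in> \<C> \<Longrightarrow> pair C (Y D) = of_bool (C = D)" "\<And>D e. e \<in> ?S' \<Longrightarrow> Y D e = 0"
    by metis
  define B where "B e D = Y D e" for e D
  have 1: "(\<Sum>e\<in>S. zvec C e * B e D) = of_bool (C = D)" if "C \<in> \<C>" "D \<in> \<C>" for C D
    using Y(1)[OF that(1), of D] sumS[of "Y D" C] Y(2) pair_sum_edges[OF that(1)] by (simp add: B_def)
  have 2: "(\<Sum>C\<in>\<C>. B e C * zvec C e') = of_bool (e = e')" if e: "e \<in> S" "e' \<in> S" for e e'
  proof -
    \<comment> \<open>The error of the second product. It pairs to 0 with all cycles, so it is a
      gradient; it vanishes on the tree, so the potential is constant.\<close>
    define w where "w e = (if e \<in> S then of_bool (e = e') - (\<Sum>C\<in>\<C>. B e C * zvec C e') else 0)" for e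
    have "pair D w = 0" if D: "D \<in> \<C>" for D
    proof -
      have "pair D w = (\<Sum>e\<in>S. zvec D e * w e)" using pair_sum_edges[OF D] sumS[of w D] by (simp add: w_def)
      also have "\<dots> = (\<Sum>e\<in>S. (if e = e' then zvec D e' else 0) - (\<Sum>C\<in>\<C>. zvec D e * B e C * zvec C e'))"
        by (intro sum.cong) (auto simp: w_def right_diff_distrib sum_distrib_left mult.assoc)
      also have "\<dots> = zvec D e' - (\<Sum>C\<in>\<C>. (\<Sum>e\<in>S. zvec D e * B e C) * zvec C e')"
        using finS e(2) by (simp add: sum_subtractf sum_distrib_right) (rule sum.swap)
      also have "(\<Sum>C\<in>\<C>. (\<Sum>e\<in>S. zvec D e * B e C) * zvec C e') = (\<Sum>C\<in>\<C>. if C = D then zvec D e' else 0)"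
        using 1[OF D] by (intro sum.cong) auto
      finally show ?thesis using D fin\<C> by simp
    qed
    then obtain p where p: "\<forall>e\<in>edges G. w e = grad p e" using pair_zero_grad by blast
    have const: "p u = p v" if "u \<in> verts G" "v \<in> verts G" for u v
    proof (rule grad_const)
      show "(u, v) \<in> (adj_rel (G\<lparr>edges := ?S'\<rparr>))\<^sup>*"
        using tree that by (simp add: is_tree_def connected_graph_adj_rel)
      fix e assume "e \<in> edges (G\<lparr>edges := ?S'\<rparr>)"
      then show "e \<in> edges G \<and> ends (G\<lparr>edges := ?S'\<rparr>) e = ends G e \<and> grad p e = 0"
        using p by (auto simp: w_def)
    qed
    have "w e = grad p e" "e \<in> edges G" using p e S by blast+
    then have "w e = 0" using const[OF tgt_V src_V, of e e] by (simp add: grad_def)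
    then show ?thesis using e by (simp add: w_def)
  qed
  show ?thesis using 1 2 by blast
qed

lemma tree_complement_card:
  assumes S: "S \<subseteq> edges G" and tree: "is_tree (G\<lparr>edges := edges G - S\<rparr>)"
  shows "card S = card \<C>"
proof -
  obtain B where B: "\<forall>C\<in>\<C>. \<forall>D\<in>\<C>. (\<Sum>e\<in>S. zvec C e * B e D) = of_bool (C = D)"
    "\<forall>e\<in>S. \<forall>e'\<in>S. (\<Sum>C\<in>\<C>. B e C * zvec C e') = of_bool (e = e')"
    using tree_inverse[OF assms] by blast
  \<comment> \<open>The two products of the mutually inverse matrices have the same trace.\<close>
  have "int (card S) = (\<Sum>e\<in>S. \<Sum>C\<in>\<C>. B e C * zvec C e)" using B(2) by simp
  also have "\<dots> = (\<Sum>C\<in>\<C>. \<Sum>e\<in>S. zvec C e * B e C)" by (subst sum.swap) (simp add: mult.commute)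
  also have "\<dots> = int (card \<C>)" using B(1) by simp
  finally show ?thesis by simp
qed

text \<open>For the complement of a tree the matrix is invertible over the integers. Otherwise it is
  singular: if the remaining edges do not connect the graph, a cut function gives a vector
  annihilated from the right; if they contain a cycle, its coefficients in the basis are annihilated
  from the left.\<close>

lemma tree_complement_det:
  assumes S: "S \<subseteq> edges G" and b: "bij_betw b \<C> S"
  shows "(det_on \<C> (\<lambda>C D. zvec C (b D)))\<^sup>2 = of_bool (is_tree (G\<lparr>edges := edges G - S\<rparr>))"
proof (cases "is_tree (G\<lparr>edges := edges G - S\<rparr>)")
  case True
  then obtain B where B: "\<forall>C\<in>\<C>. \<forall>D\<in>\<C>. (\<Sum>e\<in>S. zvec C e * B e D) = of_bool (C = D)"
    using tree_inverse[OF S] by blast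
  have "det_on \<C> (\<lambda>C D. zvec C (b D)) * det_on \<C> (\<lambda>C D. B (b C) D) =
      det_on \<C> (\<lambda>C D. \<Sum>K\<in>\<C>. zvec C (b K) * B (b K) D)"
    by (rule det_on_mult[OF fin\<C>, symmetric])
  also have "\<dots> = det_on \<C> (\<lambda>C D. if C = D then 1 else 0)"
  proof (rule det_on_cong)
    fix C D assume "C \<in> \<C>" "D \<in> \<C>"
    then show "(\<Sum>K\<in>\<C>. zvec C (b K) * B (b K) D) = (if C = D then 1 else 0)"
      using sum.reindex_bij_betw[OF b, of "\<lambda>e. zvec C e * B e D"] B by simp
  qed
  finally have "det_on \<C> (\<lambda>C D. zvec C (b D)) * det_on \<C> (\<lambda>C D. B (b C) D) = 1"
    using det_on_identity[OF fin\<C>] by simp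
  then have "\<bar>det_on \<C> (\<lambda>C D. zvec C (b D))\<bar> = 1" by (metis abs_zmult_eq_1 abs_1)
  then have "(det_on \<C> (\<lambda>C D. zvec C (b D)))\<^sup>2 = 1" by (metis one_power2 power2_abs)
  then show ?thesis using True by simp
next
  case notree: False
  have "det_on \<C> (\<lambda>C D. zvec C (b D)) = 0"
  proof (rule ccontr)
    assume det: "det_on \<C> (\<lambda>C D. zvec C (b D)) \<noteq> 0"
    let ?H = "G\<lparr>edges := edges G - S\<rparr>"
    have "(u, v) \<in> (adj_rel ?H)\<^sup>*" if uv: "u \<in> verts G" "v \<in> verts G" for u v
    proof (rule ccontr)
      assume n: "(u, v) \<notin> (adj_rel ?H)\<^sup>*"
      define p where "p x = (of_bool ((u, x) \<in> (adj_rel ?H)\<^sup>*) :: int)" for x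
      have g0: "grad p e = 0" if e: "e \<in> edges G - S" for e
      proof -
        have "(src e, tgt e) \<in> adj_rel ?H" using e ends by (auto simp: adj_rel_def)
        then have 1: "(src e, tgt e) \<in> (adj_rel ?H)\<^sup>*" by (rule r_into_rtrancl)
        note 1 rtrancl_adj_rel_sym[OF 1]
        then have "(u, tgt e) \<in> (adj_rel ?H)\<^sup>* \<longleftrightarrow> (u, src e) \<in> (adj_rel ?H)\<^sup>*" by (meson rtrancl_trans)
        then show ?thesis by (simp add: grad_def p_def)
      qed
      have "(\<Sum>D\<in>\<C>. zvec C (b D) * grad p (b D)) = 0" if C: "C \<in> \<C>" for C
      proof -
        have "(\<Sum>D\<in>\<C>. zvec C (b D) * grad p (b D)) = (\<Sum>e\<in>S. zvec C e * grad p e)"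
          by (rule sum.reindex_bij_betw[OF b])
        also have "\<dots> = (\<Sum>e\<in>edges G. zvec C e * grad p e)"
          using g0 S finE by (intro sum.mono_neutral_left) auto
        also have "\<dots> = 0" using pair_sum_edges[OF C] dcycle_pair_grad[OF cyc[OF C]] by simp
        finally show ?thesis .
      qed
      then have "\<forall>D\<in>\<C>. grad p (b D) = 0"
        using det_on_col_kernel[OF fin\<C> det, of "\<lambda>D. grad p (b D)"] by simp
      then have "\<forall>e\<in>S. grad p e = 0" using b by (auto simp: bij_betw_def)
      then have "\<forall>e\<in>edges G. grad p e = 0" using g0 by blast
      moreover have "(u, v) \<in> (adj_rel G)\<^sup>*" using conn uv by (simp add: connected_graph_adj_rel)
      ultimately have "p u = p v" using grad_const[of u v G p] by blast
      then show False using n by (simp add: p_def)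
    qed
    then have "connected_graph ?H" using conn by (simp add: connected_graph_adj_rel)
    then obtain vs es where "is_cycle ?H vs es" using notree by (auto simp: is_tree_def)
    moreover have "card (ends ?H e) = 2" if "e \<in> edges ?H" for e using that ends no_loop by simp
    ultimately obtain ds where ds: "dcycle ?H ds" using is_cycle_dcycle[of ?H vs es] by blast
    then have dsG: "dcycle G ds" unfolding dcycle_def using walk_mono[of ?H _ ds _ G] by auto
    have dsS: "set (dedges ds) \<subseteq> edges G - S" using ds walk_dedges unfolding dcycle_def by fastforce
    have "\<forall>e. e \<notin> edges G \<longrightarrow> zvec ds e = 0" using dsS zvec_notin by blast
    then obtain k where k: "\<And>e. zvec ds e = (\<Sum>C\<in>\<C>. k C * zvec C e)"
      using cycle_in_span[of "zvec ds"] bd_dcycle[OF dsG] by blast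
    have "(\<Sum>C\<in>\<C>. k C * zvec C (b D)) = 0" if "D \<in> \<C>" for D
    proof -
      have "b D \<in> S" using b that by (auto simp: bij_betw_def)
      then have "b D \<notin> set (dedges ds)" using dsS by blast
      then show ?thesis using k[of "b D"] zvec_notin by simp
    qed
    then have "\<forall>C\<in>\<C>. k C = 0" using det_on_row_kernel[OF fin\<C> det] by blast
    then have "zvec ds e = 0" for e by (simp add: k)
    moreover obtain u e v where "(u, e, v) \<in> set ds" using ds by (cases ds) (auto simp: dcycle_def)
    moreover have "distinct (dedges ds)" using ds by (simp add: dcycle_def)
    ultimately show False using zvec_dart by (metis sg_neq_0)
  qed
  then show ?thesis using notree by simp
qed

theorem spanning_trees_gram: "int (num_spanning_trees G) = det_on \<C> gram" "det_on \<C> gram \<noteq> 0"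
proof -
  let ?TT = "{S. S \<subseteq> edges G \<and> card S = card \<C>}"
  have "\<exists>b. bij_betw b \<C> S" if "S \<in> ?TT" for S
    using that fin\<C> finE finite_subset[of S "edges G"] by (intro finite_same_card_bij) auto
  then obtain b where b: "\<And>S. S \<in> ?TT \<Longrightarrow> bij_betw (b S) \<C> S" by metis
  \<comment> \<open>Cauchy-Binet for the cycles and their dual functions has the value 1, so some
    maximal minor of the cycle matrix is nonzero. The Gram determinant is the sum of the squares of
    these minors, hence positive.\<close>
  obtain Y where Y: "\<And>C D. C \<in> \<C> \<Longrightarrow> pair C (Y D) = of_bool (C = D)"
    using pair_onto[of "\<lambda>C. of_bool (C = _)"] by metis
  have "(1 :: int) = det_on \<C> (\<lambda>C D. if C = D then 1 else 0)" by (rule det_on_identity[OF fin\<C>, symmetric])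
  also have "\<dots> = det_on \<C> (\<lambda>C D. \<Sum>e\<in>edges G. zvec C e * Y D e)"
    using Y by (intro det_on_cong) (simp flip: pair_sum_edges)
  also have "\<dots> = (\<Sum>S\<in>?TT. det_on \<C> (\<lambda>C D. zvec C (b S D)) * det_on \<C> (\<lambda>C D. Y D (b S C)))"
    by (rule Cauchy_Binet_det_on[OF fin\<C> finE, of b zvec "\<lambda>e D. Y D e"]) (use b in auto)
  finally obtain S0 where S0: "S0 \<in> ?TT" "det_on \<C> (\<lambda>C D. zvec C (b S0 D)) \<noteq> 0"
    by (metis (no_types, lifting) mult_eq_0_iff sum.neutral zero_neq_one)
  have pos: "(\<Sum>S\<in>?TT. (det_on \<C> (\<lambda>C D. zvec C (b S D)))\<^sup>2) > 0"
    by (rule sum_pos2[OF _ S0(1)]) (use finE S0(2) in simp_all)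
  have "det_on \<C> gram = det_on \<C> (\<lambda>C D. \<Sum>e\<in>edges G. zvec C e * zvec D e)"
    by (rule det_on_cong) (simp add: gram_def)
  also have "\<dots> = (\<Sum>S\<in>?TT. det_on \<C> (\<lambda>C D. zvec C (b S D)) * det_on \<C> (\<lambda>C D. zvec D (b S C)))"
    by (rule Cauchy_Binet_det_on[OF fin\<C> finE, of b zvec "\<lambda>e D. zvec D e"]) (use b in auto)
  also have "\<dots> = (\<Sum>S\<in>?TT. (det_on \<C> (\<lambda>C D. zvec C (b S D)))\<^sup>2)"
    using det_on_transpose[OF fin\<C>, of "\<lambda>C D. zvec C (b _ D)"]
    by (intro sum.cong) (simp_all add: power2_eq_square)
  finally have sq: "det_on \<C> gram = (\<Sum>S\<in>?TT. (det_on \<C> (\<lambda>C D. zvec C (b S D)))\<^sup>2)" .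
  with pos show "det_on \<C> gram \<noteq> 0" by simp
  note sq
  also have "(\<Sum>S\<in>?TT. (det_on \<C> (\<lambda>C D. zvec C (b S D)))\<^sup>2) = (\<Sum>S\<in>?TT. of_bool (is_tree (G\<lparr>edges := edges G - S\<rparr>)))"
    by (intro sum.cong) (use b tree_complement_det in auto)
  also have "\<dots> = int (card {S\<in>?TT. is_tree (G\<lparr>edges := edges G - S\<rparr>)})"
    using finE by (simp add: sum.inter_filter[symmetric] of_bool_def)
  \<comment> \<open>By \<open>tree_complement_card\<close> complements of spanning trees have the
    size that \<open>?TT\<close> demands.\<close>
  also have "card {S\<in>?TT. is_tree (G\<lparr>edges := edges G - S\<rparr>)} = num_spanning_trees G"
    unfolding num_spanning_trees_def
  proof (rule bij_betw_same_card[of "\<lambda>S. edges G - S"], rule bij_betw_byWitness[where f' = "\<lambda>S. edges G - S"])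
    show "(\<lambda>S. edges G - S) ` {S. S \<subseteq> edges G \<and> is_tree (G\<lparr>edges := S\<rparr>)} \<subseteq> {S\<in>?TT. is_tree (G\<lparr>edges := edges G - S\<rparr>)}"
    proof (rule image_subsetI)
      fix S assume "S \<in> {S. S \<subseteq> edges G \<and> is_tree (G\<lparr>edges := S\<rparr>)}"
      then have S: "S \<subseteq> edges G" "is_tree (G\<lparr>edges := S\<rparr>)" by auto
      then have "edges G - (edges G - S) = S" by blast
      then show "edges G - S \<in> {S\<in>?TT. is_tree (G\<lparr>edges := edges G - S\<rparr>)}"
        using tree_complement_card[of "edges G - S"] S by simp
    qed
  qed auto
  finally show "int (num_spanning_trees G) = det_on \<C> gram" by simp
qed

end

end


section \<open>Splitting and reversing cycles\<close>

definition drev :: "('v, 'e) dart list \<Rightarrow> ('v, 'e) dart list" where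
  "drev ds = rev (map (\<lambda>(u, e, v). (v, e, u)) ds)"

lemma dedges_drev: "dedges (drev ds) = rev (dedges ds)"
  by (induction ds) (auto simp: drev_def)

lemma walk_drev: "walk G a ds b \<Longrightarrow> walk G b (drev ds) a"
proof (induction ds arbitrary: a)
  case (Cons d ds)
  obtain u e v where d: "d = (u, e, v)" by (cases d)
  then have "drev (d # ds) = drev ds @ [(v, e, u)]" by (simp add: drev_def)
  moreover have "walk G b (drev ds) v" using Cons d by auto
  ultimately show ?case using Cons.prems d by (auto simp: walk_append insert_commute)
qed (simp add: drev_def)

lemma tails_drev: "tails (drev ds) = rev (map (snd \<circ> snd) ds)"
  by (induction ds) (auto simp: drev_def)

lemma dpath_drev:
  assumes "dpath G a ds b"
  shows "dpath G b (drev ds) a" "insert a (set (tails (drev ds))) = insert b (set (tails ds))"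
proof -
  have w: "walk G a ds b" and d: "distinct (tails ds @ [b])" using assms by (auto simp: dpath_def)
  have h: "a # map (snd \<circ> snd) ds = tails ds @ [b]" by (rule walk_heads[OF w])
  have "tails (drev ds) @ [a] = rev (a # map (snd \<circ> snd) ds)" by (simp add: tails_drev)
  also have "\<dots> = rev (tails ds @ [b])" unfolding h ..
  finally have e: "tails (drev ds) @ [a] = rev (tails ds @ [b])" .
  then have "distinct (tails (drev ds) @ [a])" using d by (metis distinct_rev)
  then show "dpath G b (drev ds) a" using walk_drev[OF w] by (simp add: dpath_def)
  have "set (tails (drev ds) @ [a]) = set (tails ds @ [b])" unfolding e by simp
  then show "insert a (set (tails (drev ds))) = insert b (set (tails ds))" by simp
qed

text \<open>The list of darts may begin anywhere on the cycle, so it is rotated to begin at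
  \<open>a\<close> before it is cut at \<open>b\<close>; hence only the multiset of darts is
  preserved. Pairings depend on nothing more.\<close>

lemma dcycle_split:
  assumes C: "dcycle G C" and ab: "a \<in> set (tails C)" "b \<in> set (tails C)" "a \<noteq> b"
  shows "\<exists>p q. mset C = mset (p @ q) \<and> dpath G a p b \<and> dpath G b q a \<and> distinct (tails (p @ q)) \<and>
    distinct (dedges (p @ q)) \<and> p \<noteq> [] \<and> q \<noteq> []"
proof -
  obtain x y where "(a, x, y) \<in> set C" using ab(1) by auto
  then obtain r s where C': "C = r @ (a, x, y) # s" by (meson split_list)
  let ?s = "(a, x, y) # s"
  let ?C = "?s @ r"
  have w: "walk G (fst (hd C)) C (fst (hd C))" and dC: "distinct (tails C)" "distinct (dedges C)"
    using C by (auto simp: dcycle_def)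
  have wC: "walk G a ?C a" using w C' by (auto simp: walk_append)
  have m: "mset ?C = mset C" using C' by simp
  have d: "distinct (tails ?C)" "distinct (dedges ?C)" using dC C' by auto
  have "b \<in> set (tails ?C)" using ab(2) C' by auto
  then obtain d where d': "d \<in> set ?C" "b = fst d" unfolding set_map by (elim imageE)
  obtain x' y' where "d = (b, x', y')" using d'(2) by (cases d) auto
  then obtain p q where pq: "?C = p @ (b, x', y') # q" using d'(1) by (meson split_list)
  let ?q = "(b, x', y') # q"
  have "p \<noteq> []" using pq ab(3) by (cases p) auto
  have "walk G a p b" "walk G b ?q a" using wC unfolding pq by (auto simp: walk_append)
  moreover have "a \<in> set (tails p)" using \<open>p \<noteq> []\<close> pq by (cases p) auto
  then have "distinct (tails p @ [b])" "distinct (tails ?q @ [a])" using d unfolding pq by auto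
  ultimately have "dpath G a p b" "dpath G b ?q a" by (auto simp: dpath_def)
  then show ?thesis using m d \<open>p \<noteq> []\<close> unfolding pq by (intro exI[of _ p] exI[of _ ?q]) auto
qed

lemma dcycle_join:
  assumes "dpath G a p b" "dpath G b q a" "p \<noteq> []" "distinct (tails (p @ q))" "distinct (dedges (p @ q))"
  shows "dcycle G (p @ q)"
proof -
  have "fst (hd p) = a" using assms by (auto simp: dpath_def walk_head)
  then show ?thesis using assms by (auto simp: dcycle_def dpath_def walk_append)
qed

lemma (in oriented_graph) pair_mset: "mset p = mset q \<Longrightarrow> pair p y = pair q y"
proof -
  assume pq: "mset p = mset q"
  have "pair ds y = sum_mset (image_mset (\<lambda>(u, e, v). sg u e * y e) (mset ds))" for ds
    unfolding pair_def by (simp add: sum_mset_sum_list flip: mset_map)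
  then show ?thesis using pq by simp
qed


section \<open>Plane theta graphs\<close>

lemma connected_subset_outside:
  fixes S T :: "complex set"
  assumes "connected T" "T \<inter> S = {}" "\<not> bounded T"
  shows "T \<subseteq> outside S"
proof
  fix x assume x: "x \<in> T"
  then have "T \<subseteq> connected_component_set (- S) x" using assms by (intro connected_component_maximal) auto
  then show "x \<in> outside S" using assms(3) bounded_subset unfolding outside by blast
qed

text \<open>The inside of the first curve is connected and misses the second curve, so once the
  insides overlap it lies inside the second curve. Taking closures, \<open>c2\<close> lies inside
  the second curve or on it; not being inside, it would have to be part of that curve.\<close>

lemma theta_aux:
  fixes c1 c2 c3 :: "real \<Rightarrow> complex"
  assumes arcs: "arc c1" "arc c2" "arc c3"
    and st: "pathstart c1 = a" "pathstart c2 = a" "pathstart c3 = a" "pathfinish c1 = b" "pathfinish c2 = b" "pathfinish c3 = b"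
    and int: "path_image c1 \<inter> path_image c2 = {a, b}" "path_image c1 \<inter> path_image c3 = {a, b}" "path_image c2 \<inter> path_image c3 = {a, b}"
    and n: "path_image c2 \<inter> inside (path_image c1 \<union> path_image c3) = {}"
      "path_image c3 \<inter> inside (path_image c1 \<union> path_image c2) = {}"
  shows "inside (path_image c1 \<union> path_image c2) \<inter> inside (path_image c1 \<union> path_image c3) = {}"
proof (rule ccontr)
  let ?S = "path_image c1 \<union> path_image c2" and ?T = "path_image c1 \<union> path_image c3"
  assume ne: "inside ?S \<inter> inside ?T \<noteq> {}"
  have sp: "simple_path (c1 +++ reversepath c2)" "simple_path (c1 +++ reversepath c3)"
    using assms by (auto intro!: simple_path_join_loop arc_reversepath)
  have im: "path_image (c1 +++ reversepath c2) = ?S" "path_image (c1 +++ reversepath c3) = ?T"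
    using st by (auto simp: path_image_join)
  have J2: "connected (inside ?S)" "frontier (inside ?S) = ?S"
    using Jordan_inside_outside[OF sp(1)] im st by auto
  have J3: "frontier (inside ?T) = ?T" "open (inside ?T)" "open (outside ?T)"
    using Jordan_inside_outside[OF sp(2)] im st by auto
  have "inside ?S \<inter> ?T = {}" using n(2) inside_no_overlap[of ?S] by blast
  then have "inside ?S \<subseteq> inside ?T \<union> outside ?T" using inside_Un_outside[of ?T] by blast
  then have sub: "inside ?S \<subseteq> inside ?T"
    using connectedD[OF J2(1) J3(2,3)] ne inside_Int_outside[of ?T] by blast
  have "path_image c2 \<subseteq> closure (inside ?S)" using J2(2) by (auto simp: frontier_def)
  also have "\<dots> \<subseteq> closure (inside ?T)" by (rule closure_mono[OF sub])
  also have "\<dots> = inside ?T \<union> ?T" using J3(1) by (auto simp: closure_Un_frontier)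
  finally have "path_image c2 \<subseteq> inside ?T \<union> ?T" .
  then have "path_image c2 \<subseteq> ?T" using n(1) by blast
  moreover obtain z where "z \<in> path_image c2 - {a, b}"
    using nonempty_simple_path_endless[OF arc_imp_simple_path[OF arcs(2)]] st by auto
  ultimately show False using int by blast
qed

text \<open>If none of the three arcs lay inside the closed curve formed by the other two, the three insides would
  be pairwise disjoint, and Janiszewski's theorem would connect the inside of one of the closed curves to
  infinity.\<close>

lemma theta:
  fixes c1 c2 c3 :: "real \<Rightarrow> complex"
  assumes arcs: "arc c1" "arc c2" "arc c3"
    and st: "pathstart c1 = a" "pathstart c2 = a" "pathstart c3 = a" "pathfinish c1 = b" "pathfinish c2 = b" "pathfinish c3 = b"
    and int: "path_image c1 \<inter> path_image c2 = {a, b}" "path_image c1 \<inter> path_image c3 = {a, b}" "path_image c2 \<inter> path_image c3 = {a, b}"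
    and n3: "path_image c3 \<inter> inside (path_image c1 \<union> path_image c2) = {}"
  shows "path_image c1 \<inter> inside (path_image c2 \<union> path_image c3) \<noteq> {} \<or>
    path_image c2 \<inter> inside (path_image c1 \<union> path_image c3) \<noteq> {}"
proof (rule ccontr)
  let ?P1 = "path_image c1" and ?P2 = "path_image c2" and ?P3 = "path_image c3"
  assume "\<not> ?thesis"
  then have n1: "?P1 \<inter> inside (?P2 \<union> ?P3) = {}" and n2: "?P2 \<inter> inside (?P1 \<union> ?P3) = {}" by auto
  have d2: "inside (?P1 \<union> ?P2) \<inter> inside (?P2 \<union> ?P3) = {}"
    using theta_aux[of c2 c1 c3 a b] arcs st int n1 n2 n3 by (simp add: Un_commute Int_commute)
  have d3: "inside (?P1 \<union> ?P3) \<inter> inside (?P2 \<union> ?P3) = {}"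
    using theta_aux[of c3 c1 c2 a b] arcs st int n1 n2 n3 by (simp add: Un_commute Int_commute)
  have J: "inside (ci \<union> cj) \<noteq> {} \<and> connected (outside (ci \<union> cj))"
    if "ci = path_image g \<and> cj = path_image h \<and> arc g \<and> arc h \<and> pathstart g = a \<and> pathstart h = a \<and>
      pathfinish g = b \<and> pathfinish h = b \<and> ci \<inter> cj = {a, b}" for g h ci cj
  proof -
    have "simple_path (g +++ reversepath h)"
      using that by (auto intro!: simple_path_join_loop arc_reversepath)
    moreover have "path_image (g +++ reversepath h) = ci \<union> cj" using that by (auto simp: path_image_join)
    ultimately show ?thesis using Jordan_inside_outside[of "g +++ reversepath h"] that by auto
  qed
  have cpt: "compact ?P1" "compact ?P2" "compact ?P3" using arcs by (auto simp: compact_arc_image)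
  have "inside (?P2 \<union> ?P3) \<noteq> {}" using J[of ?P2 c2 ?P3 c3] arcs st int by auto
  \<comment> \<open>\<open>y\<close> lies inside the curve of \<open>c2\<close> and
    \<open>c3\<close> and, by disjointness of the insides, outside the two others; \<open>x\<close>
    will be outside all three arcs together.\<close>
  then obtain y where y: "y \<in> inside (?P2 \<union> ?P3)" by blast
  have "bounded (?P1 \<union> ?P2 \<union> ?P3)" using cpt by (auto intro: compact_imp_bounded)
  then have "outside (?P1 \<union> ?P2 \<union> ?P3) \<noteq> {}" by (intro outside_bounded_nonempty) auto
  then obtain x where x: "x \<in> outside (?P1 \<union> ?P2 \<union> ?P3)" by blast
  have y0: "y \<notin> ?P1" "y \<notin> ?P2" "y \<notin> ?P3" using y n1 inside_no_overlap[of "?P2 \<union> ?P3"] by blast+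
  have x1: "x \<in> outside (?P1 \<union> ?P2)" and x2: "x \<in> outside (?P1 \<union> ?P3)" and x3: "x \<in> outside (?P2 \<union> ?P3)"
    using x outside_mono[of "?P1 \<union> ?P2" "?P1 \<union> ?P2 \<union> ?P3"] outside_mono[of "?P1 \<union> ?P3" "?P1 \<union> ?P2 \<union> ?P3"]
      outside_mono[of "?P2 \<union> ?P3" "?P1 \<union> ?P2 \<union> ?P3"] by auto
  have y1: "y \<in> outside (?P1 \<union> ?P2)" using y y0 d2 inside_Un_outside[of "?P1 \<union> ?P2"] by blast
  have y2: "y \<in> outside (?P1 \<union> ?P3)" using y y0 d3 inside_Un_outside[of "?P1 \<union> ?P3"] by blast
  have cc: "connected_component (- S) x y" if "connected (outside S)" "x \<in> outside S" "y \<in> outside S" for S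
    using that outside_no_overlap[of S] unfolding connected_component_def by blast
  have o12: "connected (outside (?P1 \<union> ?P2))" and o13: "connected (outside (?P1 \<union> ?P3))"
    using J[of ?P1 c1 ?P2 c2] J[of ?P1 c1 ?P3 c3] arcs st int by simp_all
  \<comment> \<open>The two curves that do not separate \<open>x\<close> from \<open>y\<close> meet
    exactly in \<open>c1\<close>; its connectedness is the hypothesis of Janiszewski's
    theorem.\<close>
  have "(?P1 \<union> ?P2) \<inter> (?P1 \<union> ?P3) = ?P1" using int by auto
  moreover have "connected ?P1" using arcs by (simp add: connected_arc_image)
  ultimately have k: "connected ((?P1 \<union> ?P2) \<inter> (?P1 \<union> ?P3))" by simp
  have "compact (?P1 \<union> ?P2)" "closed (?P1 \<union> ?P3)" using cpt by (auto intro: compact_imp_closed)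
  from Janiszewski[OF this k cc[OF o12 x1 y1] cc[OF o13 x2 y2]]
  have "connected_component (- ((?P1 \<union> ?P2) \<union> (?P1 \<union> ?P3))) x y" .
  then have "connected_component (- (?P2 \<union> ?P3)) x y"
    by (rule connected_component_of_subset) auto
  then have "y \<in> outside (?P2 \<union> ?P3)" using x3 outside_same_component by blast
  then show False using y inside_Int_outside by blast
qed


section \<open>Biconnected outerplane graphs\<close>

abbreviation cset :: "('v, 'a set) dart list \<Rightarrow> 'a set" where
  "cset ds \<equiv> \<Union>(set (dedges ds))"

locale plane_gr =
  fixes G :: "(complex, complex set) mgraph"
  assumes plane: "plane_graph G"
begin

lemma fin: "finite (verts G)" "finite (edges G)"
  using plane by (auto simp: plane_graph_def)

lemma edge_arc:
  assumes "e \<in> edges G"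
  obtains g where "arc g" "path_image g = e" "ends G e = {pathstart g, pathfinish g}" "e \<inter> verts G = ends G e"
  using plane assms unfolding plane_graph_def by meson

lemma edge_inter: "e \<in> edges G \<Longrightarrow> e' \<in> edges G \<Longrightarrow> e \<noteq> e' \<Longrightarrow> e \<inter> e' \<subseteq> verts G"
  using plane unfolding plane_graph_def by blast

lemma ends_sub: "e \<in> edges G \<Longrightarrow> ends G e \<subseteq> e" "e \<in> edges G \<Longrightarrow> ends G e \<subseteq> verts G"
  "e \<in> edges G \<Longrightarrow> e \<inter> verts G = ends G e"
  using edge_arc by (metis Int_lower1, metis Int_lower2, metis)

lemma ends_card: "e \<in> edges G \<Longrightarrow> card (ends G e) = 2"
  using edge_arc arc_distinct_ends by (metis card_2_iff)

lemma edge_arc_from: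
  assumes e: "e \<in> edges G" and uv: "ends G e = {u, v}"
  shows "\<exists>g. arc g \<and> path_image g = e \<and> pathstart g = u \<and> pathfinish g = v"
proof -
  obtain g where g: "arc g" "path_image g = e" "ends G e = {pathstart g, pathfinish g}" "e \<inter> verts G = ends G e"
    by (rule edge_arc[OF e])
  then consider "pathstart g = u" "pathfinish g = v" | "pathstart g = v" "pathfinish g = u"
    using uv by (auto simp: doubleton_eq_iff)
  then show ?thesis
  proof cases
    case 2
    then show ?thesis using g by (intro exI[of _ "reversepath g"]) (auto simp: arc_reversepath)
  qed (use g in blast)
qed

lemma edge_infinite: "e \<in> edges G \<Longrightarrow> infinite e"
proof
  assume e: "e \<in> edges G" "finite e"
  then have "connected e" using edge_arc connected_arc_image by metis
  then have "e = {} \<or> (\<exists>a. e = {a})" using e connected_finite_iff_sing by metis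
  moreover have "card (ends G e) \<le> card e" using e ends_sub by (intro card_mono)
  ultimately show False using ends_card[OF e(1)] by auto
qed

text \<open>Two edges share only vertices, of which there are finitely many, whereas an edge is
  infinite. This recovers the edges of a cycle from its mere point set, for instance from the
  frontier of a face.\<close>

lemma edge_sub_Union:
  assumes "e \<in> edges G" "D \<subseteq> edges G" "e \<subseteq> \<Union>D"
  shows "e \<in> D"
proof (rule ccontr)
  assume "e \<notin> D"
  then have "e \<subseteq> verts G" using assms edge_inter by blast
  then show False using edge_infinite[OF assms(1)] fin finite_subset by blast
qed

lemma cset_inter_verts:
  assumes "D \<subseteq> edges G" "D' \<subseteq> edges G" "D \<inter> D' = {}"
  shows "\<Union>D \<inter> \<Union>D' \<subseteq> verts G"
  using assms edge_inter by fast

lemma cset_verts: "walk G a ds b \<Longrightarrow> ds \<noteq> [] \<Longrightarrow> cset ds \<inter> verts G = insert b (set (tails ds))"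
proof (induction ds arbitrary: a)
  case (Cons d ds)
  obtain u e v where d: "d = (u, e, v)" by (cases d)
  have e: "e \<inter> verts G = {u, v}" and w: "walk G v ds b" using Cons.prems d ends_sub(3)[of e] by auto
  show ?case
  proof (cases "ds = []")
    case True
    then show ?thesis using e w d by auto
  next
    case False
    then have v: "v \<in> set (tails ds)" using walk_head[OF w] by (cases ds) auto
    have "cset (d # ds) \<inter> verts G = (e \<inter> verts G) \<union> (cset ds \<inter> verts G)" using d by auto
    also have "\<dots> = {u, v} \<union> insert b (set (tails ds))" unfolding e Cons.IH[OF w False] ..
    finally show ?thesis using v d by auto
  qed
qed simp

lemma dpath_arc:
  assumes "dpath G a ds b" "ds \<noteq> []"
  shows "\<exists>g. arc g \<and> pathstart g = a \<and> pathfinish g = b \<and> path_image g = cset ds"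
  using assms
proof (induction ds arbitrary: a)
  case (Cons d ds)
  obtain u e v where d: "d = (u, e, v)" by (cases d)
  have e: "e \<in> edges G" "ends G e = {a, v}" "a \<noteq> v" "u = a" and p: "dpath G v ds b" and a: "a \<notin> set (tails ds @ [b])"
    using Cons.prems d by (auto simp: dpath_def)
  obtain g where g: "arc g" "path_image g = e" "pathstart g = a" "pathfinish g = v"
    using edge_arc_from[OF e(1,2)] by blast
  show ?case
  proof (cases "ds = []")
    case True
    then have "v = b" using p by (simp add: dpath_def)
    then show ?thesis using g d True by (intro exI[of _ g]) auto
  next
    case False
    then obtain h where h: "arc h" "pathstart h = v" "pathfinish h = b" "path_image h = cset ds"
      using Cons.IH[OF p] by blast
    have w: "walk G v ds b" using p by (simp add: dpath_def)
    have "e \<notin> set (dedges ds)" using dpath_dedges_distinct[OF Cons.prems(1)] d by simp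
    then have "\<Union>{e} \<inter> cset ds \<subseteq> verts G" using e walk_dedges[OF w] by (intro cset_inter_verts) auto
    then have "e \<inter> cset ds \<subseteq> (e \<inter> verts G) \<inter> (cset ds \<inter> verts G)" by auto
    also have "\<dots> = {a, v} \<inter> insert b (set (tails ds))"
      unfolding ends_sub(3)[OF e(1)] e(2) cset_verts[OF w False] ..
    also have "\<dots> \<subseteq> {v}" using a by auto
    finally have "arc (g +++ h)" using g h by (intro arc_join) auto
    moreover have "path_image (g +++ h) = cset (d # ds)" using g h d by (simp add: path_image_join)
    ultimately show ?thesis using g h by (intro exI[of _ "g +++ h"]) auto
  qed
qed simp

text \<open>The second arc is reversed so that both run from \<open>a\<close> to \<open>b\<close>,
  as in \<open>theta\<close>.\<close>

lemma split_arcs: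
  assumes p: "dpath G a p b" and q: "dpath G b q a" and d: "distinct (tails (p @ q))" "distinct (dedges (p @ q))"
    and ne: "p \<noteq> []" "q \<noteq> []"
  shows "\<exists>g h. arc g \<and> pathstart g = a \<and> pathfinish g = b \<and> path_image g = cset p \<and>
    arc h \<and> pathstart h = a \<and> pathfinish h = b \<and> path_image h = cset q" and "cset p \<inter> cset q = {a, b}"
proof -
  obtain g h where g: "arc g" "pathstart g = a" "pathfinish g = b" "path_image g = cset p"
    and h: "arc h" "pathstart h = b" "pathfinish h = a" "path_image h = cset q"
    using dpath_arc[OF p ne(1)] dpath_arc[OF q ne(2)] by blast
  then show "\<exists>g h. arc g \<and> pathstart g = a \<and> pathfinish g = b \<and> path_image g = cset p \<and>
    arc h \<and> pathstart h = a \<and> pathfinish h = b \<and> path_image h = cset q"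
    by (intro exI[of _ g] exI[of _ "reversepath h"]) (auto simp: arc_reversepath)
  have w: "walk G a p b" "walk G b q a" using p q by (auto simp: dpath_def)
  have ab: "a \<in> set (tails p)" "b \<in> set (tails q)" using ne walk_head[OF w(1)] walk_head[OF w(2)]
    by (metis hd_in_set hd_map list.map_disc_iff)+
  have "cset p \<inter> cset q \<subseteq> verts G"
    using walk_dedges[OF w(1)] walk_dedges[OF w(2)] d by (intro cset_inter_verts) auto
  then have "cset p \<inter> cset q = (cset p \<inter> verts G) \<inter> (cset q \<inter> verts G)" by blast
  also have "\<dots> = insert b (set (tails p)) \<inter> insert a (set (tails q))"
    unfolding cset_verts[OF w(1) ne(1)] cset_verts[OF w(2) ne(2)] ..
  also have "\<dots> = {a, b}"
  proof -
    have "set (tails p) \<inter> set (tails q) = {}" using d(1) by simp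
    then show ?thesis using ab by blast
  qed
  finally show "cset p \<inter> cset q = {a, b}" .
qed

lemma split_facts:
  fixes g h :: "real \<Rightarrow> complex"
  assumes "arc g" "arc h" "pathstart g = a" "pathfinish g = b" "pathstart h = a" "pathfinish h = b"
    and "path_image g \<inter> path_image h = {a, b}"
  shows "inside (path_image g \<union> path_image h) \<noteq> {}" "open (inside (path_image g \<union> path_image h))"
    "connected (inside (path_image g \<union> path_image h))" "bounded (inside (path_image g \<union> path_image h))"
    "open (outside (path_image g \<union> path_image h))"
    "connected (outside (path_image g \<union> path_image h))" "\<not> bounded (outside (path_image g \<union> path_image h))"
    "frontier (inside (path_image g \<union> path_image h)) = path_image g \<union> path_image h"
    "frontier (outside (path_image g \<union> path_image h)) = path_image g \<union> path_image h"
proof -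
  have "simple_path (g +++ reversepath h)"
    using assms by (auto intro!: simple_path_join_loop arc_reversepath)
  moreover have "path_image (g +++ reversepath h) = path_image g \<union> path_image h" using assms by (auto simp: path_image_join)
  moreover have "pathfinish (g +++ reversepath h) = pathstart (g +++ reversepath h)" using assms by simp
  ultimately show "inside (path_image g \<union> path_image h) \<noteq> {}" "open (inside (path_image g \<union> path_image h))"
    "connected (inside (path_image g \<union> path_image h))" "bounded (inside (path_image g \<union> path_image h))"
    "open (outside (path_image g \<union> path_image h))"
    "connected (outside (path_image g \<union> path_image h))" "\<not> bounded (outside (path_image g \<union> path_image h))"
    "frontier (inside (path_image g \<union> path_image h)) = path_image g \<union> path_image h"
    "frontier (outside (path_image g \<union> path_image h)) = path_image g \<union> path_image h"
    using Jordan_inside_outside[of "g +++ reversepath h"] by auto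
qed

lemma dcycle_Jordan:
  assumes C: "dcycle G C"
  shows "inside (cset C) \<noteq> {}" "open (inside (cset C))" "connected (inside (cset C))" "bounded (inside (cset C))"
    "open (outside (cset C))" "connected (outside (cset C))" "\<not> bounded (outside (cset C))"
    "frontier (inside (cset C)) = cset C" "frontier (outside (cset C)) = cset C"
proof -
  obtain a b ds e where ds: "C = ds @ [(b, e, a)]" "dpath G a ds b" "e \<notin> set (dedges ds)" "e \<in> edges G"
    "ends G e = {b, a}" "b \<noteq> a"
    using dcycle_last[OF C] by blast
  have "dpath G b [(b, e, a)] a" using ds by (auto simp: dpath_def)
  moreover have "ds \<noteq> []" using ds by (auto simp: dpath_def)
  moreover have "distinct (tails (ds @ [(b, e, a)]))" "distinct (dedges (ds @ [(b, e, a)]))" using C ds(1) by (auto simp: dcycle_def)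
  ultimately obtain g h where gh: "arc g" "arc h" "pathstart g = a" "pathfinish g = b" "pathstart h = a" "pathfinish h = b"
    "path_image g \<inter> path_image h = {a, b}" and im: "path_image g = cset ds" "path_image h = cset [(b, e, a)]"
    using split_arcs[OF ds(2), of "[(b, e, a)]"] by auto
  have "cset C = path_image g \<union> path_image h" unfolding im ds(1) by auto
  then show "inside (cset C) \<noteq> {}" "open (inside (cset C))" "connected (inside (cset C))" "bounded (inside (cset C))"
    "open (outside (cset C))" "connected (outside (cset C))" "\<not> bounded (outside (cset C))"
    "frontier (inside (cset C)) = cset C" "frontier (outside (cset C)) = cset C"
    using split_facts[OF gh] by simp_all
qed

lemma dcycle_cset_verts:
  assumes C: "dcycle G C"
  shows "cset C \<inter> verts G = set (tails C)"
proof -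
  have w: "walk G (fst (hd C)) C (fst (hd C))" "C \<noteq> []" using C by (auto simp: dcycle_def)
  then show ?thesis using cset_verts[OF w] by (cases C) auto
qed

lemma dcycle_cset_support:
  assumes "dcycle G C"
  shows "cset C \<subseteq> support G"
  unfolding support_def using dcycle_dedges[OF assms] by blast

end

locale outerplane_gr = plane_gr +
  assumes outer: "verts G \<subseteq> frontier (outer_face G)" and bi: "biconnected G"
begin

text \<open>A vertex is a limit of points of the outer face. If it were in the open inside of a
  cycle, that inside would contain points outside the whole graph, which are outside the
  cycle.\<close>

lemma vertex_not_inside:
  assumes "v \<in> verts G" "dcycle G C"
  shows "v \<notin> inside (cset C)"
proof
  assume v: "v \<in> inside (cset C)"
  have "v \<in> closure (outside (support G))" using outer assms by (auto simp: outer_face_def frontier_def)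
  then have "inside (cset C) \<inter> outside (support G) \<noteq> {}"
    using v dcycle_Jordan(2)[OF assms(2)] by (metis closure_iff_nhds_not_empty disjoint_iff order_refl)
  moreover have "outside (support G) \<subseteq> outside (cset C)"
    by (rule outside_mono[OF dcycle_cset_support[OF assms(2)]])
  ultimately show False using inside_Int_outside[of "cset C"] by blast
qed

text \<open>\<open>a\<close> and \<open>b\<close> cut \<open>C0\<close> into \<open>p\<close> and
  \<open>q\<close>. If the ear avoided the inside of \<open>C0\<close>, then by \<open>theta\<close>
  one of \<open>p\<close> and \<open>q\<close> would enter the inside of the cycle formed by the ear
  and the other, and this cycle would have a strictly larger inside. So the ear meets the inside,
  and without its ends it is connected and disjoint from \<open>C0\<close>, so it stays
  there.\<close>

lemma ear_inside:
  assumes C0: "dcycle G C0" and max: "\<And>C. dcycle G C \<Longrightarrow> inside (cset C0) \<subseteq> inside (cset C) \<Longrightarrow> inside (cset C) = inside (cset C0)"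
    and ab: "a \<in> set (tails C0)" "b \<in> set (tails C0)" "a \<noteq> b"
    and P: "dpath G a P b" "P \<noteq> []" and t: "set (tails P) \<inter> set (tails C0) \<subseteq> {a}"
    and de: "set (dedges P) \<inter> set (dedges C0) = {}"
  shows "cset P - {a, b} \<subseteq> inside (cset C0)"
proof -
  obtain p q where pq: "mset C0 = mset (p @ q)" "dpath G a p b" "dpath G b q a" "distinct (tails (p @ q))"
    "distinct (dedges (p @ q))" "p \<noteq> []" "q \<noteq> []"
    using dcycle_split[OF C0 ab] by blast
  have setC: "set C0 = set p \<union> set q" using mset_eq_setD[OF pq(1)] by simp
  then have tC: "set (tails C0) = set (tails p) \<union> set (tails q)" and dC: "set (dedges C0) = set (dedges p) \<union> set (dedges q)"
    by (simp_all add: image_Un)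
  then have csetC: "cset C0 = cset p \<union> cset q" by simp
  obtain g1 g2 where g1: "arc g1" "pathstart g1 = a" "pathfinish g1 = b" "path_image g1 = cset p"
    and g2: "arc g2" "pathstart g2 = a" "pathfinish g2 = b" "path_image g2 = cset q"
    using split_arcs(1)[OF pq(2-7)] by blast
  have i12: "cset p \<inter> cset q = {a, b}" by (rule split_arcs(2)[OF pq(2-7)])
  obtain g3 where g3: "arc g3" "pathstart g3 = a" "pathfinish g3 = b" "path_image g3 = cset P"
    using dpath_arc[OF P] by blast
  have dP: "distinct (tails P)" "distinct (dedges P)"
    using P(1) dpath_dedges_distinct[OF P(1)] by (simp_all add: dpath_def)
  have "a \<in> set (tails p)" using walk_head[of G a p b] pq(2,6) by (cases p) (auto simp: dpath_def)
  then have aq: "a \<notin> set (tails q)" using pq(4) by auto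
  have Pq: "distinct (tails (P @ q))" "distinct (dedges (P @ q))"
  proof -
    have "set (tails P) \<inter> set (tails q) = {}" "set (dedges P) \<inter> set (dedges q) = {}"
      using t tC aq de dC by blast+
    then show "distinct (tails (P @ q))" "distinct (dedges (P @ q))"
      using dP pq(4,5) unfolding map_append distinct_append by blast+
  qed
  \<comment> \<open>\<open>p\<close> runs from \<open>a\<close> to \<open>b\<close> like the ear and
    has to be reversed to close a cycle with it.\<close>
  note rp = dpath_drev[OF pq(2)]
  have ar: "a \<notin> set (tails (drev p))" and dr: "distinct (tails (drev p))" using rp(1) by (auto simp: dpath_def)
  have "set (tails (drev p)) \<subseteq> insert b (set (tails p))" unfolding rp(2)[symmetric] by (rule subset_insertI)
  also have "\<dots> \<subseteq> set (tails C0)" using tC ab(2) by simp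
  finally have "set (tails (drev p)) \<subseteq> set (tails C0)" .
  then have "set (tails P) \<inter> set (tails (drev p)) = {}" using t ar by blast
  then have Pp: "distinct (tails (P @ drev p))" "distinct (dedges (P @ drev p))"
    using dP dr pq(5) de dC unfolding map_append dedges_drev by auto
  have rne: "drev p \<noteq> []" using pq(6) by (simp add: drev_def)
  have csr: "cset (drev p) = cset p" unfolding dedges_drev by simp
  have i32: "cset P \<inter> cset q = {a, b}" by (rule split_arcs(2)[OF P(1) pq(3) Pq P(2) pq(7)])
  have i31: "cset P \<inter> cset p = {a, b}" using split_arcs(2)[OF P(1) rp(1) Pp P(2) rne] csr by simp
  have meets: "cset P \<inter> inside (cset C0) \<noteq> {}"
  proof
    assume n: "cset P \<inter> inside (cset C0) = {}"
    \<comment> \<open>Strictness: an arc of \<open>C0\<close> without its ends is nonempty and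
      cannot lie inside \<open>C0\<close>.\<close>
    have no: False if "arc g" "pathstart g = a" "pathfinish g = b" "path_image g \<subseteq> cset C0" "path_image g - {a, b} \<subseteq> inside (cset C0)" for g
    proof -
      have "path_image g - {a, b} \<noteq> {}" using nonempty_simple_path_endless[OF arc_imp_simple_path[OF that(1)]] that by simp
      then show False using that(4,5) inside_no_overlap[of "cset C0"] by blast
    qed
    have "cset p \<inter> inside (cset q \<union> cset P) \<noteq> {} \<or> cset q \<inter> inside (cset p \<union> cset P) \<noteq> {}"
      using theta[OF g1(1) g2(1) g3(1) g1(2) g2(2) g3(2) g1(3) g2(3) g3(3)] i12 i31 i32 n
      unfolding g1(4) g2(4) g3(4) csetC by (simp add: Int_commute)
    then show False
    proof
      assume m: "cset p \<inter> inside (cset q \<union> cset P) \<noteq> {}"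
      have "inside (cset q \<union> cset p) \<union> inside (cset P \<union> cset p) \<union> (cset p - {a, b}) = inside (cset q \<union> cset P)"
        using split_inside_simple_closed_curve[OF arc_imp_simple_path[OF g2(1)] g2(2,3) arc_imp_simple_path[OF g3(1)] g3(2,3)
          arc_imp_simple_path[OF g1(1)] g1(2,3) ab(3)] i12 i31 i32 m
        unfolding g1(4) g2(4) g3(4) by (metis Int_commute)
      then have s: "inside (cset C0) \<subseteq> inside (cset (P @ q))" "cset p - {a, b} \<subseteq> inside (cset (P @ q))"
        unfolding csetC by (auto simp: Un_commute)
      have "dcycle G (P @ q)" by (rule dcycle_join[OF P(1) pq(3) P(2) Pq])
      from max[OF this s(1)] have "inside (cset (P @ q)) = inside (cset C0)" .
      then show False using s(2) csetC by (intro no[OF g1(1-3)]) (simp_all only: g1(4) Un_upper1)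
    next
      assume m: "cset q \<inter> inside (cset p \<union> cset P) \<noteq> {}"
      have "inside (cset p \<union> cset q) \<union> inside (cset P \<union> cset q) \<union> (cset q - {a, b}) = inside (cset p \<union> cset P)"
        using split_inside_simple_closed_curve[OF arc_imp_simple_path[OF g1(1)] g1(2,3) arc_imp_simple_path[OF g3(1)] g3(2,3)
          arc_imp_simple_path[OF g2(1)] g2(2,3) ab(3)] i12 i31 i32 m
        unfolding g1(4) g2(4) g3(4) by (metis Int_commute)
      then have "inside (cset C0) \<subseteq> inside (cset P \<union> cset (drev p))" "cset q - {a, b} \<subseteq> inside (cset P \<union> cset (drev p))"
        unfolding csetC csr by (auto simp: Un_commute)
      then have s: "inside (cset C0) \<subseteq> inside (cset (P @ drev p))" "cset q - {a, b} \<subseteq> inside (cset (P @ drev p))"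
        by simp_all
      have "dcycle G (P @ drev p)" by (rule dcycle_join[OF P(1) rp(1) P(2) Pp])
      from max[OF this s(1)] have "inside (cset (P @ drev p)) = inside (cset C0)" .
      then show False using s(2) csetC by (intro no[OF g2(1-3)]) (simp_all only: g2(4) Un_upper2)
    qed
  qed
  define R where "R = cset P - {a, b}"
  have conn: "connected R"
    using connected_simple_path_endless[OF arc_imp_simple_path[OF g3(1)]] g3 by (simp add: R_def)
  have i30: "cset P \<inter> cset C0 = {a, b}" unfolding csetC Int_Un_distrib i31 i32 by simp
  then have cov: "R \<subseteq> inside (cset C0) \<union> outside (cset C0)"
    unfolding R_def inside_Un_outside by blast
  have "inside (cset C0) \<inter> R \<noteq> {}"
    using meets i30 inside_no_overlap[of "cset C0"] unfolding R_def by blast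
  moreover have "inside (cset C0) \<inter> outside (cset C0) \<inter> R = {}" by simp
  ultimately have "outside (cset C0) \<inter> R = {}"
    using connectedD[OF conn dcycle_Jordan(2,5)[OF C0] _ cov] by blast
  then show ?thesis using cov unfolding R_def by blast
qed

lemma outer_cycle:
  assumes bounded_face: "verts (weak_dual G) \<noteq> {}"
  shows "\<exists>C0. dcycle G C0 \<and> set (tails C0) = verts G \<and>
    (\<forall>e \<in> edges G - set (dedges C0). e - ends G e \<subseteq> inside (cset C0))"
proof -
  have "\<exists>C. dcycle G C"
  proof (rule ccontr)
    assume "\<nexists>C. dcycle G C"
    \<comment> \<open>A single arc does not separate the plane, so there would be no bounded
      face.\<close>
    then obtain e where e: "edges G = {e}" "verts G = ends G e"
      using biconnected_cycle_or_edge[OF bi] ends_sub ends_card by metis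
    have "e \<in> edges G" using e by simp
    then obtain g where g: "arc g" "path_image g = e" "ends G e = {pathstart g, pathfinish g}" "e \<inter> verts G = ends G e"
      by (rule edge_arc)
    have supp: "support G = e" using e ends_sub(1)[of e] by (auto simp: support_def)
    have "connected (- e)" using connected_arc_complement[OF g(1)] g(2) by simp
    moreover have "bounded e" using g by (metis bounded_arc_image)
    then have "\<not> bounded (- e)" by (intro cobounded_imp_unbounded) simp
    ultimately have "- e \<subseteq> outside e" by (intro connected_subset_outside) auto
    then have "outside e = - e" using outside_no_overlap[of e] by blast
    then have "outer_face G = - e" by (simp add: outer_face_def supp)
    moreover have "faces G \<subseteq> {- e}"
      using \<open>connected (- e)\<close> unfolding faces_def supp by (simp add: connected_eq_components_subset_sing)
    ultimately show False using bounded_face by (auto simp: weak_dual_def plane_dual_def delete_vert_def)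
  qed
  moreover have "finite {inside (cset C) |C. dcycle G C}"
  proof (rule finite_subset)
    show "{inside (cset C) |C. dcycle G C} \<subseteq> (\<lambda>D. inside (\<Union>D)) ` Pow (edges G)"
      using dcycle_dedges by blast
  qed (use fin in simp)
  ultimately obtain I where I: "I \<in> {inside (cset C) |C. dcycle G C}" "\<forall>J\<in>{inside (cset C) |C. dcycle G C}. I \<subseteq> J \<longrightarrow> I = J"
    using finite_has_maximal[of "{inside (cset C) |C. dcycle G C}"] by blast
  then obtain C0 where C0: "dcycle G C0" "I = inside (cset C0)" by blast
  have max: "inside (cset C) = inside (cset C0)" if "dcycle G C" "inside (cset C0) \<subseteq> inside (cset C)" for C
    using I(2) that C0(2) by blast
  have w: "walk G (fst (hd C0)) C0 (fst (hd C0))" using C0 by (simp add: dcycle_def)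
  have tV: "set (tails C0) = verts G"
  proof (rule ccontr)
    assume "set (tails C0) \<noteq> verts G"
    then obtain a f x p b where ear: "a \<in> set (tails C0)" "b \<in> set (tails C0)" "a \<noteq> b" "x \<notin> set (tails C0)"
      "dpath G a ((a, f, x) # p) b" "set (tails p) \<inter> set (tails C0) = {}"
      using biconnected_ear[OF bi ends_sub(2) C0(1)] by blast
    let ?P = "(a, f, x) # p"
    have wP: "walk G a ?P b" using ear by (simp add: dpath_def)
    have f: "f \<in> edges G" "ends G f = {a, x}" using wP by auto
    \<comment> \<open>Every edge of the ear has an end off the cycle: \<open>x\<close> for the first
      one, the tail for the others.\<close>
    have "e \<notin> set (dedges C0)" if e: "e \<in> set (dedges ?P)" for e
    proof
      assume "e \<in> set (dedges C0)"
      then obtain u v where "(u, e, v) \<in> set C0" by auto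
      then have "ends G e \<subseteq> set (tails C0)"
        using walk_dart[OF w] walk_vertices[OF w] w C0(1) by (fastforce simp: dcycle_def)
      moreover obtain u' v' where "(u', e, v') \<in> set ?P" using dedges_dart[OF e] by blast
      then have "ends G e = {u', v'}" "u' \<in> set (tails p) \<or> v' \<in> {x}"
        using walk_dart[OF wP] by (blast, force)
      ultimately show False using ear(4,6) by auto
    qed
    then have "cset ?P - {a, b} \<subseteq> inside (cset C0)"
      using ear by (intro ear_inside[OF C0(1) max]) auto
    moreover have "x \<in> cset ?P" using ends_sub(1)[OF f(1)] f(2) by auto
    moreover have "x \<noteq> a" "x \<noteq> b" using ear by auto
    ultimately have "x \<in> inside (cset C0)" by blast
    moreover have "x \<in> verts G" using ends_sub(2)[OF f(1)] f(2) by auto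
    ultimately show False using vertex_not_inside C0(1) by blast
  qed
  have "e - ends G e \<subseteq> inside (cset C0)" if e: "e \<in> edges G - set (dedges C0)" for e
  proof -
    obtain u v where uv: "ends G e = {u, v}" "u \<noteq> v" using ends_card e by (meson DiffD1 card_2_iff)
    then have "u \<in> set (tails C0)" "v \<in> set (tails C0)" using ends_sub(2)[of e] e tV by auto
    moreover have "dpath G u [(u, e, v)] v" using uv e by (auto simp: dpath_def)
    ultimately have "cset [(u, e, v)] - {u, v} \<subseteq> inside (cset C0)"
      using e uv by (intro ear_inside[OF C0(1) max]) auto
    then show ?thesis using uv by simp
  qed
  then show ?thesis using C0 tV by blast
qed

definition src :: "complex set \<Rightarrow> complex" where
  "src e = (SOME u. u \<in> ends G e)"

definition tgt :: "complex set \<Rightarrow> complex" where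
  "tgt e = (SOME v. v \<in> ends G e \<and> v \<noteq> src e)"

lemma src_tgt:
  assumes "e \<in> edges G"
  shows "ends G e = {src e, tgt e}" "src e \<noteq> tgt e"
proof -
  obtain u v where uv: "ends G e = {u, v}" "u \<noteq> v" using ends_card[OF assms] by (meson card_2_iff)
  have s: "src e \<in> ends G e" unfolding src_def using uv by (metis insertI1 someI)
  then have "\<exists>v. v \<in> ends G e \<and> v \<noteq> src e" using uv by auto
  then have "tgt e \<in> ends G e \<and> tgt e \<noteq> src e" unfolding tgt_def by (rule someI_ex)
  then show "ends G e = {src e, tgt e}" "src e \<noteq> tgt e" using s uv by auto
qed

sublocale oriented_graph G src tgt
  using src_tgt ends_sub(2) fin by unfold_locales blast+

text \<open>The invariant of adding chords: in the graph with the edges \<open>E'\<close> the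
  insides of the cycles in \<open>\<C>\<close> are the bounded faces. The last two conditions say
  that the cycles are oriented coherently, so that they add up to \<open>C0\<close>, and that an
  edge belongs to one of them if it is on \<open>C0\<close> and to two otherwise.\<close>

definition face_system :: "(complex, complex set) dart list \<Rightarrow> complex set set \<Rightarrow> (complex, complex set) dart list set \<Rightarrow> bool" where
  "face_system C0 E' \<C> \<longleftrightarrow> cycle_basis E' \<C> \<and> (\<Union>C\<in>\<C>. inside (cset C)) = inside (cset C0) - \<Union>E' \<and>
    (\<forall>C\<in>\<C>. \<forall>D\<in>\<C>. C \<noteq> D \<longrightarrow> inside (cset C) \<inter> inside (cset D) = {}) \<and>
    (\<forall>e. (\<Sum>C\<in>\<C>. zvec C e) = zvec C0 e) \<and>
    (\<forall>e\<in>E'. (\<Sum>C\<in>\<C>. \<bar>zvec C e\<bar>) = (if e \<in> set (dedges C0) then 1 else 2))"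

lemma zvec_abs:
  assumes "dcycle G C"
  shows "\<bar>zvec C e\<bar> = of_bool (e \<in> set (dedges C))"
proof (cases "e \<in> set (dedges C)")
  case True
  then obtain u v where "(u, e, v) \<in> set C" by auto
  then have "zvec C e = sg u e" using zvec_dart assms by (simp add: dcycle_def)
  then show ?thesis using True by (simp add: sg_def)
qed (simp add: zvec_notin)

lemma face_system_cycle:
  assumes "dcycle G C0"
  shows "face_system C0 (set (dedges C0)) {C0}"
proof -
  have "inside (cset C0) - cset C0 = inside (cset C0)" using inside_no_overlap[of "cset C0"] by blast
  then show ?thesis
    unfolding face_system_def using cycle_basis_cycle[OF assms] zvec_abs[OF assms] by (simp del: set_map)
qed

lemma edge_closure:
  assumes e: "e \<in> edges G" "a \<in> ends G e"
  shows "a \<in> closure (e - ends G e)"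
proof -
  have "connected e" using edge_arc[OF e(1)] connected_arc_image by metis
  moreover have "a \<in> e" using e ends_sub by blast
  moreover have "\<nexists>b. e = {b}" using edge_infinite[OF e(1)] by auto
  ultimately have "a islimpt e" by (intro connected_imp_perfect) auto
  moreover have "e = ends G e \<union> (e - ends G e)" using ends_sub(1)[OF e(1)] by blast
  moreover have "finite (ends G e)" using fin ends_sub(2)[OF e(1)] finite_subset by blast
  ultimately have "a islimpt (e - ends G e)" using islimpt_Un_finite by metis
  then show ?thesis by (simp add: closure_def)
qed

text \<open>The open chord is connected and covered by disjoint open insides, so it runs in one of
  them. Its ends are vertices in the closure of that inside but not inside, hence on the cycle,
  which the chord splits into two.\<close>

lemma face_system_chord:
  assumes sys: "face_system C0 E' \<C>" and E': "set (dedges C0) \<subseteq> E'" "E' \<subseteq> edges G"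
    and e0: "e0 \<in> edges G - E'" "e0 - ends G e0 \<subseteq> inside (cset C0)"
  shows "\<exists>\<C>'. face_system C0 (insert e0 E') \<C>'"
proof -
  have basis: "cycle_basis E' \<C>" and U: "(\<Union>C\<in>\<C>. inside (cset C)) = inside (cset C0) - \<Union>E'"
    and disj: "\<And>C D. C \<in> \<C> \<Longrightarrow> D \<in> \<C> \<Longrightarrow> C \<noteq> D \<Longrightarrow> inside (cset C) \<inter> inside (cset D) = {}"
    and sum0: "\<And>e. (\<Sum>C\<in>\<C>. zvec C e) = zvec C0 e"
    and sum1: "\<And>e. e \<in> E' \<Longrightarrow> (\<Sum>C\<in>\<C>. \<bar>zvec C e\<bar>) = (if e \<in> set (dedges C0) then 1 else 2)"
    using sys unfolding face_system_def by auto
  note cyc = cycle_basisD(2)[OF basis] and fin\<C> = cycle_basisD(1)[OF basis]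
  obtain a b where ab: "ends G e0 = {a, b}" "a \<noteq> b" using ends_card e0 by (meson DiffD1 card_2_iff)
  obtain g where g: "arc g" "path_image g = e0" "pathstart g = a" "pathfinish g = b"
    using edge_arc_from[of e0 a b] e0 ab by blast
  have e0E: "e0 \<inter> \<Union>E' \<subseteq> ends G e0"
    using e0 E' edge_inter ends_sub(3) by fast
  have nonempty: "e0 - {a, b} \<noteq> {}" and conn: "connected (e0 - {a, b})"
    using nonempty_simple_path_endless[OF arc_imp_simple_path[OF g(1)]]
      connected_simple_path_endless[OF arc_imp_simple_path[OF g(1)]] g by auto
  have sub: "e0 - {a, b} \<subseteq> (\<Union>C\<in>\<C>. inside (cset C))" unfolding U using e0 e0E ab by auto
  then obtain C where C: "C \<in> \<C>" "(e0 - {a, b}) \<inter> inside (cset C) \<noteq> {}" using nonempty by blast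
  let ?W = "\<Union>D\<in>\<C> - {C}. inside (cset D)"
  have Ccyc: "dcycle G C" and CE: "set (dedges C) \<subseteq> E'" using cyc[OF C(1)] by auto
  have opW: "open ?W" using cyc dcycle_Jordan(2) by (intro open_UN) blast
  have "inside (cset C) \<inter> ?W = {}" using disj[OF C(1)] by blast
  then have int0: "inside (cset C) \<inter> ?W \<inter> (e0 - {a, b}) = {}" by blast
  have cov: "e0 - {a, b} \<subseteq> inside (cset C) \<union> ?W" using sub by blast
  have "?W \<inter> (e0 - {a, b}) = {}"
    using connectedD[OF conn dcycle_Jordan(2)[OF Ccyc] opW int0 cov] C(2) by blast
  then have e0C: "e0 - {a, b} \<subseteq> inside (cset C)" using cov by blast
  have "x \<in> set (tails C)" if x: "x \<in> {a, b}" for x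
  proof -
    have "x \<in> closure (e0 - {a, b})" using edge_closure[of e0 x] e0 ab x by auto
    then have "x \<in> closure (inside (cset C))" using closure_mono[OF e0C] by blast
    then have "x \<in> inside (cset C) \<union> cset C"
      using dcycle_Jordan(8)[OF Ccyc] by (auto simp: closure_Un_frontier)
    moreover have "x \<in> verts G" using ends_sub(2)[of e0] e0 ab x by auto
    ultimately show ?thesis using vertex_not_inside[OF _ Ccyc] dcycle_cset_verts[OF Ccyc] by blast
  qed
  then have abC: "a \<in> set (tails C)" "b \<in> set (tails C)" by auto
  obtain p q where pq: "mset C = mset (p @ q)" "dpath G a p b" "dpath G b q a" "distinct (tails (p @ q))"
    "distinct (dedges (p @ q))" "p \<noteq> []" "q \<noteq> []"
    using dcycle_split[OF Ccyc abC ab(2)] by blast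
  have "set C = set p \<union> set q" using mset_eq_setD[OF pq(1)] by simp
  then have dC: "set (dedges C) = set (dedges p) \<union> set (dedges q)" by (simp add: image_Un)
  then have csetC: "cset C = cset p \<union> cset q" by simp
  have e0pq: "e0 \<notin> set (dedges p)" "e0 \<notin> set (dedges q)" using dC CE e0 by blast+
  \<comment> \<open>The chord is traversed once in either direction, so its contributions to the sum
    of all cycles cancel.\<close>
  define C1 C2 where "C1 = p @ [(b, e0, a)]" and "C2 = q @ [(a, e0, b)]"
  have C1: "dcycle G C1" unfolding C1_def
    using e0 ab pq e0pq by (intro dpath_close_dcycle) auto
  have C2: "dcycle G C2" unfolding C2_def
    using e0 ab pq e0pq by (intro dpath_close_dcycle) auto
  have cs: "cset C1 = cset p \<union> e0" "cset C2 = cset q \<union> e0" by (auto simp: C1_def C2_def)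
  obtain g1 g2 where g1: "arc g1" "pathstart g1 = a" "pathfinish g1 = b" "path_image g1 = cset p"
    and g2: "arc g2" "pathstart g2 = a" "pathfinish g2 = b" "path_image g2 = cset q"
    using split_arcs(1)[OF pq(2-7)] by blast
  have i12: "cset p \<inter> cset q = {a, b}" by (rule split_arcs(2)[OF pq(2-7)])
  have e0C': "e0 \<inter> cset C \<subseteq> {a, b}" using e0E CE ab by blast
  have e0ab: "{a, b} \<subseteq> e0" using ends_sub(1)[of e0] e0 ab by auto
  have i1: "cset p \<inter> e0 = {a, b}" "cset q \<inter> e0 = {a, b}" using e0C' csetC i12 e0ab by blast+
  have sp: "inside (cset C1) \<inter> inside (cset C2) = {}"
    "inside (cset C1) \<union> inside (cset C2) \<union> (e0 - {a, b}) = inside (cset C)"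
  proof -
    have m: "path_image g \<inter> inside (path_image g1 \<union> path_image g2) \<noteq> {}"
      using C(2) g1 g2 g csetC by auto
    show "inside (cset C1) \<inter> inside (cset C2) = {}"
      "inside (cset C1) \<union> inside (cset C2) \<union> (e0 - {a, b}) = inside (cset C)"
      using split_inside_simple_closed_curve[OF arc_imp_simple_path[OF g1(1)] g1(2,3) arc_imp_simple_path[OF g2(1)] g2(2,3)
          arc_imp_simple_path[OF g(1)] g(3,4) ab(2) _ _ _ m] i12 i1
      unfolding g1(4) g2(4) g(2) csetC cs by metis+
  qed
  let ?\<C> = "insert C1 (insert C2 (\<C> - {C}))"
  have pairC: "pair C y = pair p y + pair q y" for y
    using pair_mset[OF pq(1), of y] by simp
  have ends': "ends G e0 = {b, a}" using ab by auto
  have new: "cycle_basis (insert e0 E') ?\<C>" "C1 \<noteq> C2" "C1 \<notin> \<C>" "C2 \<notin> \<C>"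
    using cycle_basis_chord[OF basis C(1) e0(1) ab(1) _ _ pairC _ C1_def C1 C2_def C2] pq(2,3) dC CE
    by (auto simp: dpath_def simp del: set_map)
  have sum': "(\<Sum>D\<in>?\<C>. f D) = f C1 + (f C2 + (\<Sum>D\<in>\<C> - {C}. f D))" for f :: "_ \<Rightarrow> int"
    using fin\<C> new by simp
  have sumC: "(\<Sum>D\<in>\<C>. f D) = f C + (\<Sum>D\<in>\<C> - {C}. f D)" for f :: "_ \<Rightarrow> int"
    using fin\<C> C by (simp add: sum.remove)
  have z12: "zvec C e = zvec p e + zvec q e" for e unfolding zvec_def by (rule pairC)
  have sg': "sg b e0 = - sg a e0" using grad_dart(2)[of e0 b a] e0 ends' by simp
  have z1: "zvec C1 e = zvec p e + (if e = e0 then - sg a e0 else 0)"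
    and z2: "zvec C2 e = zvec q e + (if e = e0 then sg a e0 else 0)" for e
    by (auto simp: C1_def C2_def sg')
  have "(\<Sum>D\<in>?\<C>. zvec D e) = zvec C0 e" for e
    using sum0[of e] unfolding sum' sumC z1 z2 z12 by auto
  moreover have "(\<Sum>D\<in>?\<C>. \<bar>zvec D e\<bar>) = (if e \<in> set (dedges C0) then 1 else 2)" if e: "e \<in> insert e0 E'" for e
  proof (cases "e = e0")
    case True
    \<comment> \<open>The new edge occurs in \<open>C1\<close> and \<open>C2\<close> only, which
      gives the count 2.\<close>
    have "(\<Sum>D\<in>\<C> - {C}. \<bar>zvec D e0\<bar>) = 0"
    proof (intro sum.neutral ballI)
      fix D assume "D \<in> \<C> - {C}"
      then have "e0 \<notin> set (dedges D)" using cyc[of D] e0 by blast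
      then show "\<bar>zvec D e0\<bar> = 0" by (simp add: zvec_notin)
    qed
    moreover have "\<bar>sg a e0\<bar> = 1" by (simp add: sg_def)
    moreover have "e0 \<notin> set (dedges C0)" using E' e0 by blast
    ultimately show ?thesis unfolding sum' z1 z2 True using e0pq by (simp add: zvec_notin)
  next
    case False
    \<comment> \<open>An old edge of \<open>C\<close> goes to only one of the two parts, so the
      count is unchanged.\<close>
    have "e \<notin> set (dedges p) \<or> e \<notin> set (dedges q)" using pq(5) by auto
    then have "\<bar>zvec p e\<bar> + \<bar>zvec q e\<bar> = \<bar>zvec C e\<bar>" unfolding z12 by (auto simp: zvec_notin simp del: set_map)
    then show ?thesis using sum1[of e] e False unfolding sum' sumC z1 z2 by auto
  qed
  moreover have "inside (cset D) \<inter> inside (cset D') = {}" if D: "D \<in> ?\<C>" "D' \<in> ?\<C>" "D \<noteq> D'" for D D'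
  proof -
    have s: "inside (cset C1) \<subseteq> inside (cset C)" "inside (cset C2) \<subseteq> inside (cset C)" using sp(2) by blast+
    have o: "inside (cset D) \<inter> inside (cset C) = {}" if "D \<in> \<C> - {C}" for D
      using disj[of D C] that C(1) by blast
    have "D \<in> \<C> - {C} \<Longrightarrow> D' \<in> \<C> - {C} \<Longrightarrow> ?thesis" using disj[of D D'] D(3) by blast
    then show ?thesis using D s o[of D] o[of D'] sp(1) by (elim insertE) blast+
  qed
  moreover have "(\<Union>D\<in>?\<C>. inside (cset D)) = inside (cset C0) - \<Union>(insert e0 E')"
  proof -
    have "inside (cset C1) \<union> inside (cset C2) = inside (cset C) - e0"
      using sp(2) inside_no_overlap[of "cset C1"] inside_no_overlap[of "cset C2"] i1
        inside_no_overlap[of "cset C"] csetC unfolding cs by blast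
    moreover have "inside (cset D) \<inter> e0 = {}" if "D \<in> \<C> - {C}" for D
    proof -
      have "inside (cset D) \<inter> (e0 - {a, b}) = {}" using disj[of D C] that C(1) e0C by blast
      moreover have "inside (cset D) \<inter> {a, b} = {}"
        using vertex_not_inside[of _ D] cyc[of D] that ends_sub(2)[of e0] e0 ab by blast
      ultimately show ?thesis by blast
    qed
    ultimately have "(\<Union>D\<in>?\<C>. inside (cset D)) = (\<Union>D\<in>\<C>. inside (cset D)) - e0"
      using C(1) by blast
    then show ?thesis unfolding U by auto
  qed
  ultimately show ?thesis using new(1) unfolding face_system_def by blast
qed

lemma face_system_exists:
  assumes "verts (weak_dual G) \<noteq> {}"
  shows "\<exists>C0 \<C>. dcycle G C0 \<and> set (tails C0) = verts G \<and>
    (\<forall>e \<in> edges G - set (dedges C0). e - ends G e \<subseteq> inside (cset C0)) \<and> face_system C0 (edges G) \<C>"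
proof -
  obtain C0 where C0: "dcycle G C0" "set (tails C0) = verts G"
    "\<forall>e \<in> edges G - set (dedges C0). e - ends G e \<subseteq> inside (cset C0)"
    using outer_cycle[OF assms] by blast
  have E0: "set (dedges C0) \<subseteq> edges G" by (rule dcycle_dedges[OF C0(1)])
  have "\<exists>\<C>. face_system C0 (set (dedges C0) \<union> K) \<C>" if "finite K" "K \<subseteq> edges G - set (dedges C0)" for K
    using that
  proof induction
    case empty
    then show ?case using face_system_cycle[OF C0(1)] by auto
  next
    case (insert e K)
    then obtain \<C> where "face_system C0 (set (dedges C0) \<union> K) \<C>" by blast
    then have "\<exists>\<C>'. face_system C0 (insert e (set (dedges C0) \<union> K)) \<C>'"
      using insert.hyps insert.prems E0 C0(3) by (intro face_system_chord) auto
    then show ?case by simp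
  qed
  from this[of "edges G - set (dedges C0)"] obtain \<C> where "face_system C0 (edges G) \<C>"
    using fin E0 by (auto simp: Un_absorb1)
  then show ?thesis using C0 by blast
qed

end


section \<open>The faces of a biconnected outerplane graph\<close>

context outerplane_gr
begin

text \<open>Bounded faces correspond to the insides of the basis cycles, and dual edges to the edges
  off \<open>C0\<close>, each shared by exactly two of these cycles. This is where topology is left:
  from here on only the integral cycle basis and its Gram matrix matter.\<close>

lemma weak_dual_gram:
  assumes bounded_face: "verts (weak_dual G) \<noteq> {}"
  shows "\<exists>\<C>. cycle_basis (edges G) \<C> \<and> bij_betw (\<lambda>C. inside (cset C)) \<C> (verts (weak_dual G)) \<and>
    (\<forall>e\<in>edges (weak_dual G). ends (weak_dual G) e \<subseteq> verts (weak_dual G) \<and> card (ends (weak_dual G) e) = 2) \<and>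
    finite (edges (weak_dual G)) \<and>
    (\<forall>C\<in>\<C>. \<forall>D\<in>\<C>. A_matrix (\<lambda>F. int (bounding_cycle_length G F)) (weak_dual G) (inside (cset C)) (inside (cset D)) = gram C D)"
proof -
  obtain C0 \<C> where C0: "dcycle G C0" and tV: "set (tails C0) = verts G"
    and chords: "\<forall>e \<in> edges G - set (dedges C0). e - ends G e \<subseteq> inside (cset C0)"
    and sys: "face_system C0 (edges G) \<C>"
    using face_system_exists[OF bounded_face] by blast
  have basis: "cycle_basis (edges G) \<C>" and U: "(\<Union>C\<in>\<C>. inside (cset C)) = inside (cset C0) - \<Union>(edges G)"
    and disj: "\<And>C D. C \<in> \<C> \<Longrightarrow> D \<in> \<C> \<Longrightarrow> C \<noteq> D \<Longrightarrow> inside (cset C) \<inter> inside (cset D) = {}"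
    and sum0: "\<And>e. (\<Sum>C\<in>\<C>. zvec C e) = zvec C0 e"
    and sum1: "\<And>e. e \<in> edges G \<Longrightarrow> (\<Sum>C\<in>\<C>. \<bar>zvec C e\<bar>) = (if e \<in> set (dedges C0) then 1 else 2)"
    using sys unfolding face_system_def by auto
  have fin\<C>: "finite \<C>" by (rule cycle_basisD(1)[OF basis])
  have cyc: "dcycle G C" if "C \<in> \<C>" for C using cycle_basisD(2)[OF basis that] by blast
  have cE: "set (dedges C) \<subseteq> edges G" if "C \<in> \<C>" for C using dcycle_dedges[OF cyc[OF that]] .
  have E0: "set (dedges C0) \<subseteq> edges G" by (rule dcycle_dedges[OF C0])
  define I where "I C = inside (cset C)" for C :: "(complex, complex set) dart list"
  let ?O = "outside (cset C0)"
  have Vsub: "verts G \<subseteq> cset C0" using dcycle_cset_verts[OF C0] tV by blast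
  have supp: "support G = \<Union>(edges G)" using Vsub E0 by (auto simp: support_def)
  have OE: "?O \<inter> \<Union>(edges G) = {}"
  proof -
    have "e \<subseteq> inside (cset C0) \<union> cset C0" if e: "e \<in> edges G" for e
    proof (cases "e \<in> set (dedges C0)")
      case False
      then show ?thesis using chords e ends_sub(2)[OF e] Vsub by blast
    qed blast
    then show ?thesis using inside_Int_outside[of "cset C0"] outside_no_overlap[of "cset C0"] by blast
  qed
  have IC0: "I C \<subseteq> inside (cset C0)" if "C \<in> \<C>" for C using U that unfolding I_def by blast
  have IO: "I C \<inter> ?O = {}" if "C \<in> \<C>" for C using IC0[OF that] inside_Int_outside[of "cset C0"] by blast
  have Ine: "I C \<noteq> {}" if "C \<in> \<C>" for C using dcycle_Jordan(1)[OF cyc[OF that]] by (simp add: I_def)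
  have inj: "inj_on I \<C>"
  proof (rule inj_onI, rule ccontr)
    fix C D assume "C \<in> \<C>" "D \<in> \<C>" "I C = I D" "C \<noteq> D"
    then show False using disj[of C D] Ine[of C] by (simp add: I_def)
  qed
  have One: "?O \<noteq> {}" using dcycle_Jordan(7)[OF C0] by auto
  \<comment> \<open>Disjoint nonempty open connected sets that make up the complement are its
    components.\<close>
  have faces: "faces G = insert ?O (I ` \<C>)"
    unfolding faces_def supp
  proof (rule components_open_unique)
    show "pairwise disjnt (insert ?O (I ` \<C>))"
      using IO disj unfolding pairwise_def disjnt_def I_def by blast
    show "\<Union>(insert ?O (I ` \<C>)) = - \<Union>(edges G)"
    proof -
      have gen: "Q \<union> (J - W) = - W" if "S \<subseteq> W" "Q \<inter> W = {}" "J \<union> Q = - S" for Q J W S :: "complex set"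
        using that by blast
      have "cset C0 \<subseteq> \<Union>(edges G)" using E0 by blast
      from gen[OF this OE inside_Un_outside]
      have "?O \<union> (inside (cset C0) - \<Union>(edges G)) = - \<Union>(edges G)" .
      moreover have "\<Union>(I ` \<C>) = inside (cset C0) - \<Union>(edges G)" using U by (simp add: I_def)
      ultimately show ?thesis by simp
    qed
    fix X assume "X \<in> insert ?O (I ` \<C>)"
    then show "open X \<and> connected X \<and> X \<noteq> {}"
      using dcycle_Jordan(5,6)[OF C0] One dcycle_Jordan(1-3) cyc by (auto simp: I_def)
  qed
  have outer_face: "outer_face G = ?O"
  proof
    show "outer_face G \<subseteq> ?O"
      unfolding outer_face_def by (rule outside_mono[OF dcycle_cset_support[OF C0]])
    show "?O \<subseteq> outer_face G"
      unfolding outer_face_def supp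
      by (rule connected_subset_outside[OF dcycle_Jordan(6)[OF C0] OE dcycle_Jordan(7)[OF C0]])
  qed
  let ?T = "weak_dual G"
  have O_notin: "?O \<notin> I ` \<C>" using IO One by blast
  have vT: "verts ?T = I ` \<C>"
    using O_notin by (auto simp: weak_dual_def delete_vert_def plane_dual_def faces outer_face)
  have fI: "frontier (I C) = cset C" if "C \<in> \<C>" for C using dcycle_Jordan(8)[OF cyc[OF that]] by (simp add: I_def)
  have eI: "e \<subseteq> frontier (I C) \<longleftrightarrow> e \<in> set (dedges C)" if "C \<in> \<C>" "e \<in> edges G" for C e
    using edge_sub_Union[OF that(2) cE[OF that(1)]] fI[OF that(1)] by blast
  have eO: "e \<subseteq> frontier ?O \<longleftrightarrow> e \<in> set (dedges C0)" if "e \<in> edges G" for e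
    using edge_sub_Union[OF that E0] dcycle_Jordan(9)[OF C0] by blast
  \<comment> \<open>Deleting the outer face from the dual removes exactly the edges on its frontier,
    those of \<open>C0\<close>.\<close>
  have eT: "edges ?T = edges G - set (dedges C0)"
    using eO by (auto simp: weak_dual_def delete_vert_def plane_dual_def faces outer_face)
  have endsT: "ends ?T e = I ` {C\<in>\<C>. e \<in> set (dedges C)}" if e: "e \<in> edges ?T" for e
  proof -
    have e': "e \<in> edges G" "e \<notin> set (dedges C0)" using e eT by auto
    have "ends ?T e = {F \<in> insert ?O (I ` \<C>). e \<subseteq> frontier F}"
      by (simp add: weak_dual_def delete_vert_def plane_dual_def faces)
    also have "\<dots> = I ` {C\<in>\<C>. e \<subseteq> frontier (I C)}"
    proof -
      have gen: "{F \<in> insert Q (I ` \<C>). P F} = I ` {C\<in>\<C>. P (I C)}" if "\<not> P Q" for P Q using that by auto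
      show ?thesis using gen[of "\<lambda>F. e \<subseteq> frontier F" ?O] eO[OF e'(1)] e'(2) by simp
    qed
    also have "{C\<in>\<C>. e \<subseteq> frontier (I C)} = {C\<in>\<C>. e \<in> set (dedges C)}"
      by (rule Collect_cong, rule conj_cong[OF HOL.refl], rule eI[OF _ e'(1)])
    finally show ?thesis .
  qed
  have cnt: "card {C\<in>\<C>. e \<in> set (dedges C)} = (if e \<in> set (dedges C0) then 1 else 2)" if e: "e \<in> edges G" for e
  proof -
    have "int (card {C\<in>\<C>. e \<in> set (dedges C)}) = (\<Sum>C\<in>\<C>. \<bar>zvec C e\<bar>)"
      using fin\<C> cyc by (simp add: zvec_abs sum.inter_filter[symmetric] of_bool_def cong: if_cong del: set_map)
    then show ?thesis using sum1[OF e] by (simp split: if_splits)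
  qed
  have endsT_V: "ends ?T e \<subseteq> verts ?T" and endsT_card: "card (ends ?T e) = 2" if e: "e \<in> edges ?T" for e
  proof -
    show "ends ?T e \<subseteq> verts ?T" using endsT[OF e] vT by auto
    have "inj_on I {C\<in>\<C>. e \<in> set (dedges C)}" by (rule inj_on_subset[OF inj]) auto
    then show "card (ends ?T e) = 2" using cnt[of e] e eT unfolding endsT[OF e] by (simp add: card_image)
  qed
  have len: "bounding_cycle_length G (I C) = length C" if C: "C \<in> \<C>" for C
    unfolding bounding_cycle_length_def fI[OF C]
  proof (rule the_equality)
    show "\<exists>vs es. is_cycle G vs es \<and> \<Union>(set es) = cset C \<and> length es = length C"
      using dcycle_is_cycle[OF cyc[OF C]] ends_sub(2) by (intro exI[of _ "tails C"] exI[of _ "dedges C"]) auto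
    fix l assume "\<exists>vs es. is_cycle G vs es \<and> \<Union>(set es) = cset C \<and> length es = l"
    then obtain vs es where es: "is_cycle G vs es" "\<Union>(set es) = cset C" "length es = l" by blast
    have "set es \<subseteq> edges G" "distinct es" using es(1) by (auto simp: is_cycle_def)
    \<comment> \<open>The frontier determines the edges of any cycle tracing it, so the definite
      description has a unique value.\<close>
    have "set es = set (dedges C)"
    proof
      show "set es \<subseteq> set (dedges C)" using edge_sub_Union[OF _ cE[OF C]] es(2) \<open>set es \<subseteq> edges G\<close> by blast
      show "set (dedges C) \<subseteq> set es" using edge_sub_Union[OF _ \<open>set es \<subseteq> edges G\<close>] es(2) cE[OF C] by blast
    qed
    moreover have "distinct (dedges C)" using cyc[OF C] by (simp add: dcycle_def)
    ultimately show "l = length C" using es(3) \<open>distinct es\<close> by (metis distinct_card length_map)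
  qed
  have gram_eq: "A_matrix (\<lambda>F. int (bounding_cycle_length G F)) ?T (I C) (I D) = gram C D" if CD: "C \<in> \<C>" "D \<in> \<C>" for C D
  proof (cases "C = D")
    case True
    have "adjacency ?T (I C) (I C) = 0"
      unfolding adjacency_def using endsT_card by (intro sum.neutral) force
    moreover have "gram C C = int (length C)"
    proof -
      have "gram C C = (\<Sum>e\<in>edges G. of_bool (e \<in> set (dedges C)))"
        unfolding gram_def
      proof (rule sum.cong[OF HOL.refl])
        fix e
        have "zvec C e * zvec C e = \<bar>zvec C e\<bar> * \<bar>zvec C e\<bar>" by simp
        also have "\<dots> = of_bool (e \<in> set (dedges C))"
          unfolding zvec_abs[OF cyc[OF CD(1)]] by (simp del: set_map)
        finally show "zvec C e * zvec C e = of_bool (e \<in> set (dedges C))" .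
      qed
      also have "\<dots> = int (card (set (dedges C)))"
        using fin cE[OF CD(1)] by (simp add: of_bool_def sum.inter_restrict[symmetric] Int_absorb1 del: set_map)
      also have "card (set (dedges C)) = length C"
        using cyc[OF CD(1)] by (simp add: dcycle_def distinct_card del: set_map)
      finally show ?thesis .
    qed
    ultimately show ?thesis using True len[OF CD(1)] by (simp add: A_matrix_def)
  next
    case False
    then have IF: "I C \<noteq> I D" using inj CD by (auto simp: inj_on_eq_iff)
    define B where "B = {e\<in>edges G. e \<in> set (dedges C) \<and> e \<in> set (dedges D)}"
    \<comment> \<open>The count \<open>cnt\<close> is 1 on \<open>C0\<close> and 2 elsewhere, so two
      known cycles exhaust it.\<close>
    have only: "{K\<in>\<C>. e \<in> set (dedges K)} = {C, D} \<and> e \<notin> set (dedges C0)" if e: "e \<in> B" for e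
    proof -
      have sub: "{C, D} \<subseteq> {K\<in>\<C>. e \<in> set (dedges K)}" using e CD by (auto simp: B_def)
      have "e \<in> edges G" using e by (simp add: B_def)
      moreover have c2: "card {C, D} = 2" using False by simp
      moreover have "card {C, D} \<le> card {K\<in>\<C>. e \<in> set (dedges K)}" using fin\<C> sub by (intro card_mono) auto
      ultimately have c: "card {K\<in>\<C>. e \<in> set (dedges K)} = 2" "e \<notin> set (dedges C0)"
        using cnt[of e] by (auto split: if_splits)
      then show ?thesis using card_subset_eq[OF _ sub] c2 fin\<C> by simp
    qed
    have BT: "{e. e \<in> edges ?T \<and> ends ?T e = {I C, I D}} = B"
    proof (intro equalityI subsetI)
      fix e assume "e \<in> {e. e \<in> edges ?T \<and> ends ?T e = {I C, I D}}"
      then have e: "e \<in> edges ?T" "I C \<in> ends ?T e" "I D \<in> ends ?T e" by auto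
      then have "I C \<in> I ` {C\<in>\<C>. e \<in> set (dedges C)}" "I D \<in> I ` {C\<in>\<C>. e \<in> set (dedges C)}" using endsT by auto
      then have "e \<in> set (dedges C)" "e \<in> set (dedges D)" using inj CD by (auto simp: inj_on_eq_iff simp del: set_map)
      then show "e \<in> B" using e eT by (auto simp: B_def)
    next
      fix e assume e: "e \<in> B"
      then have "e \<in> edges ?T" using only[OF e] eT by (auto simp: B_def)
      then show "e \<in> {e. e \<in> edges ?T \<and> ends ?T e = {I C, I D}}" using endsT only[OF e] by auto
    qed
    have "adjacency ?T (I C) (I D) = (\<Sum>e\<in>B. 1)"
      unfolding adjacency_def BT
    proof (rule sum.cong[OF HOL.refl])
      fix e assume "e \<in> B"
      then have "e \<in> edges ?T" "I C \<in> ends ?T e" using BT by auto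
      then show "incidences ?T e (I C) = 1" using endsT_card[of e] by (simp add: incidences_def)
    qed
    then have adj: "int (adjacency ?T (I C) (I D)) = (\<Sum>e\<in>B. 1)" by simp
    have "gram C D = (\<Sum>e\<in>B. - 1)"
      unfolding gram_def
    proof (rule sum.mono_neutral_cong_right)
      show "finite (edges G)" "B \<subseteq> edges G" using fin by (auto simp: B_def)
      show "\<forall>e\<in>edges G - B. zvec C e * zvec D e = 0" using zvec_notin by (fastforce simp: B_def simp del: set_map)
      fix e assume e: "e \<in> B"
      \<comment> \<open>Coherence: the signed sum at an edge off \<open>C0\<close> is 0 and only
        \<open>C\<close> and \<open>D\<close> contribute, so their signs are opposite.\<close>
      have "(\<Sum>K\<in>\<C>. zvec K e) = (\<Sum>K\<in>{C, D}. zvec K e)"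
      proof (rule sum.mono_neutral_right[OF fin\<C>])
        show "\<forall>K\<in>\<C> - {C, D}. zvec K e = 0" using only[OF e] zvec_notin by blast
      qed (use CD in auto)
      then have "zvec C e + zvec D e = zvec C0 e" using sum0[of e] False by simp
      then have "zvec D e = - zvec C e" using only[OF e] zvec_notin by fastforce
      moreover have "\<bar>zvec C e\<bar> = 1" using zvec_abs[OF cyc[OF CD(1)], of e] e by (simp add: B_def)
      ultimately show "zvec C e * zvec D e = - 1" by (metis abs_mult_self_eq minus_mult_right mult_1)
    qed
    then show ?thesis using adj IF by (simp add: A_matrix_def sum_negf)
  qed
  have "bij_betw I \<C> (verts ?T)" using inj vT by (simp add: bij_betw_def)
  moreover have "finite (edges ?T)" using eT fin by simp
  ultimately show ?thesis using basis endsT_V endsT_card gram_eq unfolding I_def by blast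
qed

end


section \<open>2-matchings of a tree\<close>

lemma tree_forest:
  assumes tree: "is_tree T" and fin: "finite (verts T)" "finite (edges T)"
    and wf: "\<And>e. e \<in> edges T \<Longrightarrow> ends T e \<subseteq> verts T \<and> card (ends T e) = 2"
  shows "forest (verts T) (edges T) (ends T)"
proof -
  have acyclic: "\<nexists>ds. dcycle T ds"
    using tree dcycle_is_cycle[of T] wf unfolding is_tree_def by blast
  show ?thesis
  proof
    show "inj_on (ends T) (edges T)"
    proof (rule inj_onI, rule ccontr)
      fix e e' assume e: "e \<in> edges T" "e' \<in> edges T" "ends T e = ends T e'" "e \<noteq> e'"
      then obtain u v where "ends T e = {u, v}" "u \<noteq> v" using wf by (meson card_2_iff)
      then have "dcycle T [(u, e, v), (v, e', u)]" using e by (auto simp: dcycle_def)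
      then show False using acyclic by blast
    qed
    show "\<exists>x e. x \<noteq> r \<and> e \<in> D \<and> x \<in> ends T e \<and> (\<forall>e'\<in>D. x \<in> ends T e' \<longrightarrow> e' = e)"
      if "D \<subseteq> edges T" "D \<noteq> {}" for D r
      by (rule acyclic_leaf[OF finite_subset[OF that(1) fin(2)] that _ acyclic]) (use wf that in blast)
  qed (use fin wf in auto)
qed

context
  fixes T :: "('v, 'e) mgraph" and X :: "'v \<Rightarrow> int"
  assumes forest: "forest (verts T) (edges T) (ends T)"
begin

interpretation forest "verts T" "edges T" "ends T" X
  by (rule forest)

lemma A_matrix_forest: "A_matrix X T = A"
proof (intro ext)
  fix u v
  show "A_matrix X T u v = A u v"
  proof (cases "u = v")
    case True
    have "adjacency T u u = 0"
      unfolding adjacency_def using en_card by (intro sum.neutral) force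
    then show ?thesis using True by (simp add: A_matrix_def A_def)
  next
    case False
    show ?thesis
    proof (cases "adj u v")
      case True
      have "e = the_edge u v" if "e \<in> edges T" "ends T e = {u, v}" for e
        using inj_onD[OF en_inj, of e "the_edge u v"] the_edge[OF True] that by simp
      then have "{e. e \<in> edges T \<and> ends T e = {u, v}} = {the_edge u v}"
        using the_edge[OF True] by blast
      moreover have "incidences T (the_edge u v) u = 1"
        using the_edge[OF True] False by (simp add: incidences_def)
      ultimately have "adjacency T u v = 1" by (simp add: adjacency_def)
      then show ?thesis using True False by (simp add: A_matrix_def A_def)
    next
      case n: False
      then have none: "{e. e \<in> edges T \<and> ends T e = {u, v}} = {}" by (auto simp: adj_def)
      have "adjacency T u v = 0" unfolding adjacency_def none by simp
      then show ?thesis using n False by (simp add: A_matrix_def A_def)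
    qed
  qed
qed

lemma two_matching_iff:
  assumes "P \<subseteq> edges T" "L \<subseteq> verts T"
  shows "two_matching (with_loops T) (P <+> L) \<longleftrightarrow> matching2 P L"
proof -
  have finL: "finite L" using assms(2) finV finite_subset by blast
  have sum: "(\<Sum>x\<in>P <+> L. incidences (with_loops T) x v) = deg P v + (if v \<in> L then 2 else 0)" for v
  proof -
    have "(\<Sum>x\<in>P <+> L. incidences (with_loops T) x v) =
        (\<Sum>e\<in>P. incidences (with_loops T) (Inl e) v) + (\<Sum>u\<in>L. incidences (with_loops T) (Inr u) v)"
      using finP[OF assms(1)] finL by (simp add: sum.Plus)
    also have "(\<Sum>e\<in>P. incidences (with_loops T) (Inl e) v) = (\<Sum>e\<in>P. if v \<in> ends T e then 1 else 0)"
      using en_card assms(1) by (intro sum.cong) (auto simp: incidences_def with_loops_def)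
    also have "\<dots> = deg P v"
      unfolding deg_def using finP[OF assms(1)] by (simp add: sum.inter_filter[symmetric])
    also have "(\<Sum>u\<in>L. incidences (with_loops T) (Inr u) v) = (\<Sum>u\<in>L. if u = v then 2 else 0)"
      by (intro sum.cong) (auto simp: incidences_def with_loops_def)
    finally show ?thesis using finL by simp
  qed
  have "(\<forall>v\<in>verts T. deg P v + (if v \<in> L then 2 else 0) \<le> 2) \<longleftrightarrow> (\<forall>v\<in>verts T. deg P v \<le> 2) \<and> (\<forall>v\<in>L. deg P v = 0)"
  proof -
    have "deg P v + (if v \<in> L then 2 else 0) \<le> 2 \<longleftrightarrow> deg P v \<le> 2 \<and> (v \<in> L \<longrightarrow> deg P v = 0)" for v by auto
    then show ?thesis using assms(2) by auto
  qed
  then show ?thesis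
    using assms unfolding two_matching_def matching2_def sum by (auto simp: with_loops_def)
qed

lemma two_matching_Plus:
  assumes "two_matching (with_loops T) M"
  obtains P L where "M = P <+> L" "P \<subseteq> edges T" "L \<subseteq> verts T"
proof -
  have M: "M \<subseteq> edges T <+> verts T" using assms by (simp add: two_matching_def with_loops_def)
  have "M = {e. Inl e \<in> M} <+> {v. Inr v \<in> M}"
  proof (intro equalityI subsetI)
    fix x assume "x \<in> M" then show "x \<in> {e. Inl e \<in> M} <+> {v. Inr v \<in> M}" by (cases x) auto
  qed auto
  moreover have "{e. Inl e \<in> M} \<subseteq> edges T" "{v. Inr v \<in> M} \<subseteq> verts T" using M by auto
  ultimately show ?thesis using that by blast
qed

lemma loops_Plus:
  assumes "P \<subseteq> edges T"
  shows "loops (with_loops T) (P <+> L) = Inr ` L"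
  using assms en_card by (fastforce simp: loops_def with_loops_def)

lemma card_matching:
  assumes "P \<subseteq> edges T" "L \<subseteq> verts T"
  shows "card (P <+> L) = card P + card L"
  using card_Plus finP[OF assms(1)] finite_subset[OF assms(2) finV] by blast

lemma minimal_two_matching_iff:
  assumes "P \<subseteq> edges T" "L \<subseteq> verts T"
  shows "minimal_two_matching (with_loops T) (P <+> L) \<longleftrightarrow> minimal2 P L"
proof -
  have "(\<exists>M'. two_matching (with_loops T) M' \<and> card M' = card (P <+> L) \<and>
        loops (with_loops T) M' \<subset> loops (with_loops T) (P <+> L)) \<longleftrightarrow>
      (\<exists>P' L'. matching2 P' L' \<and> card P' + card L' = card P + card L \<and> L' \<subset> L)" (is "?l \<longleftrightarrow> ?r")
  proof
    assume ?l
    then obtain M' where M': "two_matching (with_loops T) M'" "card M' = card (P <+> L)"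
      "loops (with_loops T) M' \<subset> loops (with_loops T) (P <+> L)" by blast
    obtain P' L' where P': "M' = P' <+> L'" "P' \<subseteq> edges T" "L' \<subseteq> verts T"
      by (rule two_matching_Plus[OF M'(1)])
    have "Inr ` L' \<subset> (Inr ` L :: ('e + 'v) set)" using M'(3) unfolding P'(1) loops_Plus[OF P'(2)] loops_Plus[OF assms(1)] .
    then have "L' \<subset> L" by auto
    then show ?r using M' P' two_matching_iff[OF P'(2,3)] card_matching[OF P'(2,3)] card_matching[OF assms] by auto
  next
    assume ?r
    then obtain P' L' where P': "matching2 P' L'" "card P' + card L' = card P + card L" "L' \<subset> L" by blast
    then have s: "P' \<subseteq> edges T" "L' \<subseteq> verts T" by (auto simp: matching2_def)
    have "Inr ` L' \<subset> (Inr ` L :: ('e + 'v) set)" using P'(3) by auto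
    then show ?l using P' two_matching_iff[OF s] card_matching[OF s] card_matching[OF assms] loops_Plus[OF s(1)] loops_Plus[OF assms(1)]
      by (intro exI[of _ "P' <+> L'"]) auto
  qed
  then show ?thesis
    unfolding minimal_two_matching_def minimal2_def two_matching_iff[OF assms] by blast
qed

lemma d_poly_Plus:
  assumes "P \<subseteq> edges T"
  shows "d_poly X T (P <+> L) = det_on L A"
proof -
  have "\<Union>(ends (with_loops T) ` (Inr ` L)) = L" by (auto simp: with_loops_def)
  then show ?thesis unfolding d_poly_def loops_Plus[OF assms] A_matrix_forest by simp
qed

text \<open>Holding for every \<open>g\<close>, this identifies the gcd of the values
  \<open>d_poly\<close> with the gcd of all k-minors.\<close>

lemma minimal_two_matchings_minors:
  "(\<forall>M\<in>minimal_two_matchings (with_loops T) k. g dvd d_poly X T M) \<longleftrightarrow> minors_dvd (verts T) k (A_matrix X T) g"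
proof -
  have "(\<forall>M\<in>minimal_two_matchings (with_loops T) k. g dvd d_poly X T M) \<longleftrightarrow>
      (\<forall>P L. minimal2 P L \<and> card P + card L = k \<longrightarrow> g dvd det_on L A)" (is "?l \<longleftrightarrow> ?r")
  proof
    assume l: ?l
    show ?r
    proof (intro allI impI, elim conjE)
      fix P L assume m: "minimal2 P L" "card P + card L = k"
      then have s: "P \<subseteq> edges T" "L \<subseteq> verts T" by (auto simp: minimal2_def matching2_def)
      then have "P <+> L \<in> minimal_two_matchings (with_loops T) k"
        using m minimal_two_matching_iff[OF s] card_matching[OF s] by (simp add: minimal_two_matchings_def)
      then show "g dvd det_on L A" using l d_poly_Plus[OF s(1)] by metis
    qed
  next
    assume r: ?r
    show ?l
    proof
      fix M assume "M \<in> minimal_two_matchings (with_loops T) k"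
      then have M: "minimal_two_matching (with_loops T) M" "card M = k" by (auto simp: minimal_two_matchings_def)
      then have "two_matching (with_loops T) M" by (simp add: minimal_two_matching_def)
      then obtain P L where P: "M = P <+> L" "P \<subseteq> edges T" "L \<subseteq> verts T" by (rule two_matching_Plus)
      then show "g dvd d_poly X T M"
        using r M minimal_two_matching_iff[OF P(2,3)] card_matching[OF P(2,3)] d_poly_Plus[OF P(2)] by auto
    qed
  qed
  then show ?thesis
    unfolding minors_dvd_iff[OF finV] A_matrix_forest minimal_matchings_minors .
qed

end


section \<open>The structure of the sandpile group\<close>

text \<open>The matrix of the tree is indexed by faces and the Gram matrix by cycles; this carries
  minors from one to the other.\<close>

lemma minors_dvd_bij:
  assumes f: "bij_betw f S S'" and eq: "\<And>i j. i \<in> S \<Longrightarrow> j \<in> S \<Longrightarrow> A (f i) (f j) = B i j"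
  shows "minors_dvd S' k A g \<longleftrightarrow> minors_dvd S k B g"
proof
  assume *: "minors_dvd S' k A g"
  show "minors_dvd S k B g"
    unfolding minors_dvd_def
  proof (intro ballI)
    fix p q assume pq: "p \<in> {..<k} \<rightarrow> S" "q \<in> {..<k} \<rightarrow> S"
    then have "f \<circ> p \<in> {..<k} \<rightarrow> S'" "f \<circ> q \<in> {..<k} \<rightarrow> S'" using f by (auto simp: bij_betw_def)
    then have "g dvd det_on {..<k} (\<lambda>i j. A ((f \<circ> p) i) ((f \<circ> q) j))" using * unfolding minors_dvd_def by blast
    also have "det_on {..<k} (\<lambda>i j. A ((f \<circ> p) i) ((f \<circ> q) j)) = det_on {..<k} (\<lambda>i j. B (p i) (q j))"
      using pq by (intro det_on_cong) (auto intro!: eq)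
    finally show "g dvd det_on {..<k} (\<lambda>i j. B (p i) (q j))" .
  qed
next
  assume *: "minors_dvd S k B g"
  let ?f = "inv_into S f"
  have inv: "?f x \<in> S \<and> f (?f x) = x" if "x \<in> S'" for x
    using f that by (auto simp: bij_betw_def inv_into_into f_inv_into_f)
  show "minors_dvd S' k A g"
    unfolding minors_dvd_def
  proof (intro ballI)
    fix p q assume pq: "p \<in> {..<k} \<rightarrow> S'" "q \<in> {..<k} \<rightarrow> S'"
    then have "?f \<circ> p \<in> {..<k} \<rightarrow> S" "?f \<circ> q \<in> {..<k} \<rightarrow> S" using inv by (simp_all add: Pi_iff)
    then have "g dvd det_on {..<k} (\<lambda>i j. B ((?f \<circ> p) i) ((?f \<circ> q) j))" using * unfolding minors_dvd_def by blast
    also have "det_on {..<k} (\<lambda>i j. B ((?f \<circ> p) i) ((?f \<circ> q) j)) = det_on {..<k} (\<lambda>i j. A (p i) (q j))"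
    proof (rule det_on_cong)
      fix i j assume "i \<in> {..<k}" "j \<in> {..<k}"
      then have "p i \<in> S'" "q j \<in> S'" using pq by auto
      then show "B ((?f \<circ> p) i) ((?f \<circ> q) j) = A (p i) (q j)" using inv[of "p i"] inv[of "q j"] eq[of "?f (p i)" "?f (q j)"] by simp
    qed
    finally show "g dvd det_on {..<k} (\<lambda>i j. A (p i) (q j))" .
  qed
qed

lemma product_group_cong:
  assumes "\<And>i. i \<in> I \<Longrightarrow> G i = H i"
  shows "product_group I G = product_group I H"
  unfolding product_group_def using assms by (auto simp: fun_eq_iff restrict_def cong: PiE_cong)

lemma int_lattice_simps [simp]:
  "carrier (int_lattice V) = V \<rightarrow>\<^sub>E UNIV"
  "x \<otimes>\<^bsub>int_lattice V\<^esub> y = (\<lambda>i\<in>V. x i + y i)"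
  "\<one>\<^bsub>int_lattice V\<^esub> = (\<lambda>i\<in>V. 0)"
  by (simp_all add: int_lattice_def integer_group_def)

lemma comm_group_int_lattice: "comm_group (int_lattice V)"
proof -
  have "group (int_lattice V)" unfolding int_lattice_def by simp
  then show ?thesis
    by (rule group.group_comm_groupI) (simp add: add.commute)
qed

lemma int_lattice_pow:
  assumes "x \<in> carrier (int_lattice V)"
  shows "x [^]\<^bsub>int_lattice V\<^esub> (m :: nat) = (\<lambda>i\<in>V. int m * x i)"
proof -
  interpret comm_group "int_lattice V" by (rule comm_group_int_lattice)
  show ?thesis by (induction m) (auto simp: fun_eq_iff algebra_simps)
qed

context oriented_graph
begin

text \<open>The torsion consists of the classes of vectors with sum 0: the sum is additive, integer
  valued and vanishes on the Laplacian image, and conversely the product of all \<open>d k\<close>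
  annihilates these classes. Their coordinates are found by writing the vector as a boundary and
  applying \<open>\<phi>\<close> to the pairings.\<close>

theorem sandpile_group_iso:
  fixes \<phi> :: "(('v, 'e) dart list \<Rightarrow> int) \<Rightarrow> nat \<Rightarrow> int"
  assumes basis: "cycle_basis (edges G) \<C>" and conn: "connected_graph G"
    and d: "\<forall>k\<in>{1..n}. d k > 0"
    and \<phi>: "\<forall>x y. \<phi> (\<lambda>i. x i + y i) = (\<lambda>k. \<phi> x k + \<phi> y k)"
    and surj: "\<forall>t. \<exists>x. \<forall>k\<in>{1..n}. \<phi> x k = t k"
    and im: "\<forall>x. im_on \<C> gram x \<longleftrightarrow> (\<forall>k\<in>{1..n}. int (d k) dvd \<phi> x k)"
  shows "sandpile_group G \<cong> product_group {1..n} (\<lambda>k. integer_mod_group (d k))"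
proof -
  let ?V = "verts G" and ?Z = "int_lattice (verts G)" and ?P = "product_group {1..n} (\<lambda>k. integer_mod_group (d k))"
  let ?L = "\<lambda>f u. \<Sum>v\<in>verts G. laplacian G u v * f v"
  interpret Z: comm_group ?Z by (rule comm_group_int_lattice)
  define \<psi> where "\<psi> y = \<phi> (\<lambda>C. pair C y)" for y
  have \<phi>_diff: "\<phi> (\<lambda>i. x i - y i) k = \<phi> x k - \<phi> y k" for x y k
    using \<phi>[rule_format, of "\<lambda>i. x i - y i" y] by (simp add: fun_eq_iff)
  have \<psi>_add: "\<psi> (\<lambda>e. y e + y' e) k = \<psi> y k + \<psi> y' k" for y y' k
    unfolding \<psi>_def pair_add \<phi>[rule_format] ..
  have \<psi>_diff: "\<psi> (\<lambda>e. y e - y' e) k = \<psi> y k - \<psi> y' k" for y y' k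
    unfolding \<psi>_def pair_diff \<phi>_diff ..
  have \<psi>_scale: "\<psi> (\<lambda>e. int m * y e) k = int m * \<psi> y k" for m y k
  proof (induction m)
    case 0
    show ?case using \<psi>_diff[of y y k] by simp
  next
    case (Suc m)
    have "\<psi> (\<lambda>e. int (Suc m) * y e) k = \<psi> (\<lambda>e. int m * y e + y e) k" by (simp add: algebra_simps)
    then show ?case using Suc by (simp add: \<psi>_add algebra_simps)
  qed
  have key: "(\<exists>f. \<forall>u\<in>?V. bd y u = ?L f u) \<longleftrightarrow> (\<forall>k\<in>{1..n}. int (d k) dvd \<psi> y k)" for y
    unfolding \<psi>_def laplacian_image_iff[OF basis conn] using im by blast
  \<comment> \<open>An arbitrary edge function with boundary \<open>x\<close>. Two choices differ by
    a function without boundary, whose coordinates are divisible by \<open>d k\<close>, so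
    \<open>\<theta>\<close> does not depend on the choice.\<close>
  define Y where "Y x = (SOME y. \<forall>v\<in>?V. bd y v = x v)" for x
  define \<theta> where "\<theta> x = (\<lambda>k\<in>{1..n}. \<psi> (Y x) k mod int (d k))" for x
  define Z0 where "Z0 = {x \<in> carrier ?Z. (\<Sum>v\<in>?V. x v) = 0}"
  have Y: "bd (Y x) v = x v" if "x \<in> Z0" "v \<in> ?V" for x v
  proof -
    have "\<exists>y. \<forall>v\<in>?V. bd y v = x v" using bd_surj[OF conn, of x] that by (simp add: Z0_def)
    then have "\<forall>v\<in>?V. bd (Y x) v = x v" unfolding Y_def by (rule someI_ex)
    then show ?thesis using that by blast
  qed
  have \<theta>_eq: "\<theta> x k = \<psi> y k mod int (d k)" if x: "x \<in> Z0" and y: "\<forall>v\<in>?V. bd y v = x v" and k: "k \<in> {1..n}" for x y k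
  proof -
    have "\<forall>u\<in>?V. bd (\<lambda>e. Y x e - y e) u = ?L (\<lambda>_. 0) u" using Y[OF x] y by (simp add: bd_diff)
    then have "\<exists>f. \<forall>u\<in>?V. bd (\<lambda>e. Y x e - y e) u = ?L f u" by (rule exI[of _ "\<lambda>_. 0"])
    then have "int (d k) dvd \<psi> (\<lambda>e. Y x e - y e) k" using k unfolding key by blast
    then have "\<psi> (Y x) k mod int (d k) = \<psi> y k mod int (d k)" by (simp add: \<psi>_diff mod_eq_dvd_iff)
    then show ?thesis using k by (simp add: \<theta>_def)
  qed
  have sub: "subgroup Z0 ?Z"
  proof (rule Z.subgroupI)
    show "Z0 \<subseteq> carrier ?Z" by (auto simp: Z0_def)
    show "Z0 \<noteq> {}" using Z.one_closed by (auto simp: Z0_def intro!: exI[of _ "\<one>\<^bsub>?Z\<^esub>"])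
    show "x \<otimes>\<^bsub>?Z\<^esub> y \<in> Z0" if "x \<in> Z0" "y \<in> Z0" for x y
      using that by (auto simp: Z0_def sum.distrib)
    show "inv\<^bsub>?Z\<^esub> x \<in> Z0" if x: "x \<in> Z0" for x
    proof -
      have "inv\<^bsub>?Z\<^esub> x = (\<lambda>i\<in>?V. - x i)"
        using x by (intro Z.inv_equality) (auto simp: Z0_def)
      then show ?thesis using x by (simp add: Z0_def sum_negf)
    qed
  qed
  let ?D = "?Z\<lparr>carrier := Z0\<rparr>"
  have grpZ0: "group ?D" by (rule Z.subgroup_imp_group[OF sub])
  have grpP: "group ?P" by (rule product_group) simp
  have \<theta>_carrier: "\<theta> x \<in> carrier ?P" if "x \<in> Z0" for x
    using d by (auto simp: \<theta>_def carrier_integer_mod_group)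
  have hom: "\<theta> \<in> hom ?D ?P"
  proof (rule homI)
    fix x y assume "x \<in> carrier ?D" "y \<in> carrier ?D"
    then have xy: "x \<in> Z0" "y \<in> Z0" by simp_all
    then have xy': "x \<otimes>\<^bsub>?Z\<^esub> y \<in> Z0" by (rule subgroup.m_closed[OF sub])
    have "\<forall>v\<in>?V. bd (\<lambda>e. Y x e + Y y e) v = (x \<otimes>\<^bsub>?Z\<^esub> y) v"
    proof
      fix v assume v: "v \<in> ?V"
      have "bd (\<lambda>e. Y x e + Y y e) v = bd (Y x) v + bd (Y y) v"
        by (simp add: bd_def distrib_right sum.distrib)
      then show "bd (\<lambda>e. Y x e + Y y e) v = (x \<otimes>\<^bsub>?Z\<^esub> y) v" using Y xy v by simp
    qed
    then have "\<theta> (x \<otimes>\<^bsub>?Z\<^esub> y) k = \<psi> (\<lambda>e. Y x e + Y y e) k mod int (d k)" if "k \<in> {1..n}" for k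
      using \<theta>_eq[OF xy' _ that] by blast
    then have "\<theta> (x \<otimes>\<^bsub>?Z\<^esub> y) k = (\<theta> x k + \<theta> y k) mod int (d k)" if "k \<in> {1..n}" for k
      using that by (simp add: \<psi>_add \<theta>_def mod_add_eq)
    then have "\<theta> (x \<otimes>\<^bsub>?Z\<^esub> y) = (\<lambda>k\<in>{1..n}. (\<theta> x k + \<theta> y k) mod int (d k))"
      by (intro ext) (auto simp: \<theta>_def)
    then show "\<theta> (x \<otimes>\<^bsub>?D\<^esub> y) = \<theta> x \<otimes>\<^bsub>?P\<^esub> \<theta> y" by simp
  qed (use \<theta>_carrier in simp)
  interpret \<theta>: group_hom ?D ?P \<theta>
    using grpZ0 grpP hom by (simp add: group_hom_def group_hom_axioms_def)
  have onto: "\<theta> ` carrier ?D = carrier ?P"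
  proof
    show "\<theta> ` carrier ?D \<subseteq> carrier ?P" using \<theta>_carrier by auto
    show "carrier ?P \<subseteq> \<theta> ` carrier ?D"
    proof
      fix t assume t: "t \<in> carrier ?P"
      obtain z where z: "\<forall>k\<in>{1..n}. \<phi> z k = t k" using surj by blast
      obtain y where y: "\<forall>C\<in>\<C>. pair C y = z C" using cycle_basisD(4)[OF basis] by blast
      define x where "x = (\<lambda>v\<in>?V. bd y v)"
      have x: "x \<in> Z0" using bd_total[of y] by (simp add: x_def Z0_def)
      have "\<theta> x k = t k" if k: "k \<in> {1..n}" for k
      proof -
        \<comment> \<open>The pairings of \<open>y\<close> agree with \<open>z\<close> on
          \<open>\<C>\<close> only, while \<open>\<phi>\<close> takes functions on all dart lists.
          Their difference is trivially in the Gram image, so the coordinates agree modulo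
          \<open>d k\<close>.\<close>
        have "im_on \<C> gram (\<lambda>C. pair C y - z C)"
          unfolding im_on_def using y by (intro exI[of _ "\<lambda>_. 0"]) simp
        then have "int (d k) dvd \<psi> y k - t k" using im k z by (simp add: \<phi>_diff \<psi>_def)
        then have "\<psi> y k mod int (d k) = t k mod int (d k)" by (simp add: mod_eq_dvd_iff)
        also have "\<dots> = t k"
        proof -
          have "t k \<in> carrier (integer_mod_group (d k))" using t k by (simp add: PiE_iff)
          moreover have "d k > 0" using d k by blast
          ultimately show ?thesis by (simp add: carrier_integer_mod_group)
        qed
        finally show ?thesis using \<theta>_eq[OF x _ k, of y] by (simp add: x_def)
      qed
      then have "\<theta> x = t" using t by (intro ext) (auto simp: \<theta>_def PiE_iff extensional_def)
      then show "t \<in> \<theta> ` carrier ?D" using x by auto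
    qed
  qed
  have H_iff: "x \<in> laplacian_image G \<longleftrightarrow> x \<in> carrier ?Z \<and> (\<exists>f. \<forall>u\<in>?V. x u = ?L f u)" for x
  proof
    assume "x \<in> laplacian_image G"
    then show "x \<in> carrier ?Z \<and> (\<exists>f. \<forall>u\<in>?V. x u = ?L f u)" unfolding laplacian_image_def by auto
  next
    assume x: "x \<in> carrier ?Z \<and> (\<exists>f. \<forall>u\<in>?V. x u = ?L f u)"
    then obtain f where "\<forall>u\<in>?V. x u = ?L f u" by blast
    \<comment> \<open>Vectors of the lattice are extensional, so \<open>f\<close> has to be
      restricted as well.\<close>
    then have "x = (\<lambda>u\<in>?V. ?L (restrict f ?V) u)" using x by (auto simp: PiE_iff extensional_def)
    then show "x \<in> laplacian_image G"
      unfolding laplacian_image_def by (rule image_eqI[of _ _ "restrict f ?V"]) simp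
  qed
  have H_Z0: "laplacian_image G \<subseteq> Z0"
  proof
    fix x assume x: "x \<in> laplacian_image G"
    then obtain f where f: "\<forall>u\<in>?V. x u = ?L f u" using H_iff by blast
    have "(\<Sum>u\<in>?V. x u) = (\<Sum>u\<in>?V. bd (grad f) u)" using f by (simp add: laplacian_grad)
    then show "x \<in> Z0" using x H_iff bd_total by (simp add: Z0_def)
  qed
  have ker_iff: "x \<in> laplacian_image G \<longleftrightarrow> (\<forall>k\<in>{1..n}. int (d k) dvd \<psi> (Y x) k)" if x: "x \<in> Z0" for x
  proof -
    have "x \<in> laplacian_image G \<longleftrightarrow> (\<exists>f. \<forall>u\<in>?V. bd (Y x) u = ?L f u)"
      unfolding H_iff using x Y[OF x] by (simp add: Z0_def)
    then show ?thesis by (simp only: key)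
  qed
  have ker: "kernel ?D ?P \<theta> = laplacian_image G"
  proof -
    have "\<theta> x = \<one>\<^bsub>?P\<^esub> \<longleftrightarrow> x \<in> laplacian_image G" if x: "x \<in> Z0" for x
      unfolding ker_iff[OF x] by (auto simp: \<theta>_def fun_eq_iff restrict_def dvd_eq_mod_eq_0)
    then show ?thesis using H_Z0 by (auto simp: kernel_def)
  qed
  have subH: "subgroup (laplacian_image G) ?Z"
  proof -
    have "subgroup (laplacian_image G) ?D" unfolding ker[symmetric] by (rule \<theta>.subgroup_kernel)
    then show ?thesis using Z.incl_subgroup[OF sub] by blast
  qed
  interpret N: normal "laplacian_image G" ?Z by (rule Z.subgroup_imp_normal[OF subH])
  have coset_one: "(laplacian_image G #>\<^bsub>?Z\<^esub> x = laplacian_image G) \<longleftrightarrow> x \<in> laplacian_image G" if "x \<in> carrier ?Z" for x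
    using Z.coset_join1[OF _ that subH] Z.coset_join2[OF that subH] by blast
  have torsion: "(\<exists>m::nat. m > 0 \<and> (laplacian_image G #>\<^bsub>?Z\<^esub> x) [^]\<^bsub>?Z Mod laplacian_image G\<^esub> m = \<one>\<^bsub>?Z Mod laplacian_image G\<^esub>) \<longleftrightarrow> x \<in> Z0"
    if x: "x \<in> carrier ?Z" for x
  proof -
    have pow: "(laplacian_image G #>\<^bsub>?Z\<^esub> x) [^]\<^bsub>?Z Mod laplacian_image G\<^esub> m = \<one>\<^bsub>?Z Mod laplacian_image G\<^esub> \<longleftrightarrow>
        (\<lambda>i\<in>?V. int m * x i) \<in> laplacian_image G" for m :: nat
      using N.FactGroup_pow[OF x, of m] int_lattice_pow[OF x, of m] coset_one[of "(\<lambda>i\<in>?V. int m * x i)"] by simp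
    show ?thesis
      unfolding pow
    proof
      assume "\<exists>m::nat. m > 0 \<and> (\<lambda>i\<in>?V. int m * x i) \<in> laplacian_image G"
      then obtain m :: nat where m: "m > 0" "(\<lambda>i\<in>?V. int m * x i) \<in> Z0" using H_Z0 by blast
      then have "int m * (\<Sum>v\<in>?V. x v) = 0" by (simp add: Z0_def sum_distrib_left)
      then show "x \<in> Z0" using m x by (simp add: Z0_def)
    next
      assume x0: "x \<in> Z0"
      \<comment> \<open>A common multiple of the orders of all cyclic factors.\<close>
      define m where "m = (\<Prod>k=1..n. d k)"
      have m: "m > 0" using d by (auto simp: m_def intro!: prod_pos)
      have "\<exists>f. \<forall>u\<in>?V. bd (\<lambda>e. int m * Y x e) u = ?L f u"
        unfolding key \<psi>_scale
      proof
        fix k assume "k \<in> {1..n}"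
        then have "d k dvd m" unfolding m_def by (intro dvd_prodI) auto
        then show "int (d k) dvd int m * \<psi> (Y x) k" by simp
      qed
      then have "(\<lambda>i\<in>?V. int m * x i) \<in> laplacian_image G"
        unfolding H_iff using Y[OF x0] by (simp add: bd_scale)
      then show "\<exists>m::nat. m > 0 \<and> (\<lambda>i\<in>?V. int m * x i) \<in> laplacian_image G" using m by blast
    qed
  qed
  have "sandpile_group G = ?D Mod laplacian_image G"
  proof -
    have coset: "laplacian_image G #>\<^bsub>?D\<^esub> x = laplacian_image G #>\<^bsub>?Z\<^esub> x" for x
      by (simp add: r_coset_def)
    have "{C \<in> carrier (?Z Mod laplacian_image G). \<exists>m::nat. m > 0 \<and> C [^]\<^bsub>?Z Mod laplacian_image G\<^esub> m = \<one>\<^bsub>?Z Mod laplacian_image G\<^esub>} =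
        carrier (?D Mod laplacian_image G)"
      using torsion subgroup.subset[OF sub] by (auto simp: FactGroup_def RCOSETS_def coset)
    then show ?thesis
      unfolding sandpile_group_def torsion_subgroup_def
      by (simp add: FactGroup_def set_mult_def[abs_def])
  qed
  then show ?thesis using \<theta>.FactGroup_iso[OF onto] unfolding ker by simp
qed

end

theorem mainTheorem2:
  fixes G :: "(complex, complex set) mgraph"
    and T :: "(complex set, complex set) mgraph"
    and n :: nat
    and c :: "complex set \<Rightarrow> nat"
    and \<Delta> :: "nat \<Rightarrow> nat"
  assumes "outerplane G" and "biconnected G"
    and "T = weak_dual G" and "is_tree T" and "n = card (verts T)"
    and "\<And>F. F \<in> verts T \<Longrightarrow> c F = bounding_cycle_length G F"
    and "\<And>k. k \<in> {1..n} \<Longrightarrow>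
           int (\<Delta> k) =
             Gcd ((\<lambda>M. d_poly (\<lambda>F. int (c F)) T M) ` minimal_two_matchings (with_loops T) k)"
  shows "(\<forall>k \<in> {2..n}. \<Delta> (k - 1) dvd \<Delta> k) \<and>
    sandpile_group G \<cong>
      product_group {1..n}
        (\<lambda>k. integer_mod_group (if k = 1 then \<Delta> 1 else \<Delta> k div \<Delta> (k - 1))) \<and>
    num_spanning_trees G = \<Delta> n"
proof -
  interpret outerplane_gr G
    using assms(1,2) by unfold_locales (auto simp: outerplane_def)
  have ne: "verts T \<noteq> {}" using assms(4) by (simp add: is_tree_def connected_graph_def)
  have conn: "connected_graph G" using assms(2) by (simp add: biconnected_def)
  obtain \<C> where basis: "cycle_basis (edges G) \<C>" and bij: "bij_betw (\<lambda>C. inside (cset C)) \<C> (verts T)"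
    and wf: "\<forall>e\<in>edges T. ends T e \<subseteq> verts T \<and> card (ends T e) = 2" and finE: "finite (edges T)"
    and A: "\<forall>C\<in>\<C>. \<forall>D\<in>\<C>. A_matrix (\<lambda>F. int (bounding_cycle_length G F)) T (inside (cset C)) (inside (cset D)) = gram C D"
    using weak_dual_gram ne unfolding assms(3) by (elim meta_impE exE conjE) blast+
  have fin\<C>: "finite \<C>" by (rule cycle_basisD(1)[OF basis])
  have finV: "finite (verts T)" using bij_betw_finite[OF bij] fin\<C> by simp
  have n: "n = card \<C>" using bij_betw_same_card[OF bij] assms(5) by simp
  have n1: "n \<ge> 1" using ne finV assms(5) by (simp add: Suc_leI card_gt_0_iff)
  let ?X = "\<lambda>F. int (c F)"
  have A': "A_matrix ?X T (inside (cset C)) (inside (cset D)) = gram C D" if "C \<in> \<C>" "D \<in> \<C>" for C D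
  proof -
    have "inside (cset C) \<in> verts T" using bij that by (auto simp: bij_betw_def)
    then have c: "c (inside (cset C)) = bounding_cycle_length G (inside (cset C))" by (rule assms(6))
    have "A_matrix ?X T (inside (cset C)) (inside (cset D)) =
        A_matrix (\<lambda>F. int (bounding_cycle_length G F)) T (inside (cset C)) (inside (cset D))"
      unfolding A_matrix_def by (simp only: c)
    also have "\<dots> = gram C D" using A that by blast
    finally show ?thesis .
  qed
  have forest: "forest (verts T) (edges T) (ends T)"
    using tree_forest[OF assms(4) finV finE] wf by blast
  have det: "det_on \<C> gram \<noteq> 0" by (rule spanning_trees_gram(2)[OF basis conn])
  obtain d :: "nat \<Rightarrow> nat" and \<phi> where d: "\<forall>k\<in>{1..n}. d k > 0"
    and \<phi>: "\<forall>x y. \<phi> (\<lambda>i. x i + y i) = (\<lambda>k. \<phi> x k + \<phi> y k)"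
    and surj: "\<forall>t. \<exists>x. \<forall>k\<in>{1..n}. \<phi> x k = t k"
    and im: "\<forall>x. im_on \<C> gram x \<longleftrightarrow> (\<forall>k\<in>{1..n}. int (d k) dvd \<phi> x k)"
    and minors: "\<forall>k\<in>{1..n}. \<forall>g. minors_dvd \<C> k gram g \<longleftrightarrow> g dvd int (\<Prod>i=1..k. d i)"
    using cokernel_Smith[OF fin\<C> n det] by blast
  have \<Delta>: "\<Delta> k = (\<Prod>i=1..k. d i)" if k: "k \<in> {1..n}" for k
  proof -
    \<comment> \<open>Both numbers are shown to have the same divisors; taking either of them for
      \<open>g\<close> gives equality.\<close>
    have dd: "g dvd int (\<Delta> k) \<longleftrightarrow> g dvd int (\<Prod>i=1..k. d i)" for g
    proof -
      have "g dvd int (\<Delta> k) \<longleftrightarrow> (\<forall>M\<in>minimal_two_matchings (with_loops T) k. g dvd d_poly ?X T M)"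
        unfolding assms(7)[OF k] by (simp add: dvd_Gcd_iff)
      also have "\<dots> \<longleftrightarrow> minors_dvd (verts T) k (A_matrix ?X T) g"
        by (rule minimal_two_matchings_minors[OF forest])
      also have "\<dots> \<longleftrightarrow> minors_dvd \<C> k gram g"
        by (rule minors_dvd_bij[OF bij]) (rule A')
      also have "\<dots> \<longleftrightarrow> g dvd int (\<Prod>i=1..k. d i)" using minors k by blast
      finally show ?thesis .
    qed
    have "int (\<Delta> k) dvd int (\<Prod>i=1..k. d i)" "int (\<Prod>i=1..k. d i) dvd int (\<Delta> k)"
      using dd[of "int (\<Delta> k)"] dd[of "int (\<Prod>i=1..k. d i)"] by (simp_all only: dvd_refl)
    then show ?thesis by (simp only: of_nat_dvd_iff dvd_antisym)
  qed
  have pos: "(\<Prod>i=1..k. d i) > 0" if "k \<le> n" for k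
    using d that by (intro prod_pos) auto
  \<comment> \<open>Consecutive products differ by the factor \<open>d k\<close>, and positivity
    lets the quotient recover it.\<close>
  have step: "\<Delta> k = \<Delta> (k - 1) * d k" "\<Delta> (k - 1) > 0" if k: "k \<in> {2..n}" for k
  proof -
    obtain j where j: "k = Suc j" using k by (cases k) auto
    then have "\<Delta> k = (\<Prod>i=1..j. d i) * d k" "\<Delta> (k - 1) = (\<Prod>i=1..j. d i)" using \<Delta>[of k] \<Delta>[of "k - 1"] k by auto
    then show "\<Delta> k = \<Delta> (k - 1) * d k" "\<Delta> (k - 1) > 0" using pos[of j] j k by auto
  qed
  have "product_group {1..n} (\<lambda>k. integer_mod_group (if k = 1 then \<Delta> 1 else \<Delta> k div \<Delta> (k - 1))) =
      product_group {1..n} (\<lambda>k. integer_mod_group (d k))"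
  proof (rule product_group_cong)
    fix k assume k: "k \<in> {1..n}"
    show "integer_mod_group (if k = 1 then \<Delta> 1 else \<Delta> k div \<Delta> (k - 1)) = integer_mod_group (d k)"
    proof (cases "k = 1")
      case True
      then show ?thesis using \<Delta>[of 1] n1 by simp
    next
      case False
      then show ?thesis using step[of k] k by simp
    qed
  qed
  moreover have "num_spanning_trees G = \<Delta> n"
  proof -
    have dd: "g dvd int (num_spanning_trees G) \<longleftrightarrow> g dvd int (\<Delta> n)" for g
      using minors n1 \<Delta>[of n] minors_dvd_card[OF fin\<C>, of gram g] n
      unfolding spanning_trees_gram(1)[OF basis conn] by simp
    have "int (num_spanning_trees G) dvd int (\<Delta> n)" "int (\<Delta> n) dvd int (num_spanning_trees G)"
      using dd[of "int (num_spanning_trees G)"] dd[of "int (\<Delta> n)"] by (simp_all only: dvd_refl)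
    then show ?thesis by (simp only: of_nat_dvd_iff dvd_antisym)
  qed
  ultimately show ?thesis
    using sandpile_group_iso[OF basis conn d \<phi> surj im] step by auto
qed

end
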